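(* Let $\gamma>1/3$, let $\mathbb{X}=(X,\mathbb{X}^2)$ be a $\gamma$-rough path, and let $A:\mathbb{R}^3\to\mathbb{R}^3\otimes\mathbb{R}^3$ be a matrix field with $\|\nabla A\|_4<\infty$. Then there exists a time $T_0>0$, depending only on $\|\nabla A\|_3$, $\mathbb{X}=(X,\mathbb{X}^2)$ and $\gamma$, such that for any $0<T\le T_0$ the equation $$Y(t)_\xi=X_\xi+\int_0^tV^{Y(s)}(Y(s)_\xi)\,ds,\qquad t\in[0,T],\ \xi\in[0,1],$$ has a unique solution bounded in $\mathscr{D}_X$, i.e. the map $F$ has a unique fixed point $Y$ in $\mathbf{D}_{X,T}=C([0,T],\mathscr{D}_X)$.
   Context: $\mathscr{C}$ is the set of continuous closed curves $X:[0,1]\to\mathbb{R}^3$, $X_0=X_1$. $\|X\|_\gamma=\sup_{\xi\ne\eta}|X_\xi-X_\eta|/|\xi-\eta|^\gamma$ (also for matrix-valued functions), $\|X\|_\infty=\sup_\xi|X_\xi|$, and $\mathscr{C}^\gamma=\{X\in\mathscr{C}:\|X\|_\infty+\|X\|_\gamma<\infty\}$. For functions of two variables, $\|R\|_{2\gamma}=\sup_{\xi\neq\eta}|R_{\xi\eta}|/|\xi-\eta|^{2\gamma}$. The norm of a tensor is the sum of the absolute values of its components; for a tensor field $\varphi$ on $\mathbb{R}^3$, $\|\varphi\|=\sup_x|\varphi(x)|$ and $\|\varphi\|_n=\sum_{k=0}^n\|\nabla^k\varphi\|$. A $\gamma$-rough path is a couple $\mathbb{X}=(X,\mathbb{X}^2)$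 with $X\in\mathscr{C}^\gamma$, $\mathbb{X}^2\in C([0,1]^2,\mathbb{R}^3\otimes\mathbb{R}^3)$, $\|\mathbb{X}^2\|_{2\gamma}<\infty$ and $$\mathbb{X}^{2,ij}_{\xi\rho}-\mathbb{X}^{2,ij}_{\xi\eta}-\mathbb{X}^{2,ij}_{\eta\rho}=(X^i_\xi-X^i_\eta)(X^j_\eta-X^j_\rho),\qquad \xi,\eta,\rho\in[0,1].$$ $\mathscr{D}_X$ (paths weakly controlled by $X$) is the Banach space of paths $Y\in\mathscr{C}$, together with $Y'\in C^\gamma([0,1],\mathbb{R}^3\otimes\mathbb{R}^3)$, such that $Y_\xi-Y_\eta=Y'_\eta(X_\xi-X_\eta)+R^Y_{\eta\xi}$ with $\|R^Y\|_{2\gamma}<\infty$; an element is understood as the pair $(Y,Y')$. Norms: $\|Y\|_D=\|Y'\|_\gamma+\|R^Y\|_{2\gamma}+\|Y'\|_\infty$, $\|Y\|_D^*=\|Y\|_D+\|Y\|_\infty$. The path $X$ itself is the element with $X'=\mathrm{Id}$, $R^X=0$. $\mathbf{D}_{X,T}=C([0,T],\mathscr{D}_X)$ has norm $\sup_{t\in[0,T]}\|Y(t)\|_D^*$. For $Y\in\mathscr{D}_X$, $V^Y(x)=\int_0^1A(x-Y_\eta)\,dY_\eta$ is a rough integral: its $i$-th component is the limit, as the mesh of the partition $0=\xi_0<\dots<\xi_n=1$ goes to $0$, of $$\sum_{k=0}^{n-1}\Big[\sum_jA^{ij}(x-Y_{\xi_k})(Y^j_{\xi_{k+1}}-Y^j_{\xi_k})+\sum_{j,a,c}(Z^{ij})'^{\,a}_{\xi_k}(Y'_{\xi_k})^{jc}\,\mathbb{X}^{2,ac}_{\xi_k\xi_{k+1}}\Big],$$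 where $(Z^{ij})'^{\,a}_\eta=-\sum_b\partial_bA^{ij}(x-Y_\eta)(Y'_\eta)^{ba}$ is the derivative with respect to $X$ of the controlled path $Z^{ij}_\eta=A^{ij}(x-Y_\eta)$. The map $F:\mathbf{D}_{X,T}\to\mathbf{D}_{X,T}$ is $F(Y)(t)_\xi=X_\xi+\int_0^tV^{Y(s)}(Y(s)_\xi)\,ds$, with derivative $[F(Y)(t)'_\xi]=\mathrm{Id}+\int_0^t\nabla V^{Y(s)}(Y(s)_\xi)\,Y(s)'_\xi\,ds$, where $(\nabla V)^{ik}=\partial_kV^i$. *)

theory Defs
  imports "HOL-Analysis.Analysis"
begin

text \<open>Norms are \<open>ennreal\<close>-valued, so that being finite is a genuine condition.\<close>

definition tensor_norm :: "'v::euclidean_space \<Rightarrow> real" where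
  "tensor_norm v = (\<Sum>b\<in>Basis. \<bar>v \<bullet> b\<bar>)"

definition sup_norm01 :: "(real \<Rightarrow> 'v::euclidean_space) \<Rightarrow> ennreal" where
  "sup_norm01 f = (SUP \<xi>\<in>{0..1}. ennreal (tensor_norm (f \<xi>)))"

definition two_param_norm :: "real \<Rightarrow> (real \<Rightarrow> real \<Rightarrow> 'v::euclidean_space) \<Rightarrow> ennreal" where
  "two_param_norm \<alpha> R =
     (SUP (\<xi>, \<eta>)\<in>{(\<xi>, \<eta>). \<xi> \<in> {0..1} \<and> \<eta> \<in> {0..1} \<and> \<xi> \<noteq> \<eta>}.
        ennreal (tensor_norm (R \<xi> \<eta>) / \<bar>\<xi> - \<eta>\<bar> powr \<alpha>))"

definition hoelder_norm :: "real \<Rightarrow> (real \<Rightarrow> 'v::euclidean_space) \<Rightarrow> ennreal" where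
  "hoelder_norm \<alpha> f = two_param_norm \<alpha> (\<lambda>\<xi> \<eta>. f \<xi> - f \<eta>)"

definition partial :: "3 \<Rightarrow> (real^3 \<Rightarrow> 'v::euclidean_space) \<Rightarrow> real^3 \<Rightarrow> 'v" where
  "partial b \<phi> x = frechet_derivative \<phi> (at x) (axis b 1)"

primrec iter_partial :: "3 list \<Rightarrow> (real^3 \<Rightarrow> 'v::euclidean_space) \<Rightarrow> real^3 \<Rightarrow> 'v" where
  "iter_partial [] \<phi> = \<phi>"
| "iter_partial (b # bs) \<phi> = partial b (iter_partial bs \<phi>)"

text \<open>\<open>n\<close>-fold Frechet differentiability on the whole space; the derivatives of order \<open>n\<close>
  need not be continuous.\<close>

definition times_differentiable :: "nat \<Rightarrow> (real^3 \<Rightarrow> 'v::euclidean_space) \<Rightarrow> bool" where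
  "times_differentiable n \<phi> \<longleftrightarrow>
     (\<forall>bs. length bs < n \<longrightarrow> (\<forall>x. iter_partial bs \<phi> differentiable (at x)))"

definition grad :: "(real^3 \<Rightarrow> 'v::euclidean_space) \<Rightarrow> real^3 \<Rightarrow> 'v^3" where
  "grad \<phi> x = (\<chi> b. partial b \<phi> x)"

text \<open>The components of \<open>\<nabla>\<^sup>k\<phi>\<close> are those of the iterated partial derivatives of \<open>\<phi>\<close>
  along all index lists of length \<open>k\<close>. The norm is meaningful for \<open>n\<close> times differentiable
  \<open>\<phi>\<close> only; differentiability has to be required separately.\<close>

definition deriv_norm :: "nat \<Rightarrow> (real^3 \<Rightarrow> 'v::euclidean_space) \<Rightarrow> ennreal" where
  "deriv_norm k \<phi> =
     (SUP x. ennreal (\<Sum>bs | length bs = k. tensor_norm (iter_partial bs \<phi> x)))"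

definition field_norm :: "nat \<Rightarrow> (real^3 \<Rightarrow> 'v::euclidean_space) \<Rightarrow> ennreal" where
  "field_norm n \<phi> = (\<Sum>k\<le>n. deriv_norm k \<phi>)"

definition closed_curve :: "(real \<Rightarrow> real^3) \<Rightarrow> bool" where
  "closed_curve X \<longleftrightarrow> path X \<and> pathfinish X = pathstart X"

definition hoelder_closed_curve :: "real \<Rightarrow> (real \<Rightarrow> real^3) \<Rightarrow> bool" where
  "hoelder_closed_curve \<gamma> X \<longleftrightarrow> closed_curve X \<and> sup_norm01 X + hoelder_norm \<gamma> X < \<infinity>"

definition rough_path :: "real \<Rightarrow> (real \<Rightarrow> real^3) \<Rightarrow> (real \<Rightarrow> real \<Rightarrow> real^3^3) \<Rightarrow> bool" where
  "rough_path \<gamma> X XX \<longleftrightarrow>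
     hoelder_closed_curve \<gamma> X \<and>
     continuous_on ({0..1} \<times> {0..1}) (\<lambda>(\<xi>, \<eta>). XX \<xi> \<eta>) \<and>
     two_param_norm (2 * \<gamma>) XX < \<infinity> \<and>
     (\<forall>\<xi>\<in>{0..1}. \<forall>\<eta>\<in>{0..1}. \<forall>\<rho>\<in>{0..1}. \<forall>i j.
        XX \<xi> \<rho> $ i $ j - XX \<xi> \<eta> $ i $ j - XX \<eta> \<rho> $ i $ j
        = (X \<xi> $ i - X \<eta> $ i) * (X \<eta> $ j - X \<rho> $ j))"

text \<open>A controlled path is a pair \<open>(Y, Y')\<close>.\<close>

type_synonym controlled = "(real \<Rightarrow> real^3) \<times> (real \<Rightarrow> real^3^3)"

text \<open>\<open>remainder X Y \<eta> \<xi>\<close> is \<open>R\<^sup>Y\<close> at \<open>(\<eta>, \<xi>)\<close>: the base point comes first.\<close>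

definition remainder :: "(real \<Rightarrow> real^3) \<Rightarrow> controlled \<Rightarrow> real \<Rightarrow> real \<Rightarrow> real^3" where
  "remainder X Y \<eta> \<xi> = fst Y \<xi> - fst Y \<eta> - snd Y \<eta> *v (X \<xi> - X \<eta>)"

text \<open>Functions on the unit interval are made extensional, so that equality of elements
  of the space means equality on the unit interval.\<close>

definition controlled_space :: "real \<Rightarrow> (real \<Rightarrow> real^3) \<Rightarrow> controlled set" where
  "controlled_space \<gamma> X =
     {Y. fst Y \<in> extensional {0..1} \<and> snd Y \<in> extensional {0..1} \<and>
         closed_curve (fst Y) \<and>
         sup_norm01 (snd Y) + hoelder_norm \<gamma> (snd Y) < \<infinity> \<and>
         two_param_norm (2 * \<gamma>) (remainder X Y) < \<infinity>}"

definition D_norm :: "real \<Rightarrow> (real \<Rightarrow> real^3) \<Rightarrow> controlled \<Rightarrow> ennreal" where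
  "D_norm \<gamma> X Y =
     hoelder_norm \<gamma> (snd Y) + two_param_norm (2 * \<gamma>) (remainder X Y) + sup_norm01 (snd Y)"

definition D_norm_star :: "real \<Rightarrow> (real \<Rightarrow> real^3) \<Rightarrow> controlled \<Rightarrow> ennreal" where
  "D_norm_star \<gamma> X Y = D_norm \<gamma> X Y + sup_norm01 (fst Y)"

definition controlled_diff :: "controlled \<Rightarrow> controlled \<Rightarrow> controlled" where
  "controlled_diff Y Z = (\<lambda>\<xi>. fst Y \<xi> - fst Z \<xi>, \<lambda>\<xi>. snd Y \<xi> - snd Z \<xi>)"

text \<open>The space \<open>C([0,T], D\<^sub>X)\<close>, with continuity taken with respect to the norm
  \<open>D_norm_star\<close>.\<close>

definition controlled_evolutions ::
  "real \<Rightarrow> (real \<Rightarrow> real^3) \<Rightarrow> real \<Rightarrow> (real \<Rightarrow> controlled) set" where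
  "controlled_evolutions \<gamma> X T =
     {Y. Y \<in> extensional {0..T} \<and>
         (\<forall>t\<in>{0..T}. Y t \<in> controlled_space \<gamma> X) \<and>
         (\<forall>t\<in>{0..T}. ((\<lambda>s. D_norm_star \<gamma> X (controlled_diff (Y s) (Y t))) \<longlongrightarrow> 0)
                        (at t within {0..T}))}"

definition partition01 :: "nat \<Rightarrow> (nat \<Rightarrow> real) \<Rightarrow> bool" where
  "partition01 n p \<longleftrightarrow> p 0 = 0 \<and> p n = 1 \<and> (\<forall>k<n. p k < p (Suc k))"

definition mesh_limit :: "(nat \<Rightarrow> (nat \<Rightarrow> real) \<Rightarrow> real) \<Rightarrow> real \<Rightarrow> bool" where
  "mesh_limit S L \<longleftrightarrow>
     (\<forall>\<epsilon>>0. \<exists>\<delta>>0. \<forall>n p. partition01 n p \<longrightarrow> (\<forall>k<n. p (Suc k) - p k < \<delta>) \<longrightarrow>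
        \<bar>S n p - L\<bar> < \<epsilon>)"

text \<open>The derivative with respect to \<open>X\<close> of the controlled path \<open>\<eta> \<mapsto> A\<^sup>i\<^sup>j (x - Y\<^sub>\<eta>)\<close>.\<close>

definition Z_deriv ::
  "(real^3 \<Rightarrow> real^3^3) \<Rightarrow> controlled \<Rightarrow> real^3 \<Rightarrow> 3 \<Rightarrow> 3 \<Rightarrow> 3 \<Rightarrow> real \<Rightarrow> real" where
  "Z_deriv A Y x i j a \<eta> =
     - (\<Sum>b\<in>UNIV. partial b A (x - fst Y \<eta>) $ i $ j * snd Y \<eta> $ b $ a)"

definition rough_sum ::
  "(real^3 \<Rightarrow> real^3^3) \<Rightarrow> (real \<Rightarrow> real \<Rightarrow> real^3^3) \<Rightarrow> controlled \<Rightarrow> real^3 \<Rightarrow> 3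
    \<Rightarrow> nat \<Rightarrow> (nat \<Rightarrow> real) \<Rightarrow> real" where
  "rough_sum A XX Y x i n p =
     (\<Sum>k<n.
        (\<Sum>j\<in>UNIV. A (x - fst Y (p k)) $ i $ j * (fst Y (p (Suc k)) $ j - fst Y (p k) $ j)) +
        (\<Sum>j\<in>UNIV. \<Sum>a\<in>UNIV. \<Sum>c\<in>UNIV.
           Z_deriv A Y x i j a (p k) * snd Y (p k) $ j $ c * XX (p k) (p (Suc k)) $ a $ c))"

text \<open>The rough integral of \<open>A (x - Y\<^sub>\<eta>)\<close> against \<open>dY\<^sub>\<eta>\<close>. A \<open>mesh_limit\<close> is unique if it
  exists, since there are partitions of arbitrarily small mesh.\<close>

definition velocity ::
  "(real^3 \<Rightarrow> real^3^3) \<Rightarrow> (real \<Rightarrow> real \<Rightarrow> real^3^3) \<Rightarrow> controlled \<Rightarrow> real^3 \<Rightarrow> real^3" where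
  "velocity A XX Y x = (\<chi> i. THE L. mesh_limit (rough_sum A XX Y x i) L)"

text \<open>\<open>jacobian\<close> has the entry \<open>\<partial>\<^sub>kV\<^sup>i\<close> in row \<open>i\<close> and column \<open>k\<close>.\<close>

definition evolution_map ::
  "(real^3 \<Rightarrow> real^3^3) \<Rightarrow> (real \<Rightarrow> real^3) \<Rightarrow> (real \<Rightarrow> real \<Rightarrow> real^3^3) \<Rightarrow> real
    \<Rightarrow> (real \<Rightarrow> controlled) \<Rightarrow> real \<Rightarrow> controlled" where
  "evolution_map A X XX T Y =
     (\<lambda>t\<in>{0..T}.
        (\<lambda>\<xi>\<in>{0..1}. X \<xi> + integral {0..t} (\<lambda>s. velocity A XX (Y s) (fst (Y s) \<xi>)),
         \<lambda>\<xi>\<in>{0..1}. mat 1 + integral {0..t}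
            (\<lambda>s. jacobian (velocity A XX (Y s)) (at (fst (Y s) \<xi>)) ** snd (Y s) \<xi>)))"

end

theory Submission
  imports Defs
begin

text \<open>The map \<open>F\<close> integrates in time the vector field
\<open>G(Y) = (V\<^sup>Y(Y), \<nabla>V\<^sup>Y(Y) Y')\<close> on the space of controlled paths, so the theorem is a
Picard theorem in \<open>D\<^sub>X\<close>. Two estimates carry it. On a ball of radius \<open>M\<close> the field \<open>G\<close> is
bounded by a constant that involves only derivatives of \<open>A\<close> up to order four
(\<open>ctrl_transport\<close>), and it is Lipschitz there with a constant that involves one derivative
more (\<open>ctrl_transport_diff\<close>). The lifetime comes from the first estimate alone: it is chosen
so that the Picard iteration started at \<open>(X, Id)\<close> stays in the ball of radius \<open>\<kappa> + 1\<close>,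
where \<open>\<kappa>\<close> bounds the data of the rough path. Convergence on the whole of \<open>[0,T]\<close> is not
bought by a shorter time but by the weight \<open>exp (2\<Lambda>t)\<close>, under which \<open>F\<close> halves distances
(\<open>evolution_map_contraction\<close>); this is why the fifth derivative does not enter the lifetime.
The same halving gives uniqueness: an element of \<open>C([0,T], D\<^sub>X)\<close> is bounded by compactness, so
any two fixed points lie in a common ball and their weighted distance is at most half of itself.

The rough integral is constructed by sewing along dyadic grids. If a germ \<open>\<Xi>\<close> is additive up
to \<open>C \<bar>t - s\<bar>\<^sup>\<theta>\<close> with \<open>\<theta> > 1\<close>, then refining a grid changes its sum by a geometrically small
amount; the limit is additive and differs from \<open>\<Xi>\<close> on every interval by a power of its length
larger than one, which forces the sums over all partitions of small mesh to the same
limit. Chen's relation makes the defect of the rough germ of order \<open>3\<gamma> > 1\<close>. For an integral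
around a closed curve the first-order term of the germ of the full interval vanishes, so
\<open>V\<^sup>Y\<close> is controlled by \<open>\<nabla>A\<close> and \<open>\<nabla>\<^sup>2A\<close>, although \<open>A\<close> itself may be unbounded.

The integral is linear in the kernel. Derivatives of \<open>V\<^sup>Y\<close> are therefore obtained by inserting
increments and linearization errors of \<open>A\<close> as kernels, which are small as fields with Lipschitz
derivative. Lipschitz dependence on the path is reduced to boundedness: along the segment
between two controlled paths the composition \<open>f(Y)\<close> has as derivative a product of two
controlled paths, and the mean value theorem applies to every quantity in the norm
(\<open>ctrl_compose_diff\<close>).

Derivatives are bounded linear maps throughout, so that \<open>\<nabla>\<close> can be iterated and each estimate
is proved once for fields with values in an arbitrary normed space; all norms are replaced by
predicates \<open>ctrl N\<close> that assert the individual bounds with constant \<open>N\<close>.\<close>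

section \<open>Sewing almost additive germs along dyadic grids\<close>

definition clip :: "real \<Rightarrow> real \<Rightarrow> real \<Rightarrow> real" where
  "clip s t x = max s (min x t)"

text \<open>Clipping lets the grid of \<open>[0,1]\<close> serve every subinterval: pieces outside \<open>[s,t]\<close> collapse to a
point, where an almost additive germ vanishes. Additivity of the limit in the interval becomes a
comparison of sums over one and the same grid.\<close>

definition dyadic_sum :: "(real \<Rightarrow> real \<Rightarrow> 'b::real_normed_vector) \<Rightarrow> nat \<Rightarrow> real \<Rightarrow> real \<Rightarrow> 'b" where
  "dyadic_sum \<Xi> n s t =
     (\<Sum>k<2^n. \<Xi> (clip s t (real k / 2^n)) (clip s t (real (Suc k) / 2^n)))"

lemma sum_pairs: "(\<Sum>k<2 * m. f k) = (\<Sum>k<m. f (2 * k) + f (Suc (2 * k)))"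
  for f :: "nat \<Rightarrow> 'b::comm_monoid_add"
  by (induction m) (auto simp: algebra_simps)

lemma half_power_powr: "((1/2)^n) powr e = (2 powr (-e)) ^ n" for e :: real
proof -
  have "((1/2)^n :: real) = 2 powr (- real n)"
    by (simp add: powr_minus powr_realpow power_one_over inverse_eq_divide)
  then have "((1/2)^n) powr e = 2 powr (- real n * e)" by (simp only: powr_powr)
  also have "\<dots> = (2 powr (-e)) powr real n" by (simp only: powr_powr) (simp add: mult.commute)
  finally show ?thesis by (simp add: powr_realpow)
qed

lemma clip_mono: "s \<le> t \<Longrightarrow> x \<le> y \<Longrightarrow> clip s t x \<le> clip s t y"
  by (auto simp: clip_def)

lemma clip_bounds: "s \<le> t \<Longrightarrow> s \<le> clip s t x \<and> clip s t x \<le> t"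
  by (auto simp: clip_def)

lemma clip_diff_le: "s \<le> t \<Longrightarrow> x \<le> y \<Longrightarrow> clip s t y - clip s t x \<le> y - x"
  by (auto simp: clip_def)

locale almost_additive =
  fixes \<Xi> :: "real \<Rightarrow> real \<Rightarrow> 'b::banach" and C \<theta> :: real
  assumes C_nonneg: "C \<ge> 0" and \<theta>_gt_1: "\<theta> > 1"
    and defect: "\<And>s u t. 0 \<le> s \<Longrightarrow> s \<le> u \<Longrightarrow> u \<le> t \<Longrightarrow> t \<le> 1 \<Longrightarrow>
      norm (\<Xi> s t - \<Xi> s u - \<Xi> u t) \<le> C * (t - s) powr \<theta>"
begin

text \<open>Half of the excess of \<open>\<theta>\<close> over one is spent on the decay in the level of the grid, the other
half on the power of the length of the interval.\<close>

definition \<epsilon> where "\<epsilon> = (\<theta> - 1) / 2"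

lemma \<epsilon>_pos: "\<epsilon> > 0"
  using \<theta>_gt_1 by (simp add: \<epsilon>_def)

lemma diag: "0 \<le> s \<Longrightarrow> s \<le> 1 \<Longrightarrow> \<Xi> s s = 0"
  using defect[of s s s] by simp

lemma clip_unit: "0 \<le> s \<Longrightarrow> s \<le> t \<Longrightarrow> t \<le> 1 \<Longrightarrow> 0 \<le> clip s t x \<and> clip s t x \<le> 1"
  using clip_bounds[of s t x] by auto

lemma dyadic_sum_0: "0 \<le> s \<Longrightarrow> s \<le> t \<Longrightarrow> t \<le> 1 \<Longrightarrow> dyadic_sum \<Xi> 0 s t = \<Xi> s t"
  by (simp add: dyadic_sum_def clip_def)

text \<open>Halving the grid inserts one point in each piece and changes the sum by the defects. A piece
of length \<open>l \<le> min (2\<^sup>-\<^sup>n) (t - s)\<close> contributes \<open>l\<^sup>\<theta> \<le> l \<cdot> (2\<^sup>-\<^sup>n)\<^sup>\<epsilon> \<cdot> (t - s)\<^sup>\<epsilon>\<close>, and the lengths add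
up to \<open>t - s\<close>.\<close>

lemma dyadic_sum_Suc_diff:
  assumes "0 \<le> s" "s \<le> t" "t \<le> 1"
  shows "norm (dyadic_sum \<Xi> (Suc n) s t - dyadic_sum \<Xi> n s t)
    \<le> C * (t - s) powr (1 + \<epsilon>) * (2 powr (-\<epsilon>)) ^ n"
proof -
  define a where "a k = clip s t (real k / 2^n)" for k
  define m where "m k = clip s t (real (2 * k + 1) / 2^Suc n)" for k
  have a_mono: "a k \<le> m k" "m k \<le> a (Suc k)" for k
    unfolding a_def m_def by (intro clip_mono assms; simp add: field_simps)+
  have len: "a (Suc k) - a k \<le> (1/2)^n" for k
  proof -
    have "real (Suc k) / 2^n - real k / 2^n = (1/2)^n" "real k / 2^n \<le> real (Suc k) / 2^n"
      by (simp_all add: divide_simps power_one_over)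
    then show ?thesis
      using clip_diff_le[of s t "real k / 2^n" "real (Suc k) / 2^n"] assms by (simp add: a_def)
  qed
  have tele: "(\<Sum>k<K. a (Suc k) - a k) = a K - a 0" for K
    by (induction K) auto
  have tele: "(\<Sum>k<2^n. a (Suc k) - a k) = t - s"
    using tele[of "2^n"] assms by (simp add: a_def clip_def)
  have "dyadic_sum \<Xi> (Suc n) s t = (\<Sum>k<2^n. \<Xi> (a k) (m k) + \<Xi> (m k) (a (Suc k)))"
  proof -
    have "real (2 * k) / 2 ^ Suc n = real k / 2 ^ n"
      "real (Suc (Suc (2 * k))) / 2 ^ Suc n = real (Suc k) / 2 ^ n" for k
      by (simp_all add: divide_simps)
    then show ?thesis
      unfolding dyadic_sum_def a_def m_def power_Suc sum_pairs by simp
  qed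
  then have "dyadic_sum \<Xi> (Suc n) s t - dyadic_sum \<Xi> n s t
      = (\<Sum>k<2^n. - (\<Xi> (a k) (a (Suc k)) - \<Xi> (a k) (m k) - \<Xi> (m k) (a (Suc k))))"
    by (simp add: dyadic_sum_def a_def sum_subtractf[symmetric] algebra_simps)
  also have "norm \<dots> \<le> (\<Sum>k<2^n. C * (a (Suc k) - a k) powr \<theta>)"
  proof (rule sum_norm_le)
    fix k
    have "0 \<le> a k" "a (Suc k) \<le> 1"
      using assms clip_unit by (auto simp: a_def)
    then show "norm (- (\<Xi> (a k) (a (Suc k)) - \<Xi> (a k) (m k) - \<Xi> (m k) (a (Suc k))))
        \<le> C * (a (Suc k) - a k) powr \<theta>"
      unfolding norm_minus_cancel using a_mono[of k] by (intro defect) auto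
  qed
  also have "\<dots> \<le> (\<Sum>k<2^n. C * ((a (Suc k) - a k) * (((1/2)^n) powr \<epsilon> * (t - s) powr \<epsilon>)))"
  proof (intro sum_mono mult_left_mono C_nonneg)
    fix k
    let ?l = "a (Suc k) - a k"
    have l0: "?l \<ge> 0" using a_mono[of k] by auto
    have l1: "?l \<le> t - s" using clip_bounds assms by (auto simp: a_def intro!: diff_mono)
    have "?l powr \<theta> = ?l * (?l powr \<epsilon> * ?l powr \<epsilon>)"
    proof (cases "?l = 0")
      case False
      have "?l powr \<theta> = ?l powr (1 + \<epsilon> + \<epsilon>)" by (simp add: \<epsilon>_def field_simps)
      also have "\<dots> = ?l * (?l powr \<epsilon> * ?l powr \<epsilon>)" using False l0 by (simp only: powr_add) simp
      finally show ?thesis .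
    qed simp
    also have "\<dots> \<le> ?l * (((1/2)^n) powr \<epsilon> * (t - s) powr \<epsilon>)"
      using l0 l1 len[of k] \<epsilon>_pos by (intro mult_left_mono mult_mono powr_mono2) auto
    finally show "?l powr \<theta> \<le> ?l * (((1/2)^n) powr \<epsilon> * (t - s) powr \<epsilon>)" .
  qed
  also have "\<dots> = C * (t - s) powr \<epsilon> * (t - s) * ((1/2)^n) powr \<epsilon>"
    unfolding sum_distrib_left[symmetric] sum_distrib_right[symmetric] tele by (simp add: algebra_simps)
  also have "((1/2)^n) powr \<epsilon> = (2 powr (-\<epsilon>)) ^ n"
    by (rule half_power_powr)
  also have "C * (t - s) powr \<epsilon> * (t - s) = C * (t - s) powr (1 + \<epsilon>)"
    using powr_mult_base[of "t - s" \<epsilon>] assms by (simp add: mult.commute)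
  finally show ?thesis .
qed

text \<open>\<open>H s t\<close> is the integral of the germ over \<open>[s,t]\<close>, and \<open>S\<close> is the sum of the geometric series
that bounds its distance from \<open>\<Xi> s t\<close>.\<close>

definition H where "H s t = lim (\<lambda>n. dyadic_sum \<Xi> n s t)"

definition S where "S = 1 / (1 - 2 powr (-\<epsilon>))"

lemma q_lt_1: "2 powr (-\<epsilon>) < 1"
  using \<epsilon>_pos by (simp add: powr_less_one)

lemma S_pos: "S > 0" using q_lt_1 by (simp add: S_def)

lemma dyadic_limit:
  assumes "0 \<le> s" "s \<le> t" "t \<le> 1"
  shows "(\<lambda>n. dyadic_sum \<Xi> n s t) \<longlonglongrightarrow> H s t"
    and "norm (H s t - \<Xi> s t) \<le> C * S * (t - s) powr (1 + \<epsilon>)"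
proof -
  let ?d = "\<lambda>n. dyadic_sum \<Xi> (Suc n) s t - dyadic_sum \<Xi> n s t"
  let ?b = "\<lambda>n. C * (t - s) powr (1 + \<epsilon>) * (2 powr (-\<epsilon>)) ^ n"
  have b: "?b sums (C * (t - s) powr (1 + \<epsilon>) * S)"
    unfolding S_def
    by (intro sums_mult geometric_sums) (use q_lt_1 in \<open>simp only: real_norm_def abs_of_nonneg powr_ge_zero\<close>)
  have sd: "summable (\<lambda>n. norm (?d n))"
  proof (rule summable_comparison_test'[OF sums_summable[OF b]])
    show "norm (norm (?d n)) \<le> ?b n" for n
      unfolding real_norm_def abs_norm_cancel by (rule dyadic_sum_Suc_diff[OF assms])
  qed
  have "(\<lambda>n. \<Sum>k<n. ?d k) \<longlonglongrightarrow> suminf ?d"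
    using summable_LIMSEQ[OF summable_norm_cancel[OF sd]] .
  then have "(\<lambda>n. dyadic_sum \<Xi> n s t - dyadic_sum \<Xi> 0 s t) \<longlonglongrightarrow> suminf ?d"
    by (simp only: sum_lessThan_telescope[where f = "\<lambda>n. dyadic_sum \<Xi> n s t"])
  from tendsto_add[OF this tendsto_const[of "\<Xi> s t"]]
  have *: "(\<lambda>n. dyadic_sum \<Xi> n s t) \<longlonglongrightarrow> suminf ?d + \<Xi> s t"
    using dyadic_sum_0[OF assms] by simp
  then have Heq: "H s t = suminf ?d + \<Xi> s t" unfolding H_def by (rule limI)
  show "(\<lambda>n. dyadic_sum \<Xi> n s t) \<longlonglongrightarrow> H s t" using * Heq by simp
  have "norm (suminf ?d) \<le> (\<Sum>n. norm (?d n))" by (rule summable_norm[OF sd])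
  also have "\<dots> \<le> suminf ?b"
    by (rule suminf_le[OF dyadic_sum_Suc_diff[OF assms] sd sums_summable[OF b]])
  also have "\<dots> = C * (t - s) powr (1 + \<epsilon>) * S" using b by (rule sums_unique[symmetric])
  finally show "norm (H s t - \<Xi> s t) \<le> C * S * (t - s) powr (1 + \<epsilon>)"
    unfolding Heq by (simp add: algebra_simps)
qed

lemma H_diag: "0 \<le> s \<Longrightarrow> s \<le> 1 \<Longrightarrow> H s s = 0"
  using dyadic_limit(2)[of s s] diag[of s] by simp

text \<open>On the level of grids, only the piece that contains \<open>s\<close> in its interior violates additivity. Even
the crude estimate that charges all \<open>2\<^sup>n\<close> pieces with the defect \<open>C \<cdot> 2\<^sup>-\<^sup>n\<^sup>\<theta>\<close> tends to zero.\<close>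

lemma H_additive:
  assumes "0 \<le> s" "s \<le> t" "t \<le> 1"
  shows "H 0 t = H 0 s + H s t"
proof -
  let ?D = "\<lambda>n. dyadic_sum \<Xi> n 0 t - (dyadic_sum \<Xi> n 0 s + dyadic_sum \<Xi> n s t)"
  have bound: "norm (?D n) \<le> C * (2 powr (1 - \<theta>)) ^ n" for n
  proof -
    let ?a = "\<lambda>k. real k / 2^n"
    have "norm (?D n) = norm (\<Sum>k<2^n. \<Xi> (clip 0 t (?a k)) (clip 0 t (?a (Suc k)))
      - (\<Xi> (clip 0 s (?a k)) (clip 0 s (?a (Suc k))) + \<Xi> (clip s t (?a k)) (clip s t (?a (Suc k)))))"
      by (simp add: dyadic_sum_def sum.distrib sum_subtractf)
    also have "\<dots> \<le> (\<Sum>k<(2::nat)^n. C * ((1/2)^n) powr \<theta>)"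
    proof (rule sum_norm_le)
      fix k
      have a0: "0 \<le> ?a k" "?a k \<le> ?a (Suc k)" "?a (Suc k) = ?a k + (1/2)^n"
        by (simp_all add: divide_simps power_one_over)
      consider "?a (Suc k) \<le> s" | "s \<le> ?a k" | "?a k < s" "s < ?a (Suc k)" by linarith
      then show "norm (\<Xi> (clip 0 t (?a k)) (clip 0 t (?a (Suc k)))
          - (\<Xi> (clip 0 s (?a k)) (clip 0 s (?a (Suc k))) + \<Xi> (clip s t (?a k)) (clip s t (?a (Suc k)))))
          \<le> C * ((1/2)^n) powr \<theta>"
      proof cases
        case 1
        moreover have "?a k \<le> s" using 1 a0 by linarith
        ultimately have "clip 0 t (?a k) = clip 0 s (?a k)" "clip 0 t (?a (Suc k)) = clip 0 s (?a (Suc k))"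
          "clip s t (?a k) = s" "clip s t (?a (Suc k)) = s"
          using assms a0(1,2) unfolding clip_def by linarith+
        then show ?thesis using diag[of s] assms C_nonneg by simp
      next
        case 2
        moreover have "s \<le> ?a (Suc k)" using 2 a0 by linarith
        ultimately have "clip 0 t (?a k) = clip s t (?a k)" "clip 0 t (?a (Suc k)) = clip s t (?a (Suc k))"
          "clip 0 s (?a k) = s" "clip 0 s (?a (Suc k)) = s"
          using assms a0(1,2) unfolding clip_def by linarith+
        then show ?thesis using diag[of s] assms C_nonneg by simp
      next
        case 3
        let ?b = "min (?a (Suc k)) t"
        have eqs: "clip 0 t (?a k) = ?a k" "clip 0 t (?a (Suc k)) = ?b"
          "clip s t (?a k) = s" "clip s t (?a (Suc k)) = ?b"
          "clip 0 s (?a k) = ?a k" "clip 0 s (?a (Suc k)) = s"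
          using 3 a0 assms by (auto simp: clip_def)
        have "norm (\<Xi> (?a k) ?b - \<Xi> (?a k) s - \<Xi> s ?b) \<le> C * (?b - ?a k) powr \<theta>"
          using 3 a0 assms by (intro defect) auto
        also have "\<dots> \<le> C * ((1/2)^n) powr \<theta>"
          using 3 a0 assms \<theta>_gt_1 by (intro mult_left_mono C_nonneg powr_mono2) auto
        finally show ?thesis unfolding eqs by (simp add: algebra_simps)
      qed
    qed
    also have "\<dots> = C * (2 ^ n * ((1/2)^n) powr \<theta>)" by simp
    also have "2 ^ n * ((1/2)^n) powr \<theta> = (2 powr (1 - \<theta>)) ^ n"
    proof -
      have "(2 powr (1 - \<theta>)) ^ n = (2 * 2 powr (-\<theta>)) ^ n"
        using powr_add[of 2 1 "-\<theta>"] by simp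
      then show ?thesis unfolding half_power_powr power_mult_distrib by simp
    qed
    finally show ?thesis .
  qed
  have "2 powr (1 - \<theta>) < 1" using \<theta>_gt_1 by (simp add: powr_less_one)
  then have "(\<lambda>n. C * (2 powr (1 - \<theta>)) ^ n) \<longlonglongrightarrow> C * 0"
    by (intro tendsto_mult tendsto_const LIMSEQ_realpow_zero) auto
  then have "?D \<longlonglongrightarrow> 0" using bound by (intro Lim_null_comparison[of ?D]) auto
  moreover have "?D \<longlonglongrightarrow> H 0 t - (H 0 s + H s t)"
    using assms by (intro tendsto_diff tendsto_add dyadic_limit) auto
  ultimately have "H 0 t - (H 0 s + H s t) = 0" by (rule LIMSEQ_unique[symmetric])
  then show ?thesis by simp
qed

lemma partition01_mono:
  assumes "partition01 n p" "i \<le> j" "j \<le> n"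
  shows "p i \<le> p j"
  using assms(2,3)
proof (induction j rule: dec_induct)
  case (step k)
  then have "p k < p (Suc k)" using assms(1) by (auto simp: partition01_def)
  then show ?case using step by simp
qed simp

lemma partition01_unit: "partition01 n p \<Longrightarrow> k \<le> n \<Longrightarrow> 0 \<le> p k \<and> p k \<le> 1"
  using partition01_mono[of n p 0 k] partition01_mono[of n p k n] by (auto simp: partition01_def)

lemma sum_H_partition:
  assumes "partition01 n p" "K \<le> n"
  shows "(\<Sum>k<K. H (p k) (p (Suc k))) = H 0 (p K)"
  using assms(2)
proof (induction K)
  case 0
  then show ?case using assms H_diag by (simp add: partition01_def)
next
  case (Suc K)
  have "H 0 (p (Suc K)) = H 0 (p K) + H (p K) (p (Suc K))"
    using partition01_unit[OF assms(1)] partition01_mono[OF assms(1), of K "Suc K"] Suc.prems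
    by (intro H_additive) auto
  then show ?case using Suc by simp
qed

text \<open>By additivity the integral splits along the partition, so the errors of the single pieces add
up; each is of higher order than the length of its piece.\<close>

lemma partition_sum_error:
  assumes p: "partition01 n p" and mesh: "\<And>k. k < n \<Longrightarrow> p (Suc k) - p k < \<delta>" and "\<delta> > 0"
  shows "norm ((\<Sum>k<n. \<Xi> (p k) (p (Suc k))) - H 0 1) \<le> C * S * \<delta> powr \<epsilon>"
proof -
  have "H 0 1 = (\<Sum>k<n. H (p k) (p (Suc k)))"
    using sum_H_partition[OF p order_refl] p by (simp add: partition01_def)
  then have "norm ((\<Sum>k<n. \<Xi> (p k) (p (Suc k))) - H 0 1)
      = norm (\<Sum>k<n. \<Xi> (p k) (p (Suc k)) - H (p k) (p (Suc k)))"
    by (simp add: sum_subtractf)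
  also have "\<dots> \<le> (\<Sum>k<n. C * S * ((p (Suc k) - p k) * \<delta> powr \<epsilon>))"
  proof (rule sum_norm_le)
    fix k assume "k \<in> {..<n}"
    then have k: "k < n" by simp
    have l: "p k \<le> p (Suc k)" using p k by (force simp: partition01_def)
    have "norm (\<Xi> (p k) (p (Suc k)) - H (p k) (p (Suc k))) \<le> C * S * (p (Suc k) - p k) powr (1 + \<epsilon>)"
      using partition01_unit[OF p, of k] partition01_unit[OF p, of "Suc k"] k l
      by (subst norm_minus_commute) (intro dyadic_limit; simp)
    also have "(p (Suc k) - p k) powr (1 + \<epsilon>) = (p (Suc k) - p k) * (p (Suc k) - p k) powr \<epsilon>"
      using powr_mult_base[of "p (Suc k) - p k" \<epsilon>] l by simp
    also have "C * S * \<dots> \<le> C * S * ((p (Suc k) - p k) * \<delta> powr \<epsilon>)"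
      using C_nonneg S_pos l mesh[OF k] \<epsilon>_pos
      by (intro mult_left_mono powr_mono2) auto
    finally show "norm (\<Xi> (p k) (p (Suc k)) - H (p k) (p (Suc k))) \<le> C * S * ((p (Suc k) - p k) * \<delta> powr \<epsilon>)" .
  qed
  also have "\<dots> = C * S * ((\<Sum>k<n. p (Suc k) - p k) * \<delta> powr \<epsilon>)"
    by (simp add: sum_distrib_left sum_distrib_right)
  also have "(\<Sum>k<n. p (Suc k) - p k) = 1"
    using p by (simp add: sum_lessThan_telescope partition01_def)
  finally show ?thesis by simp
qed

lemma partition_sums_converge:
  assumes "e > 0"
  shows "\<exists>\<delta>>0. \<forall>n p. partition01 n p \<longrightarrow> (\<forall>k<n. p (Suc k) - p k < \<delta>) \<longrightarrow>
    norm ((\<Sum>k<n. \<Xi> (p k) (p (Suc k))) - H 0 1) < e"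
proof -
  \<comment> \<open>The \<open>+ 1\<close> only prevents a division by zero.\<close>
  define \<delta> where "\<delta> = (e / (C * S + 1)) powr (1 / \<epsilon>)"
  have CS: "C * S \<ge> 0" using C_nonneg S_pos by simp
  have pos: "e / (C * S + 1) > 0" using assms CS by simp
  have \<delta>: "\<delta> > 0" "\<delta> powr \<epsilon> = e / (C * S + 1)"
    using pos \<epsilon>_pos CS assms by (auto simp: \<delta>_def powr_powr)
  have "C * S * \<delta> powr \<epsilon> < e"
    using CS assms unfolding \<delta>(2) by (simp add: field_simps)
  then show ?thesis using partition_sum_error[OF _ _ \<delta>(1)] \<delta>(1) by (meson le_less_trans)
qed

end

lemma uniform_partition: "N > 0 \<Longrightarrow> partition01 N (\<lambda>k. real k / real N)"
  by (auto simp: partition01_def field_simps)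

lemma mesh_limit_unique:
  assumes "mesh_limit R L" "mesh_limit R L'"
  shows "L = L'"
proof (rule ccontr)
  assume "L \<noteq> L'"
  then have e: "\<bar>L - L'\<bar> / 2 > 0" by simp
  from assms(1) e obtain d where d: "d > 0" "\<And>n p. partition01 n p \<Longrightarrow>
      (\<forall>k<n. p (Suc k) - p k < d) \<Longrightarrow> \<bar>R n p - L\<bar> < \<bar>L - L'\<bar> / 2"
    unfolding mesh_limit_def by meson
  from assms(2) e obtain d' where d': "d' > 0" "\<And>n p. partition01 n p \<Longrightarrow>
      (\<forall>k<n. p (Suc k) - p k < d') \<Longrightarrow> \<bar>R n p - L'\<bar> < \<bar>L - L'\<bar> / 2"
    unfolding mesh_limit_def by meson
  obtain m where m: "inverse (real (Suc m)) < min d d'"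
    using reals_Archimedean[of "min d d'"] d d' by auto
  let ?p = "\<lambda>k. real k / real (Suc m)"
  have mesh: "?p (Suc k) - ?p k < min d d'" for k
    using m by (simp add: field_simps)
  have "\<bar>R (Suc m) ?p - L\<bar> < \<bar>L - L'\<bar> / 2" "\<bar>R (Suc m) ?p - L'\<bar> < \<bar>L - L'\<bar> / 2"
    using d(2)[of "Suc m" ?p] d'(2)[of "Suc m" ?p] uniform_partition[of "Suc m"] mesh by auto
  then show False by (simp add: abs_if split: if_splits)
qed

section \<open>Controlled paths and their rough integral\<close>

text \<open>The product that pairs integrand and integrator is kept abstract: besides the matrix-vector product
it has to be its liftings to derivatives of the integrand.\<close>

definition contractive_bilinear ::
  "('z::real_normed_vector \<Rightarrow> 'w::real_normed_vector \<Rightarrow> 'b::real_normed_vector) \<Rightarrow> bool" where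
  "contractive_bilinear p \<longleftrightarrow> bounded_bilinear p \<and> (\<forall>a b. norm (p a b) \<le> norm a * norm b)"

lemma contractive_bilinear_bound:
  assumes "contractive_bilinear p" "norm a \<le> A" "norm b \<le> B"
  shows "norm (p a b) \<le> A * B"
proof -
  have "norm (p a b) \<le> norm a * norm b" using assms by (simp add: contractive_bilinear_def)
  also have "\<dots> \<le> A * B" using assms by (intro mult_mono') auto
  finally show ?thesis .
qed

lemma norm_blinfun_le: "norm f \<le> A \<Longrightarrow> norm x \<le> B \<Longrightarrow> norm (blinfun_apply f x) \<le> A * B"
  by (meson mult_mono' norm_blinfun norm_ge_zero order_trans)

lemma norm_blinfun_compose_le: "norm f \<le> A \<Longrightarrow> norm g \<le> B \<Longrightarrow> norm (f o\<^sub>L g) \<le> A * B"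
  by (meson mult_mono' norm_blinfun_compose norm_ge_zero order_trans)

lemma axis_expansion: "(\<Sum>a\<in>UNIV. x $ a *\<^sub>R axis a (1::real)) = (x :: real^'n)"
  using basis_expansion[of x] by (simp add: scalar_mult_eq_scaleR)

lemma contractive_bilinear_expansion:
  fixes x y :: "real^'n"
  assumes "contractive_bilinear p"
  shows "p (blinfun_apply f x) (blinfun_apply g y)
    = (\<Sum>a\<in>UNIV. \<Sum>c\<in>UNIV. (x $ a * y $ c) *\<^sub>R p (f (axis a 1)) (g (axis c 1)))"
proof -
  interpret p: bounded_bilinear p using assms by (simp add: contractive_bilinear_def)
  have "p (f x) (g y) = p (f (\<Sum>a\<in>UNIV. x $ a *\<^sub>R axis a 1)) (g (\<Sum>c\<in>UNIV. y $ c *\<^sub>R axis c 1))"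
    by (simp only: axis_expansion)
  also have "\<dots> = (\<Sum>a\<in>UNIV. \<Sum>c\<in>UNIV. (x $ a * y $ c) *\<^sub>R p (f (axis a 1)) (g (axis c 1)))"
    by (simp add: blinfun.sum_right blinfun.scaleR_right p.sum_left p.sum_right
        p.scaleR_left p.scaleR_right scaleR_sum_right mult.commute)
       (rule sum.swap)
  finally show ?thesis .
qed

text \<open>One constant \<open>\<kappa> \<ge> 1\<close> bounds the path, its Hoelder constant and the second-order process; taking it
at least one lets powers of \<open>\<kappa>\<close> absorb each other in the estimates.\<close>

locale rough =
  fixes \<gamma> \<kappa> :: real and X :: "real \<Rightarrow> real^3" and XX :: "real \<Rightarrow> real \<Rightarrow> real^3^3"
  assumes \<gamma>: "\<gamma> > 1/3" and \<kappa>: "\<kappa> \<ge> 1"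
    and X_le: "\<And>\<xi>. \<xi> \<in> {0..1} \<Longrightarrow> norm (X \<xi>) \<le> \<kappa>"
    and X_hoelder: "\<And>\<xi> \<eta>. \<xi> \<in> {0..1} \<Longrightarrow> \<eta> \<in> {0..1} \<Longrightarrow>
      norm (X \<xi> - X \<eta>) \<le> \<kappa> * \<bar>\<xi> - \<eta>\<bar> powr \<gamma>"
    and XX_le: "\<And>\<xi> \<eta> a c. \<xi> \<in> {0..1} \<Longrightarrow> \<eta> \<in> {0..1} \<Longrightarrow>
      \<bar>XX \<xi> \<eta> $ a $ c\<bar> \<le> \<kappa> * (\<bar>\<xi> - \<eta>\<bar> powr \<gamma>)\<^sup>2"
    and chen: "\<And>\<xi> \<eta> \<rho> i j. \<xi> \<in> {0..1} \<Longrightarrow> \<eta> \<in> {0..1} \<Longrightarrow> \<rho> \<in> {0..1} \<Longrightarrow>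
      XX \<xi> \<rho> $ i $ j - XX \<xi> \<eta> $ i $ j - XX \<eta> \<rho> $ i $ j = (X \<xi> $ i - X \<eta> $ i) * (X \<eta> $ j - X \<rho> $ j)"
    and X_closed: "X 0 = X 1"
begin

definition \<omega> :: "real \<Rightarrow> real \<Rightarrow> real" where "\<omega> \<xi> \<eta> = \<bar>\<xi> - \<eta>\<bar> powr \<gamma>"

lemma \<omega>_nonneg [simp]: "\<omega> \<xi> \<eta> \<ge> 0" by (simp add: \<omega>_def)

lemma \<omega>_self [simp]: "\<omega> \<xi> \<xi> = 0" by (simp add: \<omega>_def)

lemma \<omega>_sym: "\<omega> \<xi> \<eta> = \<omega> \<eta> \<xi>" by (simp add: \<omega>_def abs_minus_commute)

lemma \<omega>_le_1: "\<xi> \<in> {0..1} \<Longrightarrow> \<eta> \<in> {0..1} \<Longrightarrow> \<omega> \<xi> \<eta> \<le> 1"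
  unfolding \<omega>_def using \<gamma> by (intro powr_le1) auto

lemma \<omega>_sq_le: "\<xi> \<in> {0..1} \<Longrightarrow> \<eta> \<in> {0..1} \<Longrightarrow> (\<omega> \<xi> \<eta>)\<^sup>2 \<le> \<omega> \<xi> \<eta>"
  using \<omega>_le_1[of \<xi> \<eta>] by (simp add: power2_eq_square mult_left_le)

lemma \<omega>_mono: "s \<le> s' \<Longrightarrow> s' \<le> t' \<Longrightarrow> t' \<le> t \<Longrightarrow> \<omega> s' t' \<le> \<omega> s t"
  unfolding \<omega>_def using \<gamma> by (intro powr_mono2) auto

lemma \<omega>_cube: "s \<le> t \<Longrightarrow> (\<omega> s t)^3 = (t - s) powr (3 * \<gamma>)"
proof -
  assume "s \<le> t"
  then have "(\<omega> s t)^3 = (t - s) powr \<gamma> * ((t - s) powr \<gamma> * (t - s) powr \<gamma>)"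
    by (simp add: \<omega>_def power3_eq_cube abs_minus_commute mult.assoc)
  also have "\<dots> = (t - s) powr (\<gamma> + (\<gamma> + \<gamma>))" by (simp only: powr_add)
  also have "\<gamma> + (\<gamma> + \<gamma>) = 3 * \<gamma>" by simp
  finally show ?thesis .
qed

lemma X_inc: "\<xi> \<in> {0..1} \<Longrightarrow> \<eta> \<in> {0..1} \<Longrightarrow> norm (X \<xi> - X \<eta>) \<le> \<kappa> * \<omega> \<xi> \<eta>"
  using X_hoelder by (simp add: \<omega>_def)

lemma XX_bound: "\<xi> \<in> {0..1} \<Longrightarrow> \<eta> \<in> {0..1} \<Longrightarrow> \<bar>XX \<xi> \<eta> $ a $ c\<bar> \<le> \<kappa> * (\<omega> \<xi> \<eta>)\<^sup>2"
  using XX_le by (simp add: \<omega>_def)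

text \<open>The controlled norm without the size of \<open>z\<close>, for which integrands such as \<open>A (x - Y)\<close> have no bound
that depends on the derivatives of \<open>A\<close> only.\<close>

definition ctrl_semi ::
  "real \<Rightarrow> (real \<Rightarrow> 'b::real_normed_vector) \<Rightarrow> (real \<Rightarrow> (real^3) \<Rightarrow>\<^sub>L 'b) \<Rightarrow> bool" where
  "ctrl_semi N z z' \<longleftrightarrow>
     (\<forall>\<xi>\<in>{0..1}. norm (z' \<xi>) \<le> N) \<and>
     (\<forall>\<xi>\<in>{0..1}. \<forall>\<eta>\<in>{0..1}. norm (z' \<xi> - z' \<eta>) \<le> N * \<omega> \<xi> \<eta>) \<and>
     (\<forall>\<xi>\<in>{0..1}. \<forall>\<eta>\<in>{0..1}. norm (z \<xi> - z \<eta> - z' \<eta> (X \<xi> - X \<eta>)) \<le> N * (\<omega> \<xi> \<eta>)\<^sup>2)"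

definition ctrl ::
  "real \<Rightarrow> (real \<Rightarrow> 'b::real_normed_vector) \<Rightarrow> (real \<Rightarrow> (real^3) \<Rightarrow>\<^sub>L 'b) \<Rightarrow> bool" where
  "ctrl N z z' \<longleftrightarrow> (\<forall>\<xi>\<in>{0..1}. norm (z \<xi>) \<le> N) \<and> ctrl_semi N z z'"

lemma ctrl_semiD:
  assumes "ctrl_semi N z z'" "\<xi> \<in> {0..1}"
  shows "norm (z' \<xi>) \<le> N"
    and "\<eta> \<in> {0..1} \<Longrightarrow> norm (z' \<xi> - z' \<eta>) \<le> N * \<omega> \<xi> \<eta>"
    and "\<eta> \<in> {0..1} \<Longrightarrow> norm (z \<xi> - z \<eta> - z' \<eta> (X \<xi> - X \<eta>)) \<le> N * (\<omega> \<xi> \<eta>)\<^sup>2"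
  using assms by (auto simp: ctrl_semi_def)

lemma ctrlD:
  assumes "ctrl N z z'"
  shows "ctrl_semi N z z'" and "\<xi> \<in> {0..1} \<Longrightarrow> norm (z \<xi>) \<le> N"
  using assms by (auto simp: ctrl_def)

lemma ctrl_semi_nonneg: "ctrl_semi N z z' \<Longrightarrow> N \<ge> 0"
  using order_trans[OF norm_ge_zero ctrl_semiD(1)[of N z z' 0]] by simp

lemma ctrl_nonneg: "ctrl N z z' \<Longrightarrow> N \<ge> 0"
  using ctrlD(1) ctrl_semi_nonneg by blast

lemma ctrl_semi_mono:
  assumes "ctrl_semi N z z'" "N \<le> M"
  shows "ctrl_semi M z z'"
proof -
  have "N * \<omega> \<xi> \<eta> \<le> M * \<omega> \<xi> \<eta>" "N * (\<omega> \<xi> \<eta>)\<^sup>2 \<le> M * (\<omega> \<xi> \<eta>)\<^sup>2" for \<xi> \<eta>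
    using assms(2) by (auto intro: mult_right_mono)
  with assms show ?thesis unfolding ctrl_semi_def by (meson order_trans)
qed

lemma ctrl_mono: "ctrl N z z' \<Longrightarrow> N \<le> M \<Longrightarrow> ctrl M z z'"
  unfolding ctrl_def using ctrl_semi_mono by (meson order_trans)

lemma ctrl_semi_cong:
  assumes "\<And>\<xi>. \<xi> \<in> {0..1} \<Longrightarrow> z \<xi> = y \<xi>" "\<And>\<xi>. \<xi> \<in> {0..1} \<Longrightarrow> z' \<xi> = y' \<xi>"
  shows "ctrl_semi N z z' \<longleftrightarrow> ctrl_semi N y y'"
  using assms by (simp add: ctrl_semi_def)

lemma ctrl_cong:
  assumes "\<And>\<xi>. \<xi> \<in> {0..1} \<Longrightarrow> z \<xi> = y \<xi>" "\<And>\<xi>. \<xi> \<in> {0..1} \<Longrightarrow> z' \<xi> = y' \<xi>"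
  shows "ctrl N z z' \<longleftrightarrow> ctrl N y y'"
  using assms ctrl_semi_cong[of z y z' y' N] by (simp add: ctrl_def)

lemma ctrl_semi_add:
  assumes z: "ctrl_semi N z z'" and y: "ctrl_semi M y y'"
  shows "ctrl_semi (N + M) (\<lambda>\<xi>. z \<xi> + y \<xi>) (\<lambda>\<xi>. z' \<xi> + y' \<xi>)"
  unfolding ctrl_semi_def
proof (intro conjI ballI)
  fix \<xi> \<eta> :: real assume *: "\<xi> \<in> {0..1}" "\<eta> \<in> {0..1}"
  show "norm (z' \<xi> + y' \<xi>) \<le> N + M"
    by (rule norm_triangle_mono[OF ctrl_semiD(1)[OF z *(1)] ctrl_semiD(1)[OF y *(1)]])
  have eq: "z' \<xi> + y' \<xi> - (z' \<eta> + y' \<eta>) = (z' \<xi> - z' \<eta>) + (y' \<xi> - y' \<eta>)" by simp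
  show "norm (z' \<xi> + y' \<xi> - (z' \<eta> + y' \<eta>)) \<le> (N + M) * \<omega> \<xi> \<eta>"
    unfolding eq distrib_right by (rule norm_triangle_mono[OF ctrl_semiD(2)[OF z *] ctrl_semiD(2)[OF y *]])
  have eq: "z \<xi> + y \<xi> - (z \<eta> + y \<eta>) - (z' \<eta> + y' \<eta>) (X \<xi> - X \<eta>)
    = (z \<xi> - z \<eta> - z' \<eta> (X \<xi> - X \<eta>)) + (y \<xi> - y \<eta> - y' \<eta> (X \<xi> - X \<eta>))"
    by (simp add: blinfun.add_left)
  show "norm (z \<xi> + y \<xi> - (z \<eta> + y \<eta>) - (z' \<eta> + y' \<eta>) (X \<xi> - X \<eta>)) \<le> (N + M) * (\<omega> \<xi> \<eta>)\<^sup>2"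
    unfolding eq distrib_right by (rule norm_triangle_mono[OF ctrl_semiD(3)[OF z *] ctrl_semiD(3)[OF y *]])
qed

lemma ctrl_add:
  assumes "ctrl N z z'" "ctrl M y y'"
  shows "ctrl (N + M) (\<lambda>\<xi>. z \<xi> + y \<xi>) (\<lambda>\<xi>. z' \<xi> + y' \<xi>)"
  using assms ctrl_semi_add[of N z z' M y y'] unfolding ctrl_def by (auto intro: norm_triangle_mono)

lemma ctrl_semi_scaleR:
  assumes z: "ctrl_semi N z z'"
  shows "ctrl_semi (\<bar>c\<bar> * N) (\<lambda>\<xi>. c *\<^sub>R z \<xi>) (\<lambda>\<xi>. c *\<^sub>R z' \<xi>)"
  unfolding ctrl_semi_def
proof (intro conjI ballI)
  fix \<xi> \<eta> :: real assume *: "\<xi> \<in> {0..1}" "\<eta> \<in> {0..1}"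
  show "norm (c *\<^sub>R z' \<xi>) \<le> \<bar>c\<bar> * N"
    using ctrl_semiD(1)[OF z *(1)] by (simp add: mult_left_mono)
  show "norm (c *\<^sub>R z' \<xi> - c *\<^sub>R z' \<eta>) \<le> \<bar>c\<bar> * N * \<omega> \<xi> \<eta>"
    using ctrl_semiD(2)[OF z *] by (simp add: scaleR_diff_right[symmetric] mult_left_mono mult.assoc)
  have eq: "c *\<^sub>R z \<xi> - c *\<^sub>R z \<eta> - (c *\<^sub>R z' \<eta>) (X \<xi> - X \<eta>) = c *\<^sub>R (z \<xi> - z \<eta> - z' \<eta> (X \<xi> - X \<eta>))"
    by (simp add: blinfun.scaleR_left scaleR_diff_right)
  show "norm (c *\<^sub>R z \<xi> - c *\<^sub>R z \<eta> - (c *\<^sub>R z' \<eta>) (X \<xi> - X \<eta>)) \<le> \<bar>c\<bar> * N * (\<omega> \<xi> \<eta>)\<^sup>2"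
    unfolding eq using ctrl_semiD(3)[OF z *] by (simp add: mult_left_mono mult.assoc)
qed

lemma ctrl_scaleR:
  assumes "ctrl N z z'"
  shows "ctrl (\<bar>c\<bar> * N) (\<lambda>\<xi>. c *\<^sub>R z \<xi>) (\<lambda>\<xi>. c *\<^sub>R z' \<xi>)"
  using assms ctrl_semi_scaleR[of N z z' c] by (auto simp: ctrl_def mult_left_mono)

lemma ctrl_diff:
  assumes "ctrl N z z'" "ctrl M y y'"
  shows "ctrl (N + M) (\<lambda>\<xi>. z \<xi> - y \<xi>) (\<lambda>\<xi>. z' \<xi> - y' \<xi>)"
  using ctrl_add[OF assms(1) ctrl_scaleR[OF assms(2), of "-1"]] by simp

lemma ctrl_commute:
  assumes "ctrl N (\<lambda>\<xi>. z \<xi> - y \<xi>) (\<lambda>\<xi>. z' \<xi> - y' \<xi>)"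
  shows "ctrl N (\<lambda>\<xi>. y \<xi> - z \<xi>) (\<lambda>\<xi>. y' \<xi> - z' \<xi>)"
  using ctrl_scaleR[OF assms, of "-1"] by simp

lemma ctrl_path_inc:
  assumes z: "ctrl_semi N z z'" and *: "\<xi> \<in> {0..1}" "\<eta> \<in> {0..1}"
  shows "norm (z \<xi> - z \<eta>) \<le> 2 * \<kappa> * N * \<omega> \<xi> \<eta>"
proof -
  note N = ctrl_semi_nonneg[OF z]
  have "norm (z \<xi> - z \<eta>) = norm ((z \<xi> - z \<eta> - z' \<eta> (X \<xi> - X \<eta>)) + z' \<eta> (X \<xi> - X \<eta>))" by simp
  also have "\<dots> \<le> N * (\<omega> \<xi> \<eta>)\<^sup>2 + N * (\<kappa> * \<omega> \<xi> \<eta>)"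
    using ctrl_semiD(3)[OF z *] norm_blinfun_le[OF ctrl_semiD(1)[OF z *(2)] X_inc[OF *]]
    by (rule norm_triangle_mono)
  also have "N * (\<omega> \<xi> \<eta>)\<^sup>2 \<le> N * (\<kappa> * \<omega> \<xi> \<eta>)"
    using \<omega>_sq_le[OF *] \<kappa> N mult_right_mono[OF \<kappa> \<omega>_nonneg[of \<xi> \<eta>]]
    by (intro mult_left_mono) auto
  finally show ?thesis by (simp add: algebra_simps)
qed

lemma ctrl_path_continuous:
  assumes z: "ctrl_semi N z z'"
  shows "continuous_on {0..1} z"
  unfolding continuous_on_def
proof
  fix \<eta> :: real assume \<eta>: "\<eta> \<in> {0..1}"
  have "((\<lambda>\<xi>. 2 * \<kappa> * N * \<omega> \<xi> \<eta>) \<longlongrightarrow> 2 * \<kappa> * N * (\<bar>\<eta> - \<eta>\<bar> powr \<gamma>)) (at \<eta> within {0..1})"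
    unfolding \<omega>_def using \<gamma> by (intro tendsto_intros) auto
  then have lim: "((\<lambda>\<xi>. 2 * \<kappa> * N * \<omega> \<xi> \<eta>) \<longlongrightarrow> 0) (at \<eta> within {0..1})" by simp
  have "((\<lambda>\<xi>. z \<xi> - z \<eta>) \<longlongrightarrow> 0) (at \<eta> within {0..1})"
    by (rule Lim_null_comparison[OF _ lim])
       (use ctrl_path_inc[OF z _ \<eta>] in \<open>auto simp: eventually_at_filter\<close>)
  then show "(z \<longlongrightarrow> z \<eta>) (at \<eta> within {0..1})" by (simp add: LIM_zero_iff)
qed

text \<open>The summand of the compensated Riemann sums: the increment of the integrator, corrected by the
second-order process.\<close>

definition germ ::
  "('z::real_normed_vector \<Rightarrow> 'w::real_normed_vector \<Rightarrow> 'b::real_normed_vector) \<Rightarrow>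
   (real \<Rightarrow> 'z) \<Rightarrow> (real \<Rightarrow> (real^3) \<Rightarrow>\<^sub>L 'z) \<Rightarrow> (real \<Rightarrow> 'w) \<Rightarrow> (real \<Rightarrow> (real^3) \<Rightarrow>\<^sub>L 'w) \<Rightarrow>
   real \<Rightarrow> real \<Rightarrow> 'b" where
  "germ p z z' w w' s t = p (z s) (w t - w s) +
     (\<Sum>a\<in>UNIV. \<Sum>c\<in>UNIV. XX s t $ a $ c *\<^sub>R p (z' s (axis a 1)) (w' s (axis c 1)))"

definition rough_integral ::
  "('z::real_normed_vector \<Rightarrow> 'w::real_normed_vector \<Rightarrow> 'b::banach) \<Rightarrow>
   (real \<Rightarrow> 'z) \<Rightarrow> (real \<Rightarrow> (real^3) \<Rightarrow>\<^sub>L 'z) \<Rightarrow> (real \<Rightarrow> 'w) \<Rightarrow> (real \<Rightarrow> (real^3) \<Rightarrow>\<^sub>L 'w) \<Rightarrow> 'b" where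
  "rough_integral p z z' w w' = lim (\<lambda>n. dyadic_sum (germ p z z' w w') n 0 1)"

text \<open>Chen's relation turns the defect of the compensator into \<open>p (z' x) (w' y)\<close> with the increments
\<open>x\<close> of \<open>X\<close> over \<open>[s,u]\<close> and \<open>y\<close> over \<open>[u,t]\<close>. This is the leading part of the defect
\<open>p (z u - z s) (w t - w u)\<close> of the first-order term and cancels it; what is left contains a
remainder, or an increment of \<open>z'\<close> or \<open>w'\<close>, and is of order \<open>\<omega>\<^sup>3\<close>.\<close>

lemma germ_defect:
  assumes p: "contractive_bilinear p" and z: "ctrl_semi N z z'" and w: "ctrl_semi M w w'"
    and st: "0 \<le> s" "s \<le> u" "u \<le> t" "t \<le> 1"
  shows "norm (germ p z z' w w' s t - germ p z z' w w' s u - germ p z z' w w' u t)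
    \<le> 22 * \<kappa>\<^sup>2 * N * M * (\<omega> s t)^3"
proof -
  interpret p: bounded_bilinear p using p by (simp add: contractive_bilinear_def)
  note pb = contractive_bilinear_bound[OF p]
  note N = ctrl_semi_nonneg[OF z] and M = ctrl_semi_nonneg[OF w]
  have I: "s \<in> {0..1}" "u \<in> {0..1}" "t \<in> {0..1}" using st by auto
  let ?w = "\<omega> s t"
  have om: "\<omega> s u \<le> ?w" "\<omega> u s \<le> ?w" "\<omega> u t \<le> ?w" "\<omega> t u \<le> ?w"
    using \<omega>_mono[of s s u t] \<omega>_mono[of s u t t] st by (auto simp: \<omega>_sym[of u s] \<omega>_sym[of t u])
  have om2: "(\<omega> u s)\<^sup>2 \<le> ?w\<^sup>2" "(\<omega> t u)\<^sup>2 \<le> ?w\<^sup>2" "(\<omega> u t)\<^sup>2 \<le> ?w\<^sup>2"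
    using om by (auto intro: power_mono)
  have k0: "\<kappa> \<ge> 0" using \<kappa> by simp
  define x where "x = X u - X s"
  define y where "y = X t - X u"
  define Rz where "Rz = z u - z s - z' s x"
  define Rw where "Rw = w t - w u - w' u y"
  define B where "B r a c = p (z' r (axis a 1)) (w' r (axis c 1))" for r a c
  have nx: "norm x \<le> \<kappa> * ?w" "norm y \<le> \<kappa> * ?w"
    using X_inc[OF I(2) I(1)] X_inc[OF I(3) I(2)] om k0 mult_left_mono[of _ ?w \<kappa>]
    unfolding x_def y_def by (meson order_trans)+
  have nR: "norm Rz \<le> N * ?w\<^sup>2" "norm Rw \<le> M * ?w\<^sup>2"
    using ctrl_semiD(3)[OF z I(2) I(1)] ctrl_semiD(3)[OF w I(3) I(2)] om2 N M
      mult_left_mono[of _ "?w\<^sup>2" N] mult_left_mono[of _ "?w\<^sup>2" M]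
    unfolding Rz_def Rw_def x_def y_def by (meson order_trans)+
  have nw: "norm (w t - w u) \<le> 2 * \<kappa> * M * ?w"
    using ctrl_path_inc[OF w I(3) I(2)] om(4) k0 M mult_left_mono[of _ ?w "2 * \<kappa> * M"]
    by (meson order_trans mult_nonneg_nonneg zero_le_numeral)
  have nzx: "norm (z' s x) \<le> N * (\<kappa> * ?w)"
    by (rule norm_blinfun_le[OF ctrl_semiD(1)[OF z I(1)] nx(1)])
  have dz: "norm (z' s - z' u) \<le> N * ?w" and dw: "norm (w' s - w' u) \<le> M * ?w"
    using ctrl_semiD(2)[OF z I(1,2)] ctrl_semiD(2)[OF w I(1,2)] om(1) N M
      mult_left_mono[of _ ?w N] mult_left_mono[of _ ?w M] by (meson order_trans)+
  have "germ p z z' w w' s t - germ p z z' w w' s u - germ p z z' w w' u t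
    = - p (z u - z s) (w t - w u) + (\<Sum>a\<in>UNIV. \<Sum>c\<in>UNIV. XX s t $ a $ c *\<^sub>R B s a c
        - XX s u $ a $ c *\<^sub>R B s a c - XX u t $ a $ c *\<^sub>R B u a c)"
    by (simp add: germ_def B_def[symmetric] p.diff_left p.diff_right sum_subtractf)
  also have "(\<Sum>a\<in>UNIV. \<Sum>c\<in>UNIV. XX s t $ a $ c *\<^sub>R B s a c
        - XX s u $ a $ c *\<^sub>R B s a c - XX u t $ a $ c *\<^sub>R B u a c)
     = (\<Sum>a\<in>UNIV. \<Sum>c\<in>UNIV. (x $ a * y $ c) *\<^sub>R B s a c + XX u t $ a $ c *\<^sub>R (B s a c - B u a c))"
  proof (intro sum.cong refl)
    fix a c :: 3
    have "XX s t $ a $ c = XX s u $ a $ c + XX u t $ a $ c + x $ a * y $ c"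
      using chen[OF I, of a c] by (simp add: x_def y_def algebra_simps)
    then show "XX s t $ a $ c *\<^sub>R B s a c - XX s u $ a $ c *\<^sub>R B s a c - XX u t $ a $ c *\<^sub>R B u a c
      = (x $ a * y $ c) *\<^sub>R B s a c + XX u t $ a $ c *\<^sub>R (B s a c - B u a c)"
      by (simp add: algebra_simps)
  qed
  also have "\<dots> = p (z' s x) (w' s y) + (\<Sum>a\<in>UNIV. \<Sum>c\<in>UNIV. XX u t $ a $ c *\<^sub>R (B s a c - B u a c))"
    unfolding contractive_bilinear_expansion[OF p, of "z' s" x "w' s" y] B_def by (simp only: sum.distrib)
  \<comment> \<open>Expanding both increments leaves terms with a remainder or an increment of a derivative.\<close>
  also have "- p (z u - z s) (w t - w u) + (p (z' s x) (w' s y)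
      + (\<Sum>a\<in>UNIV. \<Sum>c\<in>UNIV. XX u t $ a $ c *\<^sub>R (B s a c - B u a c)))
    = p (z' s x) ((w' s - w' u) y) - p (z' s x) Rw - p Rz (w t - w u)
      + (\<Sum>a\<in>UNIV. \<Sum>c\<in>UNIV. XX u t $ a $ c *\<^sub>R (B s a c - B u a c))"
    by (simp add: Rz_def Rw_def p.diff_left p.diff_right blinfun.diff_left)
  also have "norm \<dots> \<le> N * (\<kappa> * ?w) * (M * ?w * (\<kappa> * ?w)) + N * (\<kappa> * ?w) * (M * ?w\<^sup>2)
      + N * ?w\<^sup>2 * (2 * \<kappa> * M * ?w) + (\<Sum>a\<in>(UNIV::3 set). \<Sum>c\<in>(UNIV::3 set). \<kappa> * ?w\<^sup>2 * (2 * N * M * ?w))"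
  proof (intro norm_triangle_mono norm_triangle_le_diff add_mono sum_norm_le)
    show "norm (p (z' s x) ((w' s - w' u) y)) \<le> N * (\<kappa> * ?w) * (M * ?w * (\<kappa> * ?w))"
      by (intro pb nzx norm_blinfun_le dw nx)
    show "norm (p (z' s x) Rw) \<le> N * (\<kappa> * ?w) * (M * ?w\<^sup>2)" by (intro pb nzx nR)
    show "norm (p Rz (w t - w u)) \<le> N * ?w\<^sup>2 * (2 * \<kappa> * M * ?w)" by (intro pb nw nR)
    fix a c :: 3
    have "B s a c - B u a c = p ((z' s - z' u) (axis a 1)) (w' s (axis c 1))
        + p (z' u (axis a 1)) ((w' s - w' u) (axis c 1))"
      by (simp add: B_def p.diff_left p.diff_right blinfun.diff_left)
    also have "norm \<dots> \<le> N * ?w * 1 * (M * 1) + N * 1 * (M * ?w * 1)"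
      using dz dw ctrl_semiD(1)[OF z I(2)] ctrl_semiD(1)[OF w I(1)]
      by (intro norm_triangle_mono pb norm_blinfun_le) auto
    finally have "norm (B s a c - B u a c) \<le> 2 * N * M * ?w" by (simp add: algebra_simps)
    moreover have "\<bar>XX u t $ a $ c\<bar> \<le> \<kappa> * ?w\<^sup>2"
      using XX_bound[OF I(2,3), of a c] mult_left_mono[OF om2(3) k0] by linarith
    ultimately show "norm (XX u t $ a $ c *\<^sub>R (B s a c - B u a c)) \<le> \<kappa> * ?w\<^sup>2 * (2 * N * M * ?w)"
      unfolding norm_scaleR using k0 by (intro mult_mono) auto
  qed
  also have "\<dots> = N * M * ?w^3 * (\<kappa>\<^sup>2 + 21 * \<kappa>)"
    by (simp add: power2_eq_square power3_eq_cube algebra_simps)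
  also have "\<dots> \<le> N * M * ?w^3 * (22 * \<kappa>\<^sup>2)"
    using \<kappa> N M by (intro mult_left_mono) (auto simp: power2_eq_square)
  finally show ?thesis by (simp add: algebra_simps)
qed

lemma almost_additive_germ:
  assumes p: "contractive_bilinear p" and z: "ctrl_semi N z z'" and w: "ctrl_semi M w w'"
  shows "almost_additive (germ p z z' w w') (22 * \<kappa>\<^sup>2 * N * M) (3 * \<gamma>)"
proof
  show "22 * \<kappa>\<^sup>2 * N * M \<ge> 0" using ctrl_semi_nonneg[OF z] ctrl_semi_nonneg[OF w] by simp
  show "3 * \<gamma> > 1" using \<gamma> by simp
  show "norm (germ p z z' w w' s t - germ p z z' w w' s u - germ p z z' w w' u t)
    \<le> 22 * \<kappa>\<^sup>2 * N * M * (t - s) powr (3 * \<gamma>)"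
    if "0 \<le> s" "s \<le> u" "u \<le> t" "t \<le> 1" for s u t
    using germ_defect[OF p z w that] that by (simp add: \<omega>_cube)
qed

text \<open>The first summand bounds the distance between the integral and the germ of \<open>[0,1]\<close>, the second that
germ itself when the integrator is closed.\<close>

definition c\<^sub>I :: real where
  "c\<^sub>I = 22 * \<kappa>\<^sup>2 / (1 - 2 powr (- ((3 * \<gamma> - 1) / 2))) + 9 * \<kappa>"

lemma c\<^sub>I_nonneg: "c\<^sub>I \<ge> 0"
  unfolding c\<^sub>I_def using \<kappa> \<gamma> powr_less_one[of 2 "- ((3 * \<gamma> - 1) / 2)"]
  by (intro add_nonneg_nonneg divide_nonneg_nonneg) auto

lemma rough_integral_limit:
  assumes p: "contractive_bilinear p" and z: "ctrl_semi N z z'" and w: "ctrl_semi M w w'"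
  shows "(\<lambda>n. dyadic_sum (germ p z z' w w') n 0 1) \<longlonglongrightarrow> rough_integral p z z' w w'"
proof -
  interpret almost_additive "germ p z z' w w'" "22 * \<kappa>\<^sup>2 * N * M" "3 * \<gamma>"
    by (rule almost_additive_germ[OF p z w])
  show ?thesis using dyadic_limit(1)[of 0 1] by (simp add: rough_integral_def H_def)
qed

lemma rough_integral_partitions:
  assumes p: "contractive_bilinear p" and z: "ctrl_semi N z z'" and w: "ctrl_semi M w w'" and "e > 0"
  shows "\<exists>\<delta>>0. \<forall>n q. partition01 n q \<longrightarrow> (\<forall>k<n. q (Suc k) - q k < \<delta>) \<longrightarrow>
    norm ((\<Sum>k<n. germ p z z' w w' (q k) (q (Suc k))) - rough_integral p z z' w w') < e"
proof -
  interpret almost_additive "germ p z z' w w'" "22 * \<kappa>\<^sup>2 * N * M" "3 * \<gamma>"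
    by (rule almost_additive_germ[OF p z w])
  show ?thesis using partition_sums_converge[OF \<open>e > 0\<close>] by (simp add: rough_integral_def H_def)
qed

text \<open>For a closed integrator the first-order term of the germ of \<open>[0,1]\<close> vanishes and only its
second-order term is left, whence a bound in which the size of \<open>z\<close> does not occur.\<close>

lemma rough_integral_bound:
  assumes p: "contractive_bilinear p" and z: "ctrl_semi N z z'" and w: "ctrl_semi M w w'"
    and closed: "w 0 = w 1"
  shows "norm (rough_integral p z z' w w') \<le> c\<^sub>I * N * M"
proof -
  interpret almost_additive "germ p z z' w w'" "22 * \<kappa>\<^sup>2 * N * M" "3 * \<gamma>"
    by (rule almost_additive_germ[OF p z w])
  interpret p: bounded_bilinear p using p by (simp add: contractive_bilinear_def)
  note N = ctrl_semi_nonneg[OF z] and M = ctrl_semi_nonneg[OF w]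
  have "norm (germ p z z' w w' 0 1) = norm (\<Sum>a\<in>UNIV. \<Sum>c\<in>UNIV.
      XX 0 1 $ a $ c *\<^sub>R p (z' 0 (axis a 1)) (w' 0 (axis c 1)))"
    using closed by (simp add: germ_def p.zero_right)
  also have "\<dots> \<le> (\<Sum>a\<in>(UNIV::3 set). \<Sum>c\<in>(UNIV::3 set). \<kappa> * (N * M))"
  proof (intro sum_norm_le)
    fix a c :: 3
    have "norm (p (z' 0 (axis a 1)) (w' 0 (axis c 1))) \<le> N * 1 * (M * 1)"
      using ctrl_semiD(1)[OF z, of 0] ctrl_semiD(1)[OF w, of 0]
      by (intro contractive_bilinear_bound[OF p] norm_blinfun_le) auto
    moreover have "\<bar>XX 0 1 $ a $ c\<bar> \<le> \<kappa>"
      using XX_bound[of 0 1 a c] by (simp add: \<omega>_def)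
    ultimately show "norm (XX 0 1 $ a $ c *\<^sub>R p (z' 0 (axis a 1)) (w' 0 (axis c 1))) \<le> \<kappa> * (N * M)"
      unfolding norm_scaleR using \<kappa> by (intro mult_mono) auto
  qed
  finally have g: "norm (germ p z z' w w' 0 1) \<le> 9 * \<kappa> * N * M" by simp
  have "norm (rough_integral p z z' w w') \<le> norm (H 0 1 - germ p z z' w w' 0 1) + norm (germ p z z' w w' 0 1)"
    using norm_triangle_ineq[of "H 0 1 - germ p z z' w w' 0 1" "germ p z z' w w' 0 1"]
    by (simp add: rough_integral_def H_def)
  also have "\<dots> \<le> 22 * \<kappa>\<^sup>2 * N * M * S + 9 * \<kappa> * N * M"
    using dyadic_limit(2)[of 0 1] g by (intro add_mono) auto
  also have "\<dots> = c\<^sub>I * N * M"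
    unfolding c\<^sub>I_def S_def \<epsilon>_def by (simp add: algebra_simps)
  finally show ?thesis .
qed

lemma rough_integral_add_left:
  assumes p: "contractive_bilinear p" and z: "ctrl_semi N z z'" and y: "ctrl_semi K y y'"
    and w: "ctrl_semi M w w'"
  shows "rough_integral p (\<lambda>\<xi>. z \<xi> + y \<xi>) (\<lambda>\<xi>. z' \<xi> + y' \<xi>) w w'
    = rough_integral p z z' w w' + rough_integral p y y' w w'"
proof -
  interpret p: bounded_bilinear p using p by (simp add: contractive_bilinear_def)
  have "germ p (\<lambda>\<xi>. z \<xi> + y \<xi>) (\<lambda>\<xi>. z' \<xi> + y' \<xi>) w w' s t
      = germ p z z' w w' s t + germ p y y' w w' s t" for s t
    by (simp add: germ_def p.add_left blinfun.add_left scaleR_add_right sum.distrib)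
  then have "dyadic_sum (germ p (\<lambda>\<xi>. z \<xi> + y \<xi>) (\<lambda>\<xi>. z' \<xi> + y' \<xi>) w w') n 0 1
      = dyadic_sum (germ p z z' w w') n 0 1 + dyadic_sum (germ p y y' w w') n 0 1" for n
    by (simp add: dyadic_sum_def sum.distrib)
  then have "(\<lambda>n. dyadic_sum (germ p (\<lambda>\<xi>. z \<xi> + y \<xi>) (\<lambda>\<xi>. z' \<xi> + y' \<xi>) w w') n 0 1)
      \<longlonglongrightarrow> rough_integral p z z' w w' + rough_integral p y y' w w'"
    using tendsto_add[OF rough_integral_limit[OF p z w] rough_integral_limit[OF p y w]] by simp
  then show ?thesis unfolding rough_integral_def[of p "\<lambda>\<xi>. z \<xi> + y \<xi>"] by (rule limI)
qed

lemma rough_integral_add_right: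
  assumes p: "contractive_bilinear p" and z: "ctrl_semi N z z'" and y: "ctrl_semi K y y'"
    and w: "ctrl_semi M w w'"
  shows "rough_integral p z z' (\<lambda>\<xi>. w \<xi> + y \<xi>) (\<lambda>\<xi>. w' \<xi> + y' \<xi>)
    = rough_integral p z z' w w' + rough_integral p z z' y y'"
proof -
  interpret p: bounded_bilinear p using p by (simp add: contractive_bilinear_def)
  have "germ p z z' (\<lambda>\<xi>. w \<xi> + y \<xi>) (\<lambda>\<xi>. w' \<xi> + y' \<xi>) s t
      = germ p z z' w w' s t + germ p z z' y y' s t" for s t
    by (simp add: germ_def p.add_right p.diff_right blinfun.add_left scaleR_add_right sum.distrib)
  then have "dyadic_sum (germ p z z' (\<lambda>\<xi>. w \<xi> + y \<xi>) (\<lambda>\<xi>. w' \<xi> + y' \<xi>)) n 0 1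
      = dyadic_sum (germ p z z' w w') n 0 1 + dyadic_sum (germ p z z' y y') n 0 1" for n
    by (simp add: dyadic_sum_def sum.distrib)
  then have "(\<lambda>n. dyadic_sum (germ p z z' (\<lambda>\<xi>. w \<xi> + y \<xi>) (\<lambda>\<xi>. w' \<xi> + y' \<xi>)) n 0 1)
      \<longlonglongrightarrow> rough_integral p z z' w w' + rough_integral p z z' y y'"
    using tendsto_add[OF rough_integral_limit[OF p z w] rough_integral_limit[OF p z y]] by simp
  then show ?thesis unfolding rough_integral_def[of p z z' "\<lambda>\<xi>. w \<xi> + y \<xi>"] by (rule limI)
qed

end

section \<open>Iterated derivatives as bounded linear maps\<close>

text \<open>The total derivative as an element of a normed space, so that it can be differentiated again.\<close>

definition GD :: "('a::real_normed_vector \<Rightarrow> 'b::real_normed_vector) \<Rightarrow> 'a \<Rightarrow> 'a \<Rightarrow>\<^sub>L 'b" where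
  "GD f x = Blinfun (frechet_derivative f (at x))"

lemma GD_works: "f differentiable (at x) \<Longrightarrow> (f has_derivative blinfun_apply (GD f x)) (at x)"
  unfolding GD_def
  by (metis bounded_linear_Blinfun_apply frechet_derivative_works has_derivative_bounded_linear)

lemma GD_eqI:
  assumes "(f has_derivative blinfun_apply L) (at x)"
  shows "GD f x = L"
  unfolding GD_def frechet_derivative_at[OF assms, symmetric] by (rule blinfun_apply_inverse)

lemma lipschitz_of_derivative_bound:
  assumes "\<And>x. (f has_derivative blinfun_apply (f' x)) (at x)" "\<And>x. norm (f' x) \<le> B"
  shows "norm (f x - f y) \<le> B * norm (x - y)"
  by (rule differentiable_bound[OF convex_UNIV, where f' = "\<lambda>x. blinfun_apply (f' x)"])
     (use assms in \<open>auto simp: norm_blinfun.rep_eq[symmetric]\<close>)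

text \<open>\<open>smoothn B f\<close> is the class \<open>C\<^sup>n\<^sup>,\<^sup>1\<close>: the derivatives of orders \<open>1\<close> to \<open>n\<close> are bounded by \<open>B\<close>
and the last one is \<open>B\<close>-Lipschitz; \<open>f\<close> itself may be unbounded. Each order needs a definition of
its own because the type of the derivative grows with the order.\<close>

definition smooth1 :: "real \<Rightarrow> ('a::real_normed_vector \<Rightarrow> 'b::real_normed_vector) \<Rightarrow> bool" where
  "smooth1 B f \<longleftrightarrow> (\<forall>x. f differentiable (at x)) \<and> (\<forall>x. norm (GD f x) \<le> B) \<and>
     (\<forall>x y. norm (GD f x - GD f y) \<le> B * norm (x - y))"

definition smooth2 :: "real \<Rightarrow> ('a::real_normed_vector \<Rightarrow> 'b::real_normed_vector) \<Rightarrow> bool" where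
  "smooth2 B f \<longleftrightarrow> (\<forall>x. f differentiable (at x)) \<and> (\<forall>x. norm (GD f x) \<le> B) \<and> smooth1 B (GD f)"

definition smooth3 :: "real \<Rightarrow> ('a::real_normed_vector \<Rightarrow> 'b::real_normed_vector) \<Rightarrow> bool" where
  "smooth3 B f \<longleftrightarrow> (\<forall>x. f differentiable (at x)) \<and> (\<forall>x. norm (GD f x) \<le> B) \<and> smooth2 B (GD f)"

definition smooth4 :: "real \<Rightarrow> ('a::real_normed_vector \<Rightarrow> 'b::real_normed_vector) \<Rightarrow> bool" where
  "smooth4 B f \<longleftrightarrow> (\<forall>x. f differentiable (at x)) \<and> (\<forall>x. norm (GD f x) \<le> B) \<and> smooth3 B (GD f)"

lemma smooth1D:
  assumes "smooth1 B f"
  shows "(f has_derivative blinfun_apply (GD f x)) (at x)" "norm (GD f x) \<le> B"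
    "norm (GD f x - GD f y) \<le> B * norm (x - y)" "f differentiable (at x)"
  using assms GD_works by (auto simp: smooth1_def)

lemma smooth1_nonneg: "smooth1 B f \<Longrightarrow> B \<ge> 0"
  using order_trans[OF norm_ge_zero smooth1D(2)] by blast

lemma smooth1_lipschitz: "smooth1 B f \<Longrightarrow> norm (f x - f y) \<le> B * norm (x - y)"
  by (rule lipschitz_of_derivative_bound[where f' = "GD f"]) (auto dest: smooth1D)

lemma smooth2D:
  assumes "smooth2 B f"
  shows "smooth1 B (GD f)" "smooth1 B f"
  using assms smooth1_lipschitz[of B "GD f"] by (auto simp: smooth2_def smooth1_def)

lemma smooth3D:
  assumes "smooth3 B f"
  shows "smooth2 B (GD f)" "smooth2 B f"
  using assms smooth2D(2)[of B "GD f"] by (auto simp: smooth3_def smooth2_def)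

lemma smooth4D:
  assumes "smooth4 B f"
  shows "smooth3 B (GD f)" "smooth3 B f"
  using assms smooth3D(2)[of B "GD f"] by (auto simp: smooth4_def smooth3_def)

lemma smooth1I:
  assumes "\<And>x. (f has_derivative blinfun_apply (f' x)) (at x)" "\<And>x. norm (f' x) \<le> B"
    "\<And>x y. norm (f' x - f' y) \<le> B * norm (x - y)"
  shows "smooth1 B f"
proof -
  have "GD f = f'" using GD_eqI[OF assms(1)] by blast
  then show ?thesis using assms by (auto simp: smooth1_def differentiable_def)
qed

lemma taylor_bound:
  assumes "smooth1 B f"
  shows "norm (f (x + h) - f x - GD f x h) \<le> B * (norm h)\<^sup>2"
proof -
  have "norm (f (x + h) - f x - GD f x (x + h - x)) \<le> norm (x + h - x) * (B * norm h)"
  proof (rule differentiable_bound_linearization[where S = "closed_segment x (x + h)"])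
    show "x + t *\<^sub>R (x + h - x) \<in> closed_segment x (x + h)" if "t \<in> {0..1}" for t
      using that by (auto simp: in_segment algebra_simps intro!: exI[of _ t])
    show "(f has_derivative blinfun_apply (GD f y)) (at y within closed_segment x (x + h))" for y
      using smooth1D(1)[OF assms] has_derivative_at_withinI by blast
    show "onorm (blinfun_apply (GD f y) - blinfun_apply (GD f x)) \<le> B * norm h"
      if y: "y \<in> closed_segment x (x + h)" for y
    proof -
      have "norm (y - x) \<le> norm h"
        using segment_bound1[OF y] by simp
      then have "norm (GD f y - GD f x) \<le> B * norm h"
        using smooth1D(3)[OF assms, of y x] smooth1_nonneg[OF assms] mult_left_mono order_trans by blast
      then show ?thesis by (simp add: norm_blinfun.rep_eq minus_blinfun.rep_eq fun_diff_def)
    qed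
  qed auto
  then show ?thesis by (simp add: power2_eq_square algebra_simps)
qed

lemma has_derivative_shift:
  assumes "\<And>x. (f has_derivative blinfun_apply (f' x)) (at x)"
  shows "((\<lambda>y. f (y + h)) has_derivative blinfun_apply (f' (y + h))) (at y)"
proof -
  have "((\<lambda>y. y + h) has_derivative (\<lambda>k. k)) (at y)"
    by (auto intro!: derivative_eq_intros)
  from has_derivative_compose[OF this assms] show ?thesis by simp
qed

lemma has_derivative_blinfun_diff:
  assumes "(f has_derivative blinfun_apply F) (at x within S)" "(g has_derivative blinfun_apply G) (at x within S)"
  shows "((\<lambda>y. f y - g y) has_derivative blinfun_apply (F - G)) (at x within S)"
  by (rule has_derivative_eq_rhs[OF has_derivative_diff[OF assms]]) (simp add: fun_eq_iff blinfun.diff_left)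

text \<open>The increment of \<open>f\<close> in direction \<open>v\<close> has a derivative close to \<open>GD (GD f) x v\<close>, so the second
difference, which is symmetric in \<open>u\<close> and \<open>v\<close>, approximates \<open>GD (GD f) x v u\<close> to third order.\<close>

lemma second_difference_bound:
  assumes f: "\<And>x. f differentiable (at x)" and f2: "smooth1 B (GD f)"
  shows "norm ((f (x + u + v) - f (x + u)) - (f (x + v) - f x) - GD (GD f) x v u)
    \<le> B * norm v * (norm u + norm v) * norm u"
proof -
  note B = smooth1_nonneg[OF f2]
  let ?g = "\<lambda>y. f (y + v) - f y"
  let ?g' = "\<lambda>y. GD f (y + v) - GD f y"
  have g: "(?g has_derivative blinfun_apply (?g' y)) (at y)" for y
    by (rule has_derivative_blinfun_diff[OF has_derivative_shift GD_works[OF f]]) (rule GD_works[OF f])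
  let ?k = "\<lambda>y. ?g y - GD (GD f) x v y"
  have k: "(?k has_derivative blinfun_apply (?g' y - GD (GD f) x v)) (at y within S)" for y S
    by (rule has_derivative_at_withinI, rule has_derivative_blinfun_diff[OF g])
       (rule bounded_linear_imp_has_derivative[OF blinfun.bounded_linear_right])
  have "norm (?k (x + u) - ?k x) \<le> B * norm v * (norm u + norm v) * norm (x + u - x)"
  proof (rule differentiable_bound[OF convex_closed_segment[of x "x + u"] k])
    fix y assume y: "y \<in> closed_segment x (x + u)"
    then have yx: "norm (y - x) \<le> norm u"
      using segment_bound1[OF y] by simp
    have "norm (GD f (y + v) - GD f y - GD (GD f) x v)
        \<le> norm (GD f (y + v) - GD f y - GD (GD f) y v) + norm ((GD (GD f) y - GD (GD f) x) v)"
      using norm_triangle_ineq[of "GD f (y + v) - GD f y - GD (GD f) y v" "(GD (GD f) y - GD (GD f) x) v"]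
      by (simp add: blinfun.diff_left)
    also have "\<dots> \<le> B * (norm v)\<^sup>2 + B * norm u * norm v"
    proof (intro add_mono taylor_bound[OF f2] norm_blinfun_le)
      show "norm (GD (GD f) y - GD (GD f) x) \<le> B * norm u"
        using smooth1D(3)[OF f2, of y x] mult_left_mono[OF yx B] by linarith
    qed auto
    finally show "onorm (blinfun_apply (?g' y - GD (GD f) x v)) \<le> B * norm v * (norm u + norm v)"
      by (simp add: norm_blinfun.rep_eq[symmetric] power2_eq_square algebra_simps)
  qed auto
  then show ?thesis by (simp add: blinfun.add_right algebra_simps)
qed

lemma symmetric_second_derivative:
  assumes f: "\<And>x. f differentiable (at x)" and f2: "smooth1 B (GD f)"
  shows "GD (GD f) x u v = GD (GD f) x v u"
proof -
  let ?D = "GD (GD f) x u v - GD (GD f) x v u"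
  let ?K = "2 * (B * norm u * norm v * (norm u + norm v))"
  \<comment> \<open>Both sides approximate the same second difference at scale \<open>s\<close>; compare and let \<open>s\<close> tend to zero.\<close>
  have bound: "norm ?D \<le> s * ?K" if s: "s > 0" for s
  proof -
    let ?Q = "(f (x + s *\<^sub>R u + s *\<^sub>R v) - f (x + s *\<^sub>R u)) - (f (x + s *\<^sub>R v) - f x)"
    have 1: "norm (?Q - GD (GD f) x (s *\<^sub>R v) (s *\<^sub>R u)) \<le> s^3 * (B * norm u * norm v * (norm u + norm v))"
      using second_difference_bound[OF f f2, of x "s *\<^sub>R u" "s *\<^sub>R v"] s
      by (simp add: algebra_simps power3_eq_cube)
    have 2: "norm (?Q - GD (GD f) x (s *\<^sub>R u) (s *\<^sub>R v)) \<le> s^3 * (B * norm u * norm v * (norm u + norm v))"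
      using second_difference_bound[OF f f2, of x "s *\<^sub>R v" "s *\<^sub>R u"] s
      by (simp add: algebra_simps power3_eq_cube)
    have "s\<^sup>2 *\<^sub>R ?D = (?Q - GD (GD f) x (s *\<^sub>R v) (s *\<^sub>R u)) - (?Q - GD (GD f) x (s *\<^sub>R u) (s *\<^sub>R v))"
      by (simp add: blinfun.scaleR_right blinfun.scaleR_left power2_eq_square scaleR_diff_right)
    then have "s\<^sup>2 * norm ?D = norm ((?Q - GD (GD f) x (s *\<^sub>R v) (s *\<^sub>R u)) - (?Q - GD (GD f) x (s *\<^sub>R u) (s *\<^sub>R v)))"
      by (metis abs_of_nonneg norm_scaleR zero_le_power2)
    also have "\<dots> \<le> s^3 * (B * norm u * norm v * (norm u + norm v)) + s^3 * (B * norm u * norm v * (norm u + norm v))"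
      by (rule order_trans[OF norm_triangle_ineq4 add_mono[OF 1 2]])
    also have "\<dots> = s\<^sup>2 * (s * ?K)" by (simp add: power2_eq_square power3_eq_cube)
    finally show ?thesis using s by simp
  qed
  have "((\<lambda>s. s * ?K) \<longlongrightarrow> 0 * ?K) (at_right 0)" by (intro tendsto_intros)
  then have "norm ?D \<le> 0 * ?K"
    by (rule tendsto_lowerbound) (auto simp: eventually_at_right_less intro!: eventually_mono[OF eventually_at_right_less] bound)
  then show ?thesis by simp
qed

lemma smooth1_increment:
  assumes f: "smooth2 B f"
  shows "smooth1 (B * norm h) (\<lambda>y. f (y + h) - f y)"
proof (rule smooth1I)
  note f1 = smooth2D(2)[OF f] and f2 = smooth2D(1)[OF f]
  show "((\<lambda>y. f (y + h) - f y) has_derivative blinfun_apply (GD f (x + h) - GD f x)) (at x)" for x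
    by (rule has_derivative_blinfun_diff[OF has_derivative_shift[OF smooth1D(1)[OF f1]] smooth1D(1)[OF f1]])
  show "norm (GD f (x + h) - GD f x) \<le> B * norm h" for x
    using smooth1D(3)[OF f1, of "x + h" x] by simp
  show "norm ((GD f (x + h) - GD f x) - (GD f (y + h) - GD f y)) \<le> B * norm h * norm (x - y)" for x y
  proof (rule lipschitz_of_derivative_bound)
    show "((\<lambda>y. GD f (y + h) - GD f y) has_derivative blinfun_apply (GD (GD f) (x + h) - GD (GD f) x)) (at x)" for x
      by (rule has_derivative_blinfun_diff[OF has_derivative_shift[OF smooth1D(1)[OF f2]] smooth1D(1)[OF f2]])
    show "norm (GD (GD f) (x + h) - GD (GD f) x) \<le> B * norm h" for x
      using smooth1D(3)[OF f2, of "x + h" x] by simp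
  qed
qed

text \<open>By symmetry of the second derivative, the derivative of a linearization error is the linearization
error of the derivative.\<close>

lemma has_derivative_linearization_error:
  assumes f: "smooth2 B f"
  shows "((\<lambda>y. f (y + h) - f y - GD f y h) has_derivative
    blinfun_apply (GD f (y + h) - GD f y - GD (GD f) y h)) (at y)"
proof -
  note f1 = smooth2D(2)[OF f] and f2 = smooth2D(1)[OF f]
  have "((\<lambda>y. GD f y h) has_derivative (\<lambda>k. GD (GD f) y k h)) (at y)"
    by (rule bounded_linear.has_derivative[OF blinfun.bounded_linear_left smooth1D(1)[OF f2]])
  moreover have "(\<lambda>k. GD (GD f) y k h) = blinfun_apply (GD (GD f) y h)"
    using symmetric_second_derivative[OF smooth1D(4)[OF f1] f2] by blast
  ultimately have "((\<lambda>y. GD f y h) has_derivative blinfun_apply (GD (GD f) y h)) (at y)" by simp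
  from has_derivative_blinfun_diff[OF has_derivative_blinfun_diff[OF
        has_derivative_shift[OF smooth1D(1)[OF f1]] smooth1D(1)[OF f1]] this]
  show ?thesis .
qed

lemma smooth1_linearization_error:
  assumes f: "smooth3 B f"
  shows "smooth1 (B * (norm h)\<^sup>2) (\<lambda>y. f (y + h) - f y - GD f y h)"
proof (rule smooth1I)
  show "((\<lambda>y. f (y + h) - f y - GD f y h) has_derivative
    blinfun_apply (GD f (y + h) - GD f y - GD (GD f) y h)) (at y)" for y
    by (rule has_derivative_linearization_error[OF smooth3D(2)[OF f]])
  show "norm (GD f (x + h) - GD f x - GD (GD f) x h) \<le> B * (norm h)\<^sup>2" for x
    by (rule taylor_bound[OF smooth2D(1)[OF smooth3D(2)[OF f]]])
  show "norm ((GD f (x + h) - GD f x - GD (GD f) x h) - (GD f (y + h) - GD f y - GD (GD f) y h))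
    \<le> B * (norm h)\<^sup>2 * norm (x - y)" for x y
    by (rule lipschitz_of_derivative_bound[OF has_derivative_linearization_error[OF smooth3D(1)[OF f]]
          taylor_bound[OF smooth2D(1)[OF smooth3D(1)[OF f]]]])
qed

lemma smooth1_uminus: "smooth1 B f \<Longrightarrow> smooth1 B (\<lambda>y. - f y)"
proof (rule smooth1I)
  assume f: "smooth1 B f"
  show "((\<lambda>y. - f y) has_derivative blinfun_apply (- GD f x)) (at x)" for x
    by (rule has_derivative_eq_rhs[OF has_derivative_minus[OF smooth1D(1)[OF f]]])
       (simp add: fun_eq_iff blinfun.minus_left)
  show "norm (- GD f x) \<le> B" for x using smooth1D(2)[OF f] by simp
  show "norm (- GD f x - - GD f y) \<le> B * norm (x - y)" for x y
    using smooth1D(3)[OF f, of y x] by (simp add: norm_minus_commute)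
qed

lemma has_derivative_reflect:
  assumes "\<And>x. (f has_derivative blinfun_apply (f' x)) (at x)"
  shows "((\<lambda>y. f (x - y)) has_derivative blinfun_apply (- f' (x - y))) (at y)"
proof -
  have "((\<lambda>y. x - y) has_derivative (\<lambda>k. - k)) (at y)"
    by (auto intro!: derivative_eq_intros)
  from has_derivative_compose[OF this assms] show ?thesis
    by (rule has_derivative_eq_rhs) (simp add: fun_eq_iff blinfun.minus_left blinfun.minus_right)
qed

lemma smooth1_reflect:
  assumes f: "smooth1 B f"
  shows "smooth1 B (\<lambda>y. f (x - y))" "GD (\<lambda>y. f (x - y)) = (\<lambda>y. - GD f (x - y))"
proof -
  show "smooth1 B (\<lambda>y. f (x - y))"
  proof (rule smooth1I)
    show "((\<lambda>y. f (x - y)) has_derivative blinfun_apply (- GD f (x - z))) (at z)" for z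
      by (rule has_derivative_reflect[OF smooth1D(1)[OF f]])
    show "norm (- GD f (x - z)) \<le> B" for z using smooth1D(2)[OF f] by simp
    show "norm (- GD f (x - z) - - GD f (x - y)) \<le> B * norm (z - y)" for z y
      using smooth1D(3)[OF f, of "x - y" "x - z"] by simp
  qed
  show "GD (\<lambda>y. f (x - y)) = (\<lambda>y. - GD f (x - y))"
    using GD_eqI[OF has_derivative_reflect[OF smooth1D(1)[OF f]]] by blast
qed

lemma smooth2_reflect:
  assumes f: "smooth2 B f"
  shows "smooth2 B (\<lambda>y. f (x - y))"
  using smooth1_reflect[OF smooth2D(2)[OF f], of x]
    smooth1_uminus[OF smooth1_reflect(1)[OF smooth2D(1)[OF f], of x]]
  by (simp add: smooth2_def smooth1_def)

section \<open>Composition of controlled paths with fields\<close>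

definition eval_at :: "'a::real_normed_vector \<Rightarrow> ('a \<Rightarrow>\<^sub>L 'b::real_normed_vector) \<Rightarrow>\<^sub>L 'b" where
  "eval_at x = Blinfun (\<lambda>L. blinfun_apply L x)"

lemma eval_at_apply [simp]: "blinfun_apply (eval_at x) L = blinfun_apply L x"
  unfolding eval_at_def by (subst bounded_linear_Blinfun_apply) (rule blinfun.bounded_linear_left, rule refl)

lemma norm_eval_at: "norm (eval_at x) \<le> norm x"
  by (rule norm_blinfun_bound) (auto simp: mult.commute[of "norm x"] norm_blinfun)

lemma norm_eval_at_le: "norm x \<le> d \<Longrightarrow> norm (eval_at x) \<le> d"
  using norm_eval_at order_trans by blast

lemma mean_value_unit_interval:
  assumes d: "\<And>l. l \<in> {0..1} \<Longrightarrow> (g has_vector_derivative g' l) (at l within {0..1::real})"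
    and b: "\<And>l. l \<in> {0..1} \<Longrightarrow> norm (g' l) \<le> K"
  shows "norm (g 1 - g 0) \<le> K"
proof -
  have "norm (g 1 - g 0) \<le> K * norm (1 - 0 :: real)"
  proof (rule differentiable_bound[of "{0..1}" g "\<lambda>l h. h *\<^sub>R g' l"])
    show "onorm (\<lambda>h. h *\<^sub>R g' l) \<le> K" if "l \<in> {0..1}" for l
      using b[OF that] by (intro onorm_le) (simp add: mult.commute[of K] mult_left_mono)
  qed (use d in \<open>auto simp: has_vector_derivative_def\<close>)
  then show ?thesis by simp
qed

context rough begin

text \<open>How the seminorm grows under composition with a field whose constant is one: quadratic because of
the second-order Taylor remainder.\<close>

definition growth :: "real \<Rightarrow> real" where "growth M = 4 * \<kappa>\<^sup>2 * M\<^sup>2 + M"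

lemma growth_nonneg: "M \<ge> 0 \<Longrightarrow> growth M \<ge> 0" by (simp add: growth_def)

lemma ctrl_semi_compose:
  assumes f: "smooth1 B f" and y: "ctrl_semi M y y'"
  shows "ctrl_semi (B * growth M) (\<lambda>\<xi>. f (y \<xi>)) (\<lambda>\<xi>. GD f (y \<xi>) o\<^sub>L y' \<xi>)"
  unfolding ctrl_semi_def
proof (intro conjI ballI)
  note B = smooth1_nonneg[OF f] and M = ctrl_semi_nonneg[OF y]
  have BM: "B * M \<ge> 0" using B M by simp
  have k2: "\<kappa> \<le> \<kappa>\<^sup>2" using \<kappa> by (simp add: power2_eq_square)
  fix \<xi> \<eta> :: real assume *: "\<xi> \<in> {0..1}" "\<eta> \<in> {0..1}"
  note inc = ctrl_path_inc[OF y *]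
  show "norm (GD f (y \<xi>) o\<^sub>L y' \<xi>) \<le> B * growth M"
  proof -
    have "norm (GD f (y \<xi>) o\<^sub>L y' \<xi>) \<le> B * M"
      by (rule norm_blinfun_compose_le[OF smooth1D(2)[OF f] ctrl_semiD(1)[OF y *(1)]])
    also have "\<dots> \<le> B * growth M" using B by (intro mult_left_mono) (auto simp: growth_def)
    finally show ?thesis .
  qed
  have "norm (GD f (y \<xi>) - GD f (y \<eta>)) \<le> B * (2 * \<kappa> * M * \<omega> \<xi> \<eta>)"
    using smooth1D(3)[OF f] mult_left_mono[OF inc B] by (rule order_trans)
  moreover have "(GD f (y \<xi>) o\<^sub>L y' \<xi>) - (GD f (y \<eta>) o\<^sub>L y' \<eta>)
    = ((GD f (y \<xi>) - GD f (y \<eta>)) o\<^sub>L y' \<xi>) + (GD f (y \<eta>) o\<^sub>L (y' \<xi> - y' \<eta>))"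
    by (rule blinfun_eqI) (simp add: blinfun.diff_left blinfun.diff_right blinfun.add_left)
  ultimately have "norm ((GD f (y \<xi>) o\<^sub>L y' \<xi>) - (GD f (y \<eta>) o\<^sub>L y' \<eta>))
      \<le> B * (2 * \<kappa> * M * \<omega> \<xi> \<eta>) * M + B * (M * \<omega> \<xi> \<eta>)"
    using ctrl_semiD(1,2)[OF y *(1)] *(2) smooth1D(2)[OF f]
    by (auto intro!: norm_triangle_mono norm_blinfun_compose_le)
  also have "\<dots> = B * (2 * \<kappa> * M\<^sup>2 + M) * \<omega> \<xi> \<eta>" by (simp add: power2_eq_square algebra_simps)
  also have "\<dots> \<le> B * growth M * \<omega> \<xi> \<eta>"
    unfolding growth_def using B k2 \<kappa> by (intro mult_right_mono mult_left_mono add_mono) auto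
  finally show "norm ((GD f (y \<xi>) o\<^sub>L y' \<xi>) - (GD f (y \<eta>) o\<^sub>L y' \<eta>)) \<le> B * growth M * \<omega> \<xi> \<eta>" .
  have "f (y \<xi>) - f (y \<eta>) - (GD f (y \<eta>) o\<^sub>L y' \<eta>) (X \<xi> - X \<eta>)
    = (f (y \<eta> + (y \<xi> - y \<eta>)) - f (y \<eta>) - GD f (y \<eta>) (y \<xi> - y \<eta>))
      + GD f (y \<eta>) (y \<xi> - y \<eta> - y' \<eta> (X \<xi> - X \<eta>))"
    by (simp add: blinfun.diff_right)
  also have "norm \<dots> \<le> B * (2 * \<kappa> * M * \<omega> \<xi> \<eta>)\<^sup>2 + B * (M * (\<omega> \<xi> \<eta>)\<^sup>2)"
  proof (intro norm_triangle_mono norm_blinfun_le smooth1D(2)[OF f] ctrl_semiD(3)[OF y *])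
    show "norm (f (y \<eta> + (y \<xi> - y \<eta>)) - f (y \<eta>) - GD f (y \<eta>) (y \<xi> - y \<eta>)) \<le> B * (2 * \<kappa> * M * \<omega> \<xi> \<eta>)\<^sup>2"
      using taylor_bound[OF f] mult_left_mono[OF power_mono[OF inc norm_ge_zero] B] by (rule order_trans)
  qed
  also have "\<dots> = B * growth M * (\<omega> \<xi> \<eta>)\<^sup>2"
    by (simp add: growth_def power_mult_distrib algebra_simps)
  finally show "norm (f (y \<xi>) - f (y \<eta>) - (GD f (y \<eta>) o\<^sub>L y' \<eta>) (X \<xi> - X \<eta>)) \<le> B * growth M * (\<omega> \<xi> \<eta>)\<^sup>2" .
qed

text \<open>The Leibniz rule. The remainder of the product consists of the two remainders and of the product of
the two increments, which is of second order.\<close>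

lemma ctrl_product:
  assumes u: "ctrl N u u'" and v: "ctrl d v v'"
  shows "ctrl (6 * \<kappa>\<^sup>2 * N * d) (\<lambda>\<xi>. blinfun_apply (u \<xi>) (v \<xi>))
    (\<lambda>\<xi>. (u \<xi> o\<^sub>L v' \<xi>) + (eval_at (v \<xi>) o\<^sub>L u' \<xi>))"
  unfolding ctrl_def ctrl_semi_def
proof (intro conjI ballI)
  note us = ctrlD(1)[OF u] and vs = ctrlD(1)[OF v]
  note N = ctrl_nonneg[OF u] and d = ctrl_nonneg[OF v]
  have Nd: "N * d \<ge> 0" using N d by simp
  have k1: "1 \<le> \<kappa>\<^sup>2" using \<kappa> by (simp add: one_le_power)
  have k2: "\<kappa> \<le> \<kappa>\<^sup>2" using \<kappa> by (simp add: power2_eq_square)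
  fix \<xi> :: real assume \<xi>: "\<xi> \<in> {0..1}"
  have "norm (u \<xi> (v \<xi>)) \<le> N * d" by (intro norm_blinfun_le ctrlD(2)[OF u \<xi>] ctrlD(2)[OF v \<xi>])
  also have "\<dots> = 1 * (N * d)" by simp
  also have "\<dots> \<le> 6 * \<kappa>\<^sup>2 * (N * d)" using k1 Nd by (intro mult_right_mono) auto
  finally show "norm (u \<xi> (v \<xi>)) \<le> 6 * \<kappa>\<^sup>2 * N * d" by (simp add: mult.assoc)
  have "norm ((u \<xi> o\<^sub>L v' \<xi>) + (eval_at (v \<xi>) o\<^sub>L u' \<xi>)) \<le> N * d + d * N"
    by (intro norm_triangle_mono norm_blinfun_compose_le norm_eval_at_le
        ctrlD(2)[OF u \<xi>] ctrlD(2)[OF v \<xi>] ctrl_semiD(1)[OF us \<xi>] ctrl_semiD(1)[OF vs \<xi>])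
  also have "\<dots> = 2 * (N * d)" by simp
  also have "\<dots> \<le> 6 * \<kappa>\<^sup>2 * (N * d)" using k1 Nd by (intro mult_right_mono) auto
  finally show "norm ((u \<xi> o\<^sub>L v' \<xi>) + (eval_at (v \<xi>) o\<^sub>L u' \<xi>)) \<le> 6 * \<kappa>\<^sup>2 * N * d" by (simp add: mult.assoc)
  fix \<eta> :: real assume \<eta>: "\<eta> \<in> {0..1}"
  let ?w = "\<omega> \<xi> \<eta>"
  note du = ctrl_path_inc[OF us \<xi> \<eta>] and dv = ctrl_path_inc[OF vs \<xi> \<eta>]
  have "(u \<xi> o\<^sub>L v' \<xi>) + (eval_at (v \<xi>) o\<^sub>L u' \<xi>) - ((u \<eta> o\<^sub>L v' \<eta>) + (eval_at (v \<eta>) o\<^sub>L u' \<eta>))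
    = (((u \<xi> - u \<eta>) o\<^sub>L v' \<xi>) + (u \<eta> o\<^sub>L (v' \<xi> - v' \<eta>)))
    + ((eval_at (v \<xi> - v \<eta>) o\<^sub>L u' \<xi>) + (eval_at (v \<eta>) o\<^sub>L (u' \<xi> - u' \<eta>)))"
    by (rule blinfun_eqI) (simp add: blinfun.diff_left blinfun.diff_right blinfun.add_left)
  also have "norm \<dots> \<le> (2 * \<kappa> * N * ?w * d + N * (d * ?w)) + (2 * \<kappa> * d * ?w * N + d * (N * ?w))"
    by (intro norm_triangle_mono norm_blinfun_compose_le norm_eval_at_le du dv
        ctrlD(2)[OF u \<eta>] ctrlD(2)[OF v \<eta>] ctrl_semiD(1)[OF us \<xi>] ctrl_semiD(1)[OF vs \<xi>]
        ctrl_semiD(2)[OF us \<xi> \<eta>] ctrl_semiD(2)[OF vs \<xi> \<eta>])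
  also have "\<dots> = (4 * \<kappa> + 2) * (N * d * ?w)" by (simp add: algebra_simps)
  also have "\<dots> \<le> 6 * \<kappa>\<^sup>2 * (N * d * ?w)" using k1 k2 Nd by (intro mult_right_mono) auto
  finally show "norm ((u \<xi> o\<^sub>L v' \<xi>) + (eval_at (v \<xi>) o\<^sub>L u' \<xi>) - ((u \<eta> o\<^sub>L v' \<eta>) + (eval_at (v \<eta>) o\<^sub>L u' \<eta>)))
    \<le> 6 * \<kappa>\<^sup>2 * N * d * ?w" by (simp add: mult.assoc)
  have "u \<xi> (v \<xi>) - u \<eta> (v \<eta>) - ((u \<eta> o\<^sub>L v' \<eta>) + (eval_at (v \<eta>) o\<^sub>L u' \<eta>)) (X \<xi> - X \<eta>)
    = ((u \<xi> - u \<eta> - u' \<eta> (X \<xi> - X \<eta>)) (v \<eta>) + u \<eta> (v \<xi> - v \<eta> - v' \<eta> (X \<xi> - X \<eta>)))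
      + (u \<xi> - u \<eta>) (v \<xi> - v \<eta>)"
    by (simp add: blinfun.diff_left blinfun.diff_right blinfun.add_left)
  also have "norm \<dots> \<le> (N * ?w\<^sup>2 * d + N * (d * ?w\<^sup>2)) + 2 * \<kappa> * N * ?w * (2 * \<kappa> * d * ?w)"
    by (intro norm_triangle_mono norm_blinfun_le du dv ctrlD(2)[OF u \<eta>] ctrlD(2)[OF v \<eta>]
        ctrl_semiD(3)[OF us \<xi> \<eta>] ctrl_semiD(3)[OF vs \<xi> \<eta>])
  also have "\<dots> = (4 * \<kappa>\<^sup>2 + 2) * (N * d * ?w\<^sup>2)" by (simp add: power2_eq_square algebra_simps)
  also have "\<dots> \<le> 6 * \<kappa>\<^sup>2 * (N * d * ?w\<^sup>2)" using k1 Nd by (intro mult_right_mono) auto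
  finally show "norm (u \<xi> (v \<xi>) - u \<eta> (v \<eta>) - ((u \<eta> o\<^sub>L v' \<eta>) + (eval_at (v \<eta>) o\<^sub>L u' \<eta>)) (X \<xi> - X \<eta>))
    \<le> 6 * \<kappa>\<^sup>2 * N * d * ?w\<^sup>2" by (simp add: mult.assoc)
qed

text \<open>Every quantity bounded by \<open>ctrl\<close> is linear in the pair \<open>(z, z')\<close>, so the mean value theorem applies
to each of them.\<close>

lemma ctrl_mean_value:
  assumes z: "\<And>l \<xi>. l \<in> {0..1} \<Longrightarrow> \<xi> \<in> {0..1} \<Longrightarrow>
      ((\<lambda>l. z l \<xi>) has_vector_derivative dz l \<xi>) (at l within {0..1::real})"
    and z': "\<And>l \<xi>. l \<in> {0..1} \<Longrightarrow> \<xi> \<in> {0..1} \<Longrightarrow>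
      ((\<lambda>l. z' l \<xi>) has_vector_derivative dz' l \<xi>) (at l within {0..1::real})"
    and K: "\<And>l. l \<in> {0..1} \<Longrightarrow> ctrl K (dz l) (dz' l)"
  shows "ctrl K (\<lambda>\<xi>. z 1 \<xi> - z 0 \<xi>) (\<lambda>\<xi>. z' 1 \<xi> - z' 0 \<xi>)"
  unfolding ctrl_def ctrl_semi_def
proof (intro conjI ballI)
  fix \<xi> :: real assume \<xi>: "\<xi> \<in> {0..1}"
  show "norm (z 1 \<xi> - z 0 \<xi>) \<le> K"
    by (rule mean_value_unit_interval[OF z[OF _ \<xi>] ctrlD(2)[OF K \<xi>]])
  show "norm (z' 1 \<xi> - z' 0 \<xi>) \<le> K"
    by (rule mean_value_unit_interval[OF z'[OF _ \<xi>] ctrl_semiD(1)[OF ctrlD(1)[OF K] \<xi>]])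
  fix \<eta> :: real assume \<eta>: "\<eta> \<in> {0..1}"
  have "norm ((z' 1 \<xi> - z' 1 \<eta>) - (z' 0 \<xi> - z' 0 \<eta>)) \<le> K * \<omega> \<xi> \<eta>"
    by (rule mean_value_unit_interval[OF has_vector_derivative_diff[OF z'[OF _ \<xi>] z'[OF _ \<eta>]]
          ctrl_semiD(2)[OF ctrlD(1)[OF K] \<xi> \<eta>]])
  then show "norm (z' 1 \<xi> - z' 0 \<xi> - (z' 1 \<eta> - z' 0 \<eta>)) \<le> K * \<omega> \<xi> \<eta>" by (simp add: algebra_simps)
  have "norm ((z 1 \<xi> - z 1 \<eta> - z' 1 \<eta> (X \<xi> - X \<eta>)) - (z 0 \<xi> - z 0 \<eta> - z' 0 \<eta> (X \<xi> - X \<eta>))) \<le> K * (\<omega> \<xi> \<eta>)\<^sup>2"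
    by (rule mean_value_unit_interval[OF has_vector_derivative_diff[OF has_vector_derivative_diff[OF z[OF _ \<xi>] z[OF _ \<eta>]]
            bounded_linear.has_vector_derivative[OF blinfun.bounded_linear_left z'[OF _ \<eta>]]]
          ctrl_semiD(3)[OF ctrlD(1)[OF K] \<xi> \<eta>]])
  then show "norm (z 1 \<xi> - z 0 \<xi> - (z 1 \<eta> - z 0 \<eta>) - (z' 1 \<eta> - z' 0 \<eta>) (X \<xi> - X \<eta>)) \<le> K * (\<omega> \<xi> \<eta>)\<^sup>2"
    by (simp add: algebra_simps blinfun.diff_left)
qed

text \<open>Along the segment \<open>W\<close> from \<open>y\<close> to \<open>x\<close>, the derivative of \<open>f(W)\<close> is the product of the controlled
paths \<open>GD f (W)\<close> and \<open>x - y\<close>. The symmetry of \<open>GD (GD f)\<close> is what identifies the derivative of the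
Gubinelli derivative with that of the product.\<close>

lemma ctrl_compose_diff:
  assumes f: "smooth2 B f" and y: "ctrl_semi M y y'" and x: "ctrl_semi M x x'"
    and d: "ctrl d (\<lambda>\<xi>. x \<xi> - y \<xi>) (\<lambda>\<xi>. x' \<xi> - y' \<xi>)"
  shows "ctrl (6 * \<kappa>\<^sup>2 * (B * (1 + growth M)) * d) (\<lambda>\<xi>. f (x \<xi>) - f (y \<xi>))
    (\<lambda>\<xi>. (GD f (x \<xi>) o\<^sub>L x' \<xi>) - (GD f (y \<xi>) o\<^sub>L y' \<xi>))"
proof -
  note f1 = smooth2D(2)[OF f] and f2 = smooth2D(1)[OF f]
  note B = smooth1_nonneg[OF f1] and M = ctrl_semi_nonneg[OF x]
  define D where "D \<xi> = x \<xi> - y \<xi>" for \<xi>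
  define D' where "D' \<xi> = x' \<xi> - y' \<xi>" for \<xi>
  define W where "W l \<xi> = y \<xi> + l *\<^sub>R D \<xi>" for l \<xi>
  define W' where "W' l \<xi> = y' \<xi> + l *\<^sub>R D' \<xi>" for l \<xi>
  have W: "ctrl_semi M (W l) (W' l)" if "l \<in> {0..1}" for l
  proof -
    have "ctrl_semi (\<bar>1 - l\<bar> * M + \<bar>l\<bar> * M) (\<lambda>\<xi>. (1 - l) *\<^sub>R y \<xi> + l *\<^sub>R x \<xi>)
        (\<lambda>\<xi>. (1 - l) *\<^sub>R y' \<xi> + l *\<^sub>R x' \<xi>)"
      by (intro ctrl_semi_add ctrl_semi_scaleR x y)
    also have "\<bar>1 - l\<bar> * M + \<bar>l\<bar> * M = M" using that by (simp add: algebra_simps)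
    also have "(\<lambda>\<xi>. (1 - l) *\<^sub>R y \<xi> + l *\<^sub>R x \<xi>) = W l"
      by (simp add: W_def D_def algebra_simps fun_eq_iff)
    also have "(\<lambda>\<xi>. (1 - l) *\<^sub>R y' \<xi> + l *\<^sub>R x' \<xi>) = W' l"
      by (simp add: W'_def D'_def algebra_simps fun_eq_iff)
    finally show ?thesis .
  qed
  have dW: "((\<lambda>l. W l \<xi>) has_vector_derivative D \<xi>) (at l within S)"
    "((\<lambda>l. W' l \<xi>) has_vector_derivative D' \<xi>) (at l within S)" for l \<xi> S
    unfolding W_def W'_def by (auto intro!: derivative_eq_intros)
  have chain: "((\<lambda>l. g (W l \<xi>)) has_vector_derivative G (D \<xi>)) (at l within S)"
    if "(g has_derivative blinfun_apply G) (at (W l \<xi>))" for g :: "'a \<Rightarrow> 'c::real_normed_vector" and G \<xi> l S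
    using vector_derivative_diff_chain_within[OF dW(1) has_derivative_at_withinI[OF that]]
    by (simp add: o_def)
  have "ctrl (6 * \<kappa>\<^sup>2 * (B * (1 + growth M)) * d) (\<lambda>\<xi>. f (W 1 \<xi>) - f (W 0 \<xi>))
    (\<lambda>\<xi>. (GD f (W 1 \<xi>) o\<^sub>L W' 1 \<xi>) - (GD f (W 0 \<xi>) o\<^sub>L W' 0 \<xi>))"
  proof (rule ctrl_mean_value)
    fix l :: real assume l: "l \<in> {0..1}"
    show "((\<lambda>l. f (W l \<xi>)) has_vector_derivative GD f (W l \<xi>) (D \<xi>)) (at l within {0..1})" for \<xi>
      by (rule chain[OF smooth1D(1)[OF f1]])
    show "((\<lambda>l. GD f (W l \<xi>) o\<^sub>L W' l \<xi>) has_vector_derivative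
        (GD f (W l \<xi>) o\<^sub>L D' \<xi>) + (eval_at (D \<xi>) o\<^sub>L (GD (GD f) (W l \<xi>) o\<^sub>L W' l \<xi>))) (at l within {0..1})" for \<xi>
    proof -
      have eq: "GD (GD f) (W l \<xi>) (D \<xi>) o\<^sub>L W' l \<xi> = eval_at (D \<xi>) o\<^sub>L (GD (GD f) (W l \<xi>) o\<^sub>L W' l \<xi>)"
        by (rule blinfun_eqI) (simp add: symmetric_second_derivative[OF smooth1D(4)[OF f1] f2, of _ "D \<xi>"])
      show ?thesis
        unfolding eq[symmetric]
        by (rule bounded_bilinear.has_vector_derivative[OF bounded_bilinear_blinfun_compose
              chain[OF smooth1D(1)[OF f2]] dW(2)])
    qed
    have "ctrl (B * (1 + growth M)) (\<lambda>\<xi>. GD f (W l \<xi>)) (\<lambda>\<xi>. GD (GD f) (W l \<xi>) o\<^sub>L W' l \<xi>)"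
      unfolding ctrl_def
    proof (intro conjI ballI)
      show "norm (GD f (W l \<xi>)) \<le> B * (1 + growth M)" for \<xi>
        using smooth1D(2)[OF f1, of "W l \<xi>"] mult_left_mono[OF _ B, of 1 "1 + growth M"] growth_nonneg[OF M]
        by simp
      show "ctrl_semi (B * (1 + growth M)) (\<lambda>\<xi>. GD f (W l \<xi>)) (\<lambda>\<xi>. GD (GD f) (W l \<xi>) o\<^sub>L W' l \<xi>)"
        by (rule ctrl_semi_mono[OF ctrl_semi_compose[OF f2 W[OF l]]]) (use B in \<open>auto intro: mult_left_mono\<close>)
    qed
    then show "ctrl (6 * \<kappa>\<^sup>2 * (B * (1 + growth M)) * d) (\<lambda>\<xi>. GD f (W l \<xi>) (D \<xi>))
      (\<lambda>\<xi>. (GD f (W l \<xi>) o\<^sub>L D' \<xi>) + (eval_at (D \<xi>) o\<^sub>L (GD (GD f) (W l \<xi>) o\<^sub>L W' l \<xi>)))"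
      using d unfolding D_def[symmetric] D'_def[symmetric] by (rule ctrl_product)
  qed
  then show ?thesis by (simp add: W_def W'_def D_def D'_def)
qed

end

section \<open>The velocity field of a closed controlled path\<close>

text \<open>Pairs an integrand whose values are linear maps with the integrator, and returns a linear map. With
it the derivative of an integral with respect to a parameter is again an integral.\<close>

definition lift_bilinear ::
  "('z::real_normed_vector \<Rightarrow> 'w::real_normed_vector \<Rightarrow> 'b::real_normed_vector) \<Rightarrow>
   ('a::real_normed_vector \<Rightarrow>\<^sub>L 'z) \<Rightarrow> 'w \<Rightarrow> ('a \<Rightarrow>\<^sub>L 'b)" where
  "lift_bilinear p L w = Blinfun (\<lambda>h. p (blinfun_apply L h) w)"

lemma lift_bilinear_apply:
  assumes "contractive_bilinear p"
  shows "blinfun_apply (lift_bilinear p L w) h = p (blinfun_apply L h) w"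
proof -
  interpret p: bounded_bilinear p using assms by (simp add: contractive_bilinear_def)
  have "bounded_linear (\<lambda>h. p (blinfun_apply L h) w)"
    by (rule bounded_linear_compose[OF p.bounded_linear_left blinfun.bounded_linear_right])
  then show ?thesis by (simp add: lift_bilinear_def bounded_linear_Blinfun_apply)
qed

lemma contractive_lift_bilinear:
  fixes p :: "'z::real_normed_vector \<Rightarrow> 'w::real_normed_vector \<Rightarrow> 'b::real_normed_vector"
  assumes p: "contractive_bilinear p"
  shows "contractive_bilinear (lift_bilinear p :: ('a::real_normed_vector \<Rightarrow>\<^sub>L 'z) \<Rightarrow> 'w \<Rightarrow> ('a \<Rightarrow>\<^sub>L 'b))"
proof -
  interpret p: bounded_bilinear p using p by (simp add: contractive_bilinear_def)
  note app = lift_bilinear_apply[OF p]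
  have n: "norm (lift_bilinear p L w) \<le> norm L * norm w" for L :: "'a \<Rightarrow>\<^sub>L 'z" and w
  proof (rule norm_blinfun_bound)
    fix h
    have "norm (p (L h) w) \<le> (norm L * norm h) * norm w"
      by (intro contractive_bilinear_bound[OF p] norm_blinfun order_refl)
    then show "norm (lift_bilinear p L w h) \<le> norm L * norm w * norm h" by (simp add: app mult_ac)
  qed auto
  have "bounded_bilinear (lift_bilinear p :: ('a \<Rightarrow>\<^sub>L 'z) \<Rightarrow> 'w \<Rightarrow> ('a \<Rightarrow>\<^sub>L 'b))"
  proof
    show "\<exists>K. \<forall>(a :: 'a \<Rightarrow>\<^sub>L 'z) b. norm (lift_bilinear p a b) \<le> norm a * norm b * K" using n by (intro exI[of _ 1]) simp
  qed (rule blinfun_eqI; simp add: app blinfun.add_left blinfun.scaleR_left p.add_left p.add_right p.scaleR_left p.scaleR_right)+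
  with n show ?thesis by (simp add: contractive_bilinear_def)
qed

context rough begin

lemma rough_integral_diff_left:
  assumes p: "contractive_bilinear p" and z: "ctrl_semi N z z'" and y: "ctrl_semi K y y'"
    and w: "ctrl_semi M w w'"
  shows "rough_integral p (\<lambda>\<xi>. z \<xi> - y \<xi>) (\<lambda>\<xi>. z' \<xi> - y' \<xi>) w w'
    = rough_integral p z z' w w' - rough_integral p y y' w w'"
proof -
  have "ctrl_semi (N + \<bar>-1\<bar> * K) (\<lambda>\<xi>. z \<xi> + (-1) *\<^sub>R y \<xi>) (\<lambda>\<xi>. z' \<xi> + (-1) *\<^sub>R y' \<xi>)"
    by (intro ctrl_semi_add ctrl_semi_scaleR z y)
  then have d: "ctrl_semi (N + K) (\<lambda>\<xi>. z \<xi> - y \<xi>) (\<lambda>\<xi>. z' \<xi> - y' \<xi>)" by simp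
  show ?thesis using rough_integral_add_left[OF p d y w] by simp
qed

lemma rough_integral_eval:
  assumes p: "contractive_bilinear p" and z: "ctrl_semi N z z'" and w: "ctrl_semi M w w'"
    and zh: "ctrl_semi N' (\<lambda>\<xi>. blinfun_apply (z \<xi>) h) (\<lambda>\<xi>. eval_at h o\<^sub>L z' \<xi>)"
  shows "rough_integral p (\<lambda>\<xi>. blinfun_apply (z \<xi>) h) (\<lambda>\<xi>. eval_at h o\<^sub>L z' \<xi>) w w'
    = rough_integral (lift_bilinear p) z z' w w' h"
proof -
  note app = lift_bilinear_apply[OF p]
  have "dyadic_sum (germ p (\<lambda>\<xi>. blinfun_apply (z \<xi>) h) (\<lambda>\<xi>. eval_at h o\<^sub>L z' \<xi>) w w') n 0 1
    = dyadic_sum (germ (lift_bilinear p) z z' w w') n 0 1 h" for n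
    by (simp add: dyadic_sum_def germ_def blinfun.sum_left blinfun.add_left blinfun.scaleR_left app)
  then have "(\<lambda>n. dyadic_sum (germ p (\<lambda>\<xi>. blinfun_apply (z \<xi>) h) (\<lambda>\<xi>. eval_at h o\<^sub>L z' \<xi>) w w') n 0 1)
    \<longlonglongrightarrow> rough_integral (lift_bilinear p) z z' w w' h"
    using bounded_linear.tendsto[OF blinfun.bounded_linear_left
        rough_integral_limit[OF contractive_lift_bilinear[OF p] z w]] by simp
  then show ?thesis using rough_integral_limit[OF p zh w] by (rule LIMSEQ_unique[rotated])
qed

definition line_integral ::
  "('z::real_normed_vector \<Rightarrow> 'w::real_normed_vector \<Rightarrow> 'b::banach) \<Rightarrow>
   ('w \<Rightarrow> 'z) \<Rightarrow> (real \<Rightarrow> 'w) \<Rightarrow> (real \<Rightarrow> (real^3) \<Rightarrow>\<^sub>L 'w) \<Rightarrow> 'b" where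
  "line_integral p f y y' = rough_integral p (\<lambda>\<xi>. f (y \<xi>)) (\<lambda>\<xi>. GD f (y \<xi>) o\<^sub>L y' \<xi>) y y'"

text \<open>\<open>K\<^sub>b\<close> and \<open>K\<^sub>l\<close> are the constants for the size of a line integral and for its Lipschitz
dependence on the path, on the ball of radius \<open>M\<close>.\<close>

definition K\<^sub>b :: "real \<Rightarrow> real" where "K\<^sub>b M = c\<^sub>I * growth M * M"

definition K\<^sub>l :: "real \<Rightarrow> real" where
  "K\<^sub>l M = c\<^sub>I * (6 * \<kappa>\<^sup>2 * (1 + growth M)) * M + c\<^sub>I * growth M"

lemma K_nonneg: "M \<ge> 0 \<Longrightarrow> K\<^sub>b M \<ge> 0" "M \<ge> 0 \<Longrightarrow> K\<^sub>l M \<ge> 0"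
  using c\<^sub>I_nonneg growth_nonneg by (simp_all add: K\<^sub>b_def K\<^sub>l_def)

lemma line_integral_bound:
  assumes "contractive_bilinear p" "smooth1 B f" "ctrl_semi M y y'" "y 0 = y 1"
  shows "norm (line_integral p f y y') \<le> B * K\<^sub>b M"
  using rough_integral_bound[OF assms(1) ctrl_semi_compose[OF assms(2,3)] assms(3,4)]
  by (simp add: line_integral_def K\<^sub>b_def mult_ac)

lemma line_integral_diff:
  assumes p: "contractive_bilinear p" and f: "smooth1 B f" and g: "smooth1 C g" and y: "ctrl_semi M y y'"
  shows "line_integral p (\<lambda>v. f v - g v) y y' = line_integral p f y y' - line_integral p g y y'"
proof -
  have "GD (\<lambda>v. f v - g v) v = GD f v - GD g v" for v
    by (rule GD_eqI[OF has_derivative_blinfun_diff[OF smooth1D(1)[OF f] smooth1D(1)[OF g]]])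
  moreover have "((GD f v - GD g v) o\<^sub>L L) = (GD f v o\<^sub>L L) - (GD g v o\<^sub>L L)" for v and L :: "(real^3) \<Rightarrow>\<^sub>L 'b"
    by (rule blinfun_eqI) (simp add: blinfun.diff_left)
  ultimately show ?thesis
    unfolding line_integral_def
    using rough_integral_diff_left[OF p ctrl_semi_compose[OF f y] ctrl_semi_compose[OF g y] y] by simp
qed

lemma smooth1_eval:
  assumes F: "smooth1 B F"
  shows "smooth1 (B * norm h) (\<lambda>v. blinfun_apply (F v) h)"
    "GD (\<lambda>v. blinfun_apply (F v) h) = (\<lambda>v. eval_at h o\<^sub>L GD F v)"
proof -
  have d: "((\<lambda>v. blinfun_apply (F v) h) has_derivative blinfun_apply (eval_at h o\<^sub>L GD F v)) (at v)" for v
    by (rule has_derivative_eq_rhs[OF bounded_linear.has_derivative[OF blinfun.bounded_linear_left smooth1D(1)[OF F]]])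
       (simp add: fun_eq_iff)
  then show "GD (\<lambda>v. blinfun_apply (F v) h) = (\<lambda>v. eval_at h o\<^sub>L GD F v)"
    using GD_eqI[OF d] by blast
  show "smooth1 (B * norm h) (\<lambda>v. blinfun_apply (F v) h)"
  proof (rule smooth1I[OF d])
    show "norm (eval_at h o\<^sub>L GD F v) \<le> B * norm h" for v
      using norm_blinfun_compose_le[OF norm_eval_at smooth1D(2)[OF F]] by (simp add: mult.commute)
    have "(eval_at h o\<^sub>L GD F v) - (eval_at h o\<^sub>L GD F w) = eval_at h o\<^sub>L (GD F v - GD F w)" for v w
      by (rule blinfun_eqI) (simp add: blinfun.diff_left)
    then show "norm ((eval_at h o\<^sub>L GD F v) - (eval_at h o\<^sub>L GD F w)) \<le> B * norm h * norm (v - w)" for v w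
      using norm_blinfun_compose_le[OF norm_eval_at smooth1D(3)[OF F, of v w], of h] by (simp add: mult_ac)
  qed
qed

lemma line_integral_eval:
  assumes p: "contractive_bilinear p" and F: "smooth1 B F" and y: "ctrl_semi M y y'"
  shows "line_integral p (\<lambda>v. blinfun_apply (F v) h) y y' = line_integral (lift_bilinear p) F y y' h"
proof -
  have assoc: "eval_at h o\<^sub>L (GD F v o\<^sub>L L) = (eval_at h o\<^sub>L GD F v) o\<^sub>L L" for v and L :: "(real^3) \<Rightarrow>\<^sub>L 'b"
    by (rule blinfun_eqI) simp
  show ?thesis
    using rough_integral_eval[OF p ctrl_semi_compose[OF F y] y, of _ h]
      ctrl_semi_compose[OF smooth1_eval(1)[OF F, of h] y]
    unfolding line_integral_def smooth1_eval(2)[OF F] assoc by blast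
qed

text \<open>The integral is bilinear, so the difference splits into a change of the integrand, estimated by
\<open>ctrl_compose_diff\<close>, and a change of the integrator.\<close>

lemma line_integral_lipschitz_path:
  assumes p: "contractive_bilinear p" and f: "smooth2 B f"
    and x: "ctrl_semi M x x'" and y: "ctrl_semi M y y'"
    and d: "ctrl d (\<lambda>\<xi>. x \<xi> - y \<xi>) (\<lambda>\<xi>. x' \<xi> - y' \<xi>)"
    and closed: "x 0 = x 1" "y 0 = y 1"
  shows "norm (line_integral p f x x' - line_integral p f y y') \<le> B * K\<^sub>l M * d"
proof -
  note f1 = smooth2D(2)[OF f]
  note fx = ctrl_semi_compose[OF f1 x] and fy = ctrl_semi_compose[OF f1 y]
  note df = ctrlD(1)[OF ctrl_compose_diff[OF f y x d]] and ds = ctrlD(1)[OF d]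
  let ?fy = "\<lambda>\<xi>. f (y \<xi>)" and ?fy' = "\<lambda>\<xi>. GD f (y \<xi>) o\<^sub>L y' \<xi>"
  have 1: "line_integral p f x x' - rough_integral p ?fy ?fy' x x' =
      rough_integral p (\<lambda>\<xi>. f (x \<xi>) - f (y \<xi>)) (\<lambda>\<xi>. (GD f (x \<xi>) o\<^sub>L x' \<xi>) - (GD f (y \<xi>) o\<^sub>L y' \<xi>)) x x'"
    unfolding line_integral_def by (rule rough_integral_diff_left[OF p fx fy x, symmetric])
  have 2: "rough_integral p ?fy ?fy' x x' - line_integral p f y y' =
      rough_integral p ?fy ?fy' (\<lambda>\<xi>. x \<xi> - y \<xi>) (\<lambda>\<xi>. x' \<xi> - y' \<xi>)"
    using rough_integral_add_right[OF p fy y ds] by (simp add: line_integral_def)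
  have "norm (line_integral p f x x' - line_integral p f y y')
      \<le> norm (line_integral p f x x' - rough_integral p ?fy ?fy' x x')
        + norm (rough_integral p ?fy ?fy' x x' - line_integral p f y y')"
    using norm_triangle_ineq[of "line_integral p f x x' - rough_integral p ?fy ?fy' x x'"
        "rough_integral p ?fy ?fy' x x' - line_integral p f y y'"] by simp
  also have "\<dots> \<le> c\<^sub>I * (6 * \<kappa>\<^sup>2 * (B * (1 + growth M)) * d) * M + c\<^sub>I * (B * growth M) * d"
    unfolding 1 2 using closed
    by (intro add_mono rough_integral_bound[OF p df x] rough_integral_bound[OF p fy ds]) auto
  also have "\<dots> = B * K\<^sub>l M * d" by (simp add: K\<^sub>l_def algebra_simps)
  finally show ?thesis .
qed

text \<open>The velocity field of the path, for a general kernel \<open>f\<close> in place of the matrix field.\<close>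

definition kernel_field ::
  "('z::real_normed_vector \<Rightarrow> 'w::real_normed_vector \<Rightarrow> 'b::banach) \<Rightarrow>
   ('w \<Rightarrow> 'z) \<Rightarrow> (real \<Rightarrow> 'w) \<Rightarrow> (real \<Rightarrow> (real^3) \<Rightarrow>\<^sub>L 'w) \<Rightarrow> 'w \<Rightarrow> 'b" where
  "kernel_field p f y y' x = line_integral p (\<lambda>v. f (x - v)) y y'"

lemma kernel_field_bound:
  assumes "contractive_bilinear p" "smooth1 B f" "ctrl_semi M y y'" "y 0 = y 1"
  shows "norm (kernel_field p f y y' x) \<le> B * K\<^sub>b M"
  unfolding kernel_field_def by (rule line_integral_bound[OF assms(1) smooth1_reflect(1)[OF assms(2)] assms(3,4)])

lemma kernel_field_lipschitz_path:
  assumes "contractive_bilinear p" "smooth2 B f" "ctrl_semi M x x'" "ctrl_semi M y y'"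
    "ctrl d (\<lambda>\<xi>. x \<xi> - y \<xi>) (\<lambda>\<xi>. x' \<xi> - y' \<xi>)" "x 0 = x 1" "y 0 = y 1"
  shows "norm (kernel_field p f x x' v - kernel_field p f y y' v) \<le> B * K\<^sub>l M * d"
  unfolding kernel_field_def by (rule line_integral_lipschitz_path[OF assms(1) smooth2_reflect[OF assms(2)] assms(3-)])

text \<open>An increment of the integral is the integral with the increment of the kernel, which is small as a
kernel.\<close>

lemma kernel_field_lipschitz:
  assumes p: "contractive_bilinear p" and f: "smooth2 B f" and y: "ctrl_semi M y y'" and "y 0 = y 1"
  shows "norm (kernel_field p f y y' x - kernel_field p f y y' v) \<le> B * K\<^sub>b M * norm (x - v)"
proof -
  note f1 = smooth2D(2)[OF f]
  have g: "smooth1 B (\<lambda>w. f (x - w))" "smooth1 B (\<lambda>w. f (v - w))"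
    by (rule smooth1_reflect[OF f1])+
  have "kernel_field p f y y' x - kernel_field p f y y' v = line_integral p (\<lambda>w. f (x - w) - f (v - w)) y y'"
    unfolding kernel_field_def by (rule line_integral_diff[OF p g y, symmetric])
  also have "(\<lambda>w. f (x - w) - f (v - w)) = (\<lambda>w. f ((v - w) + (x - v)) - f (v - w))"
    by (simp add: algebra_simps)
  also have "norm (line_integral p \<dots> y y') \<le> B * norm (x - v) * K\<^sub>b M"
    by (rule line_integral_bound[OF p smooth1_reflect(1)[OF smooth1_increment[OF f]] y \<open>y 0 = y 1\<close>])
  finally show ?thesis by (simp add: mult_ac)
qed

text \<open>The linearization error of the integral is the integral with the linearization error of the kernel,
which as a kernel has size \<open>B |h|\<^sup>2\<close>.\<close>

lemma kernel_field_has_derivative: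
  fixes p :: "'z::real_normed_vector \<Rightarrow> 'w::real_normed_vector \<Rightarrow> 'b::banach"
  assumes p: "contractive_bilinear p" and f: "smooth3 B f" and y: "ctrl_semi M y y'" and "y 0 = y 1"
  shows "(kernel_field p f y y' has_derivative blinfun_apply (kernel_field (lift_bilinear p) (GD f) y y' x)) (at x)"
proof -
  note f2 = smooth3D(2)[OF f]
  note f1 = smooth2D(2)[OF f2] and Df = smooth2D(1)[OF f2]
  let ?C = "B * K\<^sub>b M"
  have bound: "norm (kernel_field p f y y' (x + h) - kernel_field p f y y' x - kernel_field (lift_bilinear p) (GD f) y y' x h)
      \<le> ?C * (norm h)\<^sup>2" for h
  proof -
    have 1: "kernel_field (lift_bilinear p) (GD f) y y' x h = line_integral p (\<lambda>v. GD f (x - v) h) y y'"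
      unfolding kernel_field_def by (rule line_integral_eval[OF p smooth1_reflect(1)[OF Df] y, symmetric])
    have s: "smooth1 B (\<lambda>v. f (x + h - v))" "smooth1 B (\<lambda>v. f (x - v))"
      by (rule smooth1_reflect[OF f1])+
    have s3: "smooth1 (B * norm h) (\<lambda>v. GD f (x - v) h)"
      by (rule smooth1_eval[OF smooth1_reflect(1)[OF Df]])
    have s12: "smooth1 (B * norm h) (\<lambda>v. f (x + h - v) - f (x - v))"
      using smooth1_reflect(1)[OF smooth1_increment[OF f2, of h], of x] by (simp add: algebra_simps)
    have "kernel_field p f y y' (x + h) - kernel_field p f y y' x - kernel_field (lift_bilinear p) (GD f) y y' x h
      = line_integral p (\<lambda>v. f (x + h - v) - f (x - v) - GD f (x - v) h) y y'"
      unfolding 1 unfolding kernel_field_def line_integral_diff[OF p s12 s3 y] line_integral_diff[OF p s y] by simp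
    also have "(\<lambda>v. f (x + h - v) - f (x - v) - GD f (x - v) h)
      = (\<lambda>v. f ((x - v) + h) - f (x - v) - GD f (x - v) h)" by (simp add: algebra_simps)
    also have "norm (line_integral p \<dots> y y') \<le> B * (norm h)\<^sup>2 * K\<^sub>b M"
      by (rule line_integral_bound[OF p smooth1_reflect(1)[OF smooth1_linearization_error[OF f]] y \<open>y 0 = y 1\<close>])
    finally show ?thesis by (simp add: mult_ac)
  qed
  have "((\<lambda>h. norm (kernel_field p f y y' (x + h) - kernel_field p f y y' x - kernel_field (lift_bilinear p) (GD f) y y' x h) / norm h)
    \<longlongrightarrow> 0) (at 0)"
  proof (rule Lim_null_comparison)
    show "((\<lambda>h. ?C * norm h) \<longlongrightarrow> 0) (at (0::'w))"
      by (rule tendsto_eq_intros refl | simp)+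
    show "\<forall>\<^sub>F h in at 0. norm (norm (kernel_field p f y y' (x + h) - kernel_field p f y y' x
        - kernel_field (lift_bilinear p) (GD f) y y' x h) / norm h) \<le> ?C * norm h"
      using bound by (intro always_eventually allI) (auto simp: divide_simps power2_eq_square mult_ac)
  qed
  then show ?thesis by (simp add: has_derivative_at blinfun.bounded_linear_right)
qed

lemma GD_kernel_field:
  assumes "contractive_bilinear p" "smooth3 B f" "ctrl_semi M y y'" "y 0 = y 1"
  shows "GD (kernel_field p f y y') = kernel_field (lift_bilinear p) (GD f) y y'"
  using GD_eqI[OF kernel_field_has_derivative[OF assms]] by blast

lemma smooth1_kernel_field:
  assumes p: "contractive_bilinear p" and f: "smooth3 B f" and y: "ctrl_semi M y y'" "y 0 = y 1"
  shows "smooth1 (B * K\<^sub>b M) (kernel_field p f y y')"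
proof (rule smooth1I[OF kernel_field_has_derivative[OF p f y]])
  note p' = contractive_lift_bilinear[OF p]
  show "norm (kernel_field (lift_bilinear p) (GD f) y y' x) \<le> B * K\<^sub>b M" for x
    by (rule kernel_field_bound[OF p' smooth2D(2)[OF smooth3D(1)[OF f]] y])
  show "norm (kernel_field (lift_bilinear p) (GD f) y y' x - kernel_field (lift_bilinear p) (GD f) y y' v)
    \<le> B * K\<^sub>b M * norm (x - v)" for x v
    by (rule kernel_field_lipschitz[OF p' smooth3D(1)[OF f] y])
qed

lemma smooth2_kernel_field:
  assumes p: "contractive_bilinear p" and f: "smooth4 B f" and y: "ctrl_semi M y y'" "y 0 = y 1"
  shows "smooth2 (B * K\<^sub>b M) (kernel_field p f y y')"
  using smooth1_kernel_field[OF p smooth4D(2)[OF f] y]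
    smooth1_kernel_field[OF contractive_lift_bilinear[OF p] smooth4D(1)[OF f] y]
  unfolding smooth2_def GD_kernel_field[OF p smooth4D(2)[OF f] y]
  by (simp add: smooth1_def GD_kernel_field[OF p smooth4D(2)[OF f] y])

text \<open>Two derivatives of the kernel are spent on differentiating the field twice and two more on the
Lipschitz dependence on the path of the second derivative; hence the hypothesis on \<open>f\<close>.\<close>

lemma smooth1_kernel_field_diff:
  assumes p: "contractive_bilinear p" and f: "smooth4 B f"
    and x: "ctrl_semi M x x'" "x 0 = x 1" and y: "ctrl_semi M y y'" "y 0 = y 1"
    and d: "ctrl d (\<lambda>\<xi>. x \<xi> - y \<xi>) (\<lambda>\<xi>. x' \<xi> - y' \<xi>)"
  shows "smooth1 (B * K\<^sub>l M * d) (\<lambda>v. kernel_field p f x x' v - kernel_field p f y y' v)"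
proof -
  note p1 = contractive_lift_bilinear[OF p]
  note p2 = contractive_lift_bilinear[OF p1]
  note f3 = smooth4D(2)[OF f] and Df = smooth4D(1)[OF f]
  let ?p1 = "lift_bilinear p" and ?p2 = "lift_bilinear (lift_bilinear p)"
  show ?thesis
  proof (rule smooth1I[OF has_derivative_blinfun_diff[OF kernel_field_has_derivative[OF p f3 x] kernel_field_has_derivative[OF p f3 y]]])
    show "norm (kernel_field ?p1 (GD f) x x' v - kernel_field ?p1 (GD f) y y' v) \<le> B * K\<^sub>l M * d" for v
      by (rule kernel_field_lipschitz_path[OF p1 smooth3D(2)[OF Df] x(1) y(1) d x(2) y(2)])
    show "norm ((kernel_field ?p1 (GD f) x x' v - kernel_field ?p1 (GD f) y y' v)
        - (kernel_field ?p1 (GD f) x x' w - kernel_field ?p1 (GD f) y y' w)) \<le> B * K\<^sub>l M * d * norm (v - w)" for v w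
    proof (rule lipschitz_of_derivative_bound[OF has_derivative_blinfun_diff[OF
            kernel_field_has_derivative[OF p1 Df x] kernel_field_has_derivative[OF p1 Df y]]])
      show "norm (kernel_field ?p2 (GD (GD f)) x x' v - kernel_field ?p2 (GD (GD f)) y y' v) \<le> B * K\<^sub>l M * d" for v
        by (rule kernel_field_lipschitz_path[OF p2 smooth3D(1)[OF Df] x(1) y(1) d x(2) y(2)])
    qed
  qed
qed

definition transport_growth :: "real \<Rightarrow> real \<Rightarrow> real" where
  "transport_growth B M = B * K\<^sub>b M * (1 + growth M)"

definition transport_lip_const :: "real \<Rightarrow> real \<Rightarrow> real" where
  "transport_lip_const B M = 6 * \<kappa>\<^sup>2 * (B * K\<^sub>b M * (1 + growth M)) + B * K\<^sub>l M * (1 + growth M)"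

text \<open>The growth bound of the vector field \<open>Y \<mapsto> (V\<^sup>Y(Y), \<nabla>V\<^sup>Y(Y) Y')\<close>. It uses the kernel only up to the
Lipschitz constant of its third derivative.\<close>

lemma ctrl_transport:
  assumes p: "contractive_bilinear p" and f: "smooth3 B f" and y: "ctrl_semi M y y'" "y 0 = y 1"
  shows "ctrl (transport_growth B M) (\<lambda>\<xi>. kernel_field p f y y' (y \<xi>)) (\<lambda>\<xi>. GD (kernel_field p f y y') (y \<xi>) o\<^sub>L y' \<xi>)"
proof -
  note V = smooth1_kernel_field[OF p f y]
  have g: "growth M \<ge> 0" by (rule growth_nonneg[OF ctrl_semi_nonneg[OF y(1)]])
  have le: "B * K\<^sub>b M \<le> transport_growth B M" "B * K\<^sub>b M * growth M \<le> transport_growth B M"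
    unfolding transport_growth_def using smooth1_nonneg[OF V] g mult_left_mono[of 1 "1 + growth M" "B * K\<^sub>b M"]
    by (auto intro: mult_left_mono)
  show ?thesis
    unfolding ctrl_def
    using ctrl_semi_mono[OF ctrl_semi_compose[OF V y(1)] le(2)]
      order_trans[OF kernel_field_bound[OF p smooth2D(2)[OF smooth3D(2)[OF f]] y] le(1)] by simp
qed

text \<open>The difference splits into the motion of two paths in one velocity field, for which that field has
to be twice differentiable, and the motion of one path in the difference of two fields.\<close>

lemma ctrl_transport_diff:
  assumes p: "contractive_bilinear p" and f: "smooth4 B f"
    and x: "ctrl_semi M x x'" "x 0 = x 1" and y: "ctrl_semi M y y'" "y 0 = y 1"
    and d: "ctrl d (\<lambda>\<xi>. x \<xi> - y \<xi>) (\<lambda>\<xi>. x' \<xi> - y' \<xi>)"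
  shows "ctrl (transport_lip_const B M * d) (\<lambda>\<xi>. kernel_field p f x x' (x \<xi>) - kernel_field p f y y' (y \<xi>))
    (\<lambda>\<xi>. (GD (kernel_field p f x x') (x \<xi>) o\<^sub>L x' \<xi>) - (GD (kernel_field p f y y') (y \<xi>) o\<^sub>L y' \<xi>))"
proof -
  let ?V = "kernel_field p f x x'" and ?U = "kernel_field p f y y'"
  let ?W = "\<lambda>v. ?V v - ?U v"
  note f3 = smooth4D(2)[OF f]
  have g: "growth M \<ge> 0" by (rule growth_nonneg[OF ctrl_semi_nonneg[OF y(1)]])
  have 1: "ctrl (6 * \<kappa>\<^sup>2 * (B * K\<^sub>b M * (1 + growth M)) * d) (\<lambda>\<xi>. ?V (x \<xi>) - ?V (y \<xi>))
      (\<lambda>\<xi>. (GD ?V (x \<xi>) o\<^sub>L x' \<xi>) - (GD ?V (y \<xi>) o\<^sub>L y' \<xi>))"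
    by (rule ctrl_compose_diff[OF smooth2_kernel_field[OF p f x] y(1) x(1) d])
  note W = smooth1_kernel_field_diff[OF p f x y d]
  have GW: "GD ?W v = GD ?V v - GD ?U v" for v
    by (intro GD_eqI has_derivative_blinfun_diff smooth1D(1)[OF smooth1_kernel_field[OF p f3 x]]
        smooth1D(1)[OF smooth1_kernel_field[OF p f3 y]])
  have 2: "ctrl (B * K\<^sub>l M * d * (1 + growth M)) (\<lambda>\<xi>. ?W (y \<xi>)) (\<lambda>\<xi>. GD ?W (y \<xi>) o\<^sub>L y' \<xi>)"
    unfolding ctrl_def
  proof (intro conjI ballI)
    note nn = smooth1_nonneg[OF W]
    show "norm (?W (y \<xi>)) \<le> B * K\<^sub>l M * d * (1 + growth M)" for \<xi>
      using kernel_field_lipschitz_path[OF p smooth3D(2)[OF f3] x(1) y(1) d x(2) y(2), of "y \<xi>"]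
        mult_left_mono[of 1 "1 + growth M", OF _ nn] g by simp
    show "ctrl_semi (B * K\<^sub>l M * d * (1 + growth M)) (\<lambda>\<xi>. ?W (y \<xi>)) (\<lambda>\<xi>. GD ?W (y \<xi>) o\<^sub>L y' \<xi>)"
      by (rule ctrl_semi_mono[OF ctrl_semi_compose[OF W y(1)]]) (use nn in \<open>auto intro: mult_left_mono\<close>)
  qed
  have eq: "(GD ?V (x \<xi>) o\<^sub>L x' \<xi>) - (GD ?V (y \<xi>) o\<^sub>L y' \<xi>) + (GD ?W (y \<xi>) o\<^sub>L y' \<xi>)
    = (GD ?V (x \<xi>) o\<^sub>L x' \<xi>) - (GD ?U (y \<xi>) o\<^sub>L y' \<xi>)" for \<xi>
    by (rule blinfun_eqI) (simp add: GW blinfun.diff_left blinfun.add_left)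
  have c: "6 * \<kappa>\<^sup>2 * (B * K\<^sub>b M * (1 + growth M)) * d + B * K\<^sub>l M * d * (1 + growth M) = transport_lip_const B M * d"
    by (simp add: transport_lip_const_def algebra_simps)
  show ?thesis using ctrl_add[OF 1 2] unfolding eq c by simp
qed

end

section \<open>Translation of norms and of the rough integral\<close>

lemma norm_le_tensor_norm: "norm v \<le> tensor_norm v"
  unfolding tensor_norm_def by (rule norm_le_l1)

lemma tensor_norm_le: "tensor_norm (v :: 'v::euclidean_space) \<le> DIM('v) * norm v"
  unfolding tensor_norm_def using sum_bounded_above[of Basis "\<lambda>b. \<bar>v \<bullet> b\<bar>" "norm v"] Basis_le_norm by force

lemma sup_norm01_le_iff: "c \<ge> 0 \<Longrightarrow> sup_norm01 f \<le> ennreal c \<longleftrightarrow> (\<forall>\<xi>\<in>{0..1}. tensor_norm (f \<xi>) \<le> c)"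
  by (auto simp: sup_norm01_def SUP_le_iff ennreal_le_iff)

lemma two_param_norm_le_iff:
  assumes "c \<ge> 0"
  shows "two_param_norm \<alpha> R \<le> ennreal c \<longleftrightarrow>
    (\<forall>\<xi>\<in>{0..1}. \<forall>\<eta>\<in>{0..1}. \<xi> \<noteq> \<eta> \<longrightarrow> tensor_norm (R \<xi> \<eta>) \<le> c * \<bar>\<xi> - \<eta>\<bar> powr \<alpha>)"
proof -
  have "ennreal (tensor_norm (R \<xi> \<eta>) / \<bar>\<xi> - \<eta>\<bar> powr \<alpha>) \<le> ennreal c \<longleftrightarrow> tensor_norm (R \<xi> \<eta>) \<le> c * \<bar>\<xi> - \<eta>\<bar> powr \<alpha>"
    if "\<xi> \<noteq> \<eta>" for \<xi> \<eta> :: real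
    using that assms by (simp add: ennreal_le_iff divide_le_eq)
  then show ?thesis by (fastforce simp: two_param_norm_def SUP_le_iff)
qed

lemma finite_ennreal_bound: "a < (\<infinity>::ennreal) \<Longrightarrow> a \<le> ennreal (enn2real a)"
  by (simp add: less_top)

lemma powr_double: "x powr (2 * \<gamma>) = (x powr \<gamma>)\<^sup>2" for x :: real
  using powr_add[of x \<gamma> \<gamma>] by (simp add: power2_eq_square)

lemma rough_path_imp_rough:
  assumes "\<gamma> > 1/3" and R: "rough_path \<gamma> X XX"
  shows "\<exists>\<kappa>. rough \<gamma> \<kappa> X XX"
proof -
  define a where "a = enn2real (sup_norm01 X)"
  define b where "b = enn2real (hoelder_norm \<gamma> X)"
  define c where "c = enn2real (two_param_norm (2 * \<gamma>) XX)"
  have nn: "a \<ge> 0" "b \<ge> 0" "c \<ge> 0" by (auto simp: a_def b_def c_def)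
  have fin: "sup_norm01 X < \<infinity>" "hoelder_norm \<gamma> X < \<infinity>" "two_param_norm (2 * \<gamma>) XX < \<infinity>"
    using R by (auto simp: rough_path_def hoelder_closed_curve_def)
  have a: "tensor_norm (X \<xi>) \<le> a" if "\<xi> \<in> {0..1}" for \<xi>
    using finite_ennreal_bound[OF fin(1), folded a_def] that nn sup_norm01_le_iff[of a X] by auto
  have b: "tensor_norm (X \<xi> - X \<eta>) \<le> b * \<bar>\<xi> - \<eta>\<bar> powr \<gamma>"
    if "\<xi> \<in> {0..1}" "\<eta> \<in> {0..1}" "\<xi> \<noteq> \<eta>" for \<xi> \<eta>
    using finite_ennreal_bound[OF fin(2), folded b_def] that
    unfolding hoelder_norm_def two_param_norm_le_iff[OF nn(2)] by blast
  have c: "tensor_norm (XX \<xi> \<eta>) \<le> c * \<bar>\<xi> - \<eta>\<bar> powr (2 * \<gamma>)"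
    if "\<xi> \<in> {0..1}" "\<eta> \<in> {0..1}" "\<xi> \<noteq> \<eta>" for \<xi> \<eta>
    using finite_ennreal_bound[OF fin(3), folded c_def] that
    unfolding two_param_norm_le_iff[OF nn(3)] by blast
  have chen: "XX \<xi> \<rho> $ i $ j - XX \<xi> \<eta> $ i $ j - XX \<eta> \<rho> $ i $ j = (X \<xi> $ i - X \<eta> $ i) * (X \<eta> $ j - X \<rho> $ j)"
    if "\<xi> \<in> {0..1}" "\<eta> \<in> {0..1}" "\<rho> \<in> {0..1}" for \<xi> \<eta> \<rho> i j
    using R that by (auto simp: rough_path_def)
  define \<kappa> where "\<kappa> = 1 + a + b + c"
  have "rough \<gamma> \<kappa> X XX"
  proof
    show "\<gamma> > 1/3" by fact
    show "\<kappa> \<ge> 1" using nn by (simp add: \<kappa>_def)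
    show "norm (X \<xi>) \<le> \<kappa>" if "\<xi> \<in> {0..1}" for \<xi>
      using a[OF that] norm_le_tensor_norm[of "X \<xi>"] nn by (simp add: \<kappa>_def)
    show "norm (X \<xi> - X \<eta>) \<le> \<kappa> * \<bar>\<xi> - \<eta>\<bar> powr \<gamma>" if "\<xi> \<in> {0..1}" "\<eta> \<in> {0..1}" for \<xi> \<eta>
    proof (cases "\<xi> = \<eta>")
      case False
      have "norm (X \<xi> - X \<eta>) \<le> b * \<bar>\<xi> - \<eta>\<bar> powr \<gamma>"
        using b[OF that False] norm_le_tensor_norm[of "X \<xi> - X \<eta>"] by simp
      also have "\<dots> \<le> \<kappa> * \<bar>\<xi> - \<eta>\<bar> powr \<gamma>" using nn by (intro mult_right_mono) (auto simp: \<kappa>_def)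
      finally show ?thesis .
    qed simp
    show "\<bar>XX \<xi> \<eta> $ i $ j\<bar> \<le> \<kappa> * (\<bar>\<xi> - \<eta>\<bar> powr \<gamma>)\<^sup>2" if "\<xi> \<in> {0..1}" "\<eta> \<in> {0..1}" for \<xi> \<eta> i j
    proof (cases "\<xi> = \<eta>")
      case True
      then show ?thesis using chen[OF that(1,1,1), of i j] by simp
    next
      case False
      have "\<bar>XX \<xi> \<eta> $ i $ j\<bar> \<le> norm (XX \<xi> \<eta>)"
        using component_le_norm_cart[of "XX \<xi> \<eta> $ i" j] Finite_Cartesian_Product.norm_nth_le[of "XX \<xi> \<eta>" i] by simp
      also have "\<dots> \<le> c * \<bar>\<xi> - \<eta>\<bar> powr (2 * \<gamma>)"
        using c[OF that False] norm_le_tensor_norm[of "XX \<xi> \<eta>"] by simp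
      also have "\<dots> \<le> \<kappa> * \<bar>\<xi> - \<eta>\<bar> powr (2 * \<gamma>)" using nn by (intro mult_right_mono) (auto simp: \<kappa>_def)
      finally show ?thesis by (simp only: powr_double)
    qed
    show "X 0 = X 1"
      using R by (simp add: rough_path_def hoelder_closed_curve_def closed_curve_def pathfinish_def pathstart_def)
  qed (rule chen)
  then show ?thesis by blast
qed

definition matrix_blinfun :: "real^3^3 \<Rightarrow> (real^3) \<Rightarrow>\<^sub>L (real^3)" where
  "matrix_blinfun M = Blinfun ((*v) M)"

lemma matrix_blinfun_apply [simp]: "blinfun_apply (matrix_blinfun M) v = M *v v"
  unfolding matrix_blinfun_def by (simp add: bounded_linear_Blinfun_apply matrix_vector_mul_bounded_linear)

lemma norm_matrix_vector_mult_le: "norm (M *v v) \<le> norm M * norm v" for M :: "real^'n^'m"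
proof -
  have "norm (M *v v) = L2_set (\<lambda>i. norm (row i M \<bullet> v)) UNIV"
    by (simp add: norm_vec_def matrix_vector_mult_def row_def inner_vec_def)
  also have "\<dots> \<le> L2_set (\<lambda>i. norm (M $ i) * norm v) UNIV"
    by (intro L2_set_mono) (auto simp: row_def vec_nth_inverse Cauchy_Schwarz_ineq2)
  also have "\<dots> = norm M * norm v" by (simp add: norm_vec_def L2_set_left_distrib)
  finally show ?thesis .
qed

lemma contractive_matrix_vector_mult:
  "contractive_bilinear ((*v) :: real^3^3 \<Rightarrow> real^3 \<Rightarrow> real^3)"
proof -
  have "bounded_bilinear ((*v) :: real^3^3 \<Rightarrow> real^3 \<Rightarrow> real^3)"
  proof
    show "\<exists>K. \<forall>(a :: real^3^3) (b :: real^3). norm (a *v b) \<le> norm a * norm b * K"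
      using norm_matrix_vector_mult_le by (intro exI[of _ 1]) auto
  qed (auto simp: matrix_vector_mult_add_rdistrib matrix_vector_right_distrib
      scaleR_matrix_vector_assoc matrix_vector_mult_scaleR)
  then show ?thesis by (simp add: contractive_bilinear_def norm_matrix_vector_mult_le)
qed

lemma matrix_blinfun_diff: "matrix_blinfun (M - N) = matrix_blinfun M - matrix_blinfun N"
  by (rule blinfun_eqI) (simp add: blinfun.diff_left matrix_vector_mult_diff_rdistrib)

lemma norm_matrix_blinfun: "norm (matrix_blinfun M) \<le> norm M"
  by (rule norm_blinfun_bound) (auto simp: norm_matrix_vector_mult_le)

lemma bounded_linear_matrix_blinfun: "bounded_linear matrix_blinfun"
proof
  show "\<exists>K. \<forall>M. norm (matrix_blinfun M) \<le> norm M * K"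
    using norm_matrix_blinfun by (intro exI[of _ 1]) auto
qed (rule blinfun_eqI; simp add: blinfun.add_left blinfun.scaleR_left
    matrix_vector_mult_add_rdistrib scaleR_matrix_vector_assoc)+

lemma norm_le_matrix_blinfun: "norm M \<le> 9 * norm (matrix_blinfun M)"
proof -
  have e: "\<bar>M $ i $ j\<bar> \<le> norm (matrix_blinfun M)" for i j
  proof -
    have "M $ i $ j = matrix_blinfun M (axis j 1) $ i" by (simp add: matrix_vector_mul_component inner_axis)
    also have "\<bar>\<dots>\<bar> \<le> norm (matrix_blinfun M) * norm (axis j (1::real))"
      using component_le_norm_cart norm_blinfun order_trans by blast
    finally show ?thesis by simp
  qed
  have "norm M \<le> (\<Sum>i\<in>UNIV. norm (M $ i))" unfolding norm_vec_def by (rule L2_set_le_sum) simp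
  also have "\<dots> \<le> (\<Sum>i\<in>(UNIV::3 set). \<Sum>j\<in>(UNIV::3 set). norm (matrix_blinfun M))"
    by (intro sum_mono order_trans[OF norm_le_l1_cart] e)
  finally show ?thesis by simp
qed

lemma matrix_blinfun_mat_1: "matrix_blinfun (mat 1) = id_blinfun"
  by (rule blinfun_eqI) simp

lemma matrix_blinfun_mult: "matrix_blinfun (M ** N) = matrix_blinfun M o\<^sub>L matrix_blinfun N"
  by (rule blinfun_eqI) (simp add: matrix_vector_mul_assoc)

lemma matrix_blinfun_jacobian:
  assumes "f differentiable (at x)"
  shows "matrix_blinfun (jacobian f (at x)) = GD f x"
proof (rule blinfun_eqI)
  fix v
  have "bounded_linear (frechet_derivative f (at x))"
    using assms frechet_derivative_works has_derivative_bounded_linear by blast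
  then show "matrix_blinfun (jacobian f (at x)) v = GD f x v"
    by (simp add: GD_def jacobian_def bounded_linear_Blinfun_apply bounded_linear.linear matrix_works)
qed

lemma GD_axis:
  assumes "f differentiable (at x)"
  shows "GD f x (axis b 1) = partial b f x"
  using has_derivative_unique[OF GD_works[OF assms]] frechet_derivative_works[THEN iffD1, OF assms]
  by (simp add: partial_def)

lemma GD_expansion:
  fixes f :: "real^3 \<Rightarrow> 'v::euclidean_space"
  assumes "f differentiable (at x)"
  shows "GD f x v = (\<Sum>b\<in>UNIV. v $ b *\<^sub>R partial b f x)"
proof -
  have "GD f x v = GD f x (\<Sum>b\<in>UNIV. v $ b *\<^sub>R axis b 1)" by (simp only: axis_expansion)
  also have "\<dots> = (\<Sum>b\<in>UNIV. v $ b *\<^sub>R partial b f x)"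
    by (simp add: blinfun.sum_right blinfun.scaleR_right GD_axis[OF assms])
  finally show ?thesis .
qed

context rough begin

abbreviation "deriv_blinfun Y \<equiv> (\<lambda>\<xi>. matrix_blinfun (snd Y \<xi>))"

definition ctrl_pair :: "real \<Rightarrow> controlled \<Rightarrow> bool" where
  "ctrl_pair N Y \<longleftrightarrow> ctrl N (fst Y) (deriv_blinfun Y)"

lemma D_norm_star_imp_ctrl_pair:
  assumes le: "D_norm_star \<gamma> X Y \<le> ennreal r" and r: "r \<ge> 0"
  shows "ctrl_pair r Y"
proof -
  let ?s = "sup_norm01 (fst Y)" and ?s' = "sup_norm01 (snd Y)"
    and ?h = "hoelder_norm \<gamma> (snd Y)" and ?R = "two_param_norm (2 * \<gamma>) (remainder X Y)"
  have sum: "?h + ?R + ?s' + ?s \<le> ennreal r" using le by (simp add: D_norm_star_def D_norm_def)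
  have parts: "?h \<le> ?h + ?R + ?s' + ?s" "?R \<le> ?h + ?R + ?s' + ?s"
    "?s' \<le> ?h + ?R + ?s' + ?s" "?s \<le> ?h + ?R + ?s' + ?s"
    by (simp_all add: add_increasing add_increasing2)
  note l = parts[THEN order_trans[OF _ sum]]
  show ?thesis
    unfolding ctrl_pair_def ctrl_def ctrl_semi_def
  proof (intro conjI ballI)
    fix \<xi> :: real assume \<xi>: "\<xi> \<in> {0..1}"
    show "norm (fst Y \<xi>) \<le> r"
      using l(4) \<xi> r norm_le_tensor_norm[of "fst Y \<xi>"] by (force simp: sup_norm01_le_iff)
    show "norm (matrix_blinfun (snd Y \<xi>)) \<le> r"
      using l(3) \<xi> r norm_le_tensor_norm[of "snd Y \<xi>"] norm_matrix_blinfun[of "snd Y \<xi>"]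
      by (force simp: sup_norm01_le_iff)
    fix \<eta> :: real assume \<eta>: "\<eta> \<in> {0..1}"
    show "norm (matrix_blinfun (snd Y \<xi>) - matrix_blinfun (snd Y \<eta>)) \<le> r * \<omega> \<xi> \<eta>"
    proof (cases "\<xi> = \<eta>")
      case False
      have "norm (matrix_blinfun (snd Y \<xi> - snd Y \<eta>)) \<le> tensor_norm (snd Y \<xi> - snd Y \<eta>)"
        using norm_matrix_blinfun norm_le_tensor_norm order_trans by blast
      also have "\<dots> \<le> r * \<omega> \<xi> \<eta>"
        using l(1) \<xi> \<eta> False r by (auto simp: hoelder_norm_def two_param_norm_le_iff \<omega>_def)
      finally show ?thesis by (simp add: matrix_blinfun_diff)
    qed simp
    show "norm (fst Y \<xi> - fst Y \<eta> - matrix_blinfun (snd Y \<eta>) (X \<xi> - X \<eta>)) \<le> r * (\<omega> \<xi> \<eta>)\<^sup>2"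
    proof (cases "\<xi> = \<eta>")
      case False
      have "norm (fst Y \<xi> - fst Y \<eta> - matrix_blinfun (snd Y \<eta>) (X \<xi> - X \<eta>)) \<le> tensor_norm (remainder X Y \<eta> \<xi>)"
        using norm_le_tensor_norm[of "remainder X Y \<eta> \<xi>"] by (simp add: remainder_def)
      also have "\<dots> \<le> r * \<bar>\<eta> - \<xi>\<bar> powr (2 * \<gamma>)"
        using l(2) \<xi> \<eta> False r by (auto simp: two_param_norm_le_iff)
      finally show ?thesis by (simp add: \<omega>_def powr_double abs_minus_commute)
    qed (simp add: blinfun.zero_right)
  qed
qed

lemma ctrl_pair_imp_D_norm_star:
  assumes Y: "ctrl_pair N Y"
  shows "sup_norm01 (fst Y) \<le> ennreal (3 * N)" "sup_norm01 (snd Y) \<le> ennreal (81 * N)"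
    "hoelder_norm \<gamma> (snd Y) \<le> ennreal (81 * N)"
    "two_param_norm (2 * \<gamma>) (remainder X Y) \<le> ennreal (3 * N)"
    "D_norm_star \<gamma> X Y \<le> ennreal (168 * N)"
proof -
  have c: "ctrl N (fst Y) (deriv_blinfun Y)" using Y by (simp add: ctrl_pair_def)
  note cs = ctrlD(1)[OF c] and N = ctrl_nonneg[OF c]
  have N81: "81 * N \<ge> 0" and N3: "3 * N \<ge> 0" using N by auto
  have t3: "tensor_norm v \<le> 3 * norm v" for v :: "real^3" using tensor_norm_le[of v] by simp
  have t9: "tensor_norm M \<le> 81 * norm (matrix_blinfun M)" for M
    using tensor_norm_le[of M] norm_le_matrix_blinfun[of M] by simp
  show 1: "sup_norm01 (fst Y) \<le> ennreal (3 * N)"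
    using N order_trans[OF t3 mult_left_mono[OF ctrlD(2)[OF c]]] by (simp add: sup_norm01_le_iff)
  show 2: "sup_norm01 (snd Y) \<le> ennreal (81 * N)"
    using N order_trans[OF t9 mult_left_mono[OF ctrl_semiD(1)[OF cs]]] by (simp add: sup_norm01_le_iff)
  show 3: "hoelder_norm \<gamma> (snd Y) \<le> ennreal (81 * N)"
    unfolding hoelder_norm_def two_param_norm_le_iff[OF N81]
  proof (intro ballI impI)
    fix \<xi> \<eta> :: real assume *: "\<xi> \<in> {0..1}" "\<eta> \<in> {0..1}"
    show "tensor_norm (snd Y \<xi> - snd Y \<eta>) \<le> 81 * N * \<bar>\<xi> - \<eta>\<bar> powr \<gamma>"
      using t9[of "snd Y \<xi> - snd Y \<eta>"] ctrl_semiD(2)[OF cs *] by (simp add: \<omega>_def matrix_blinfun_diff)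
  qed
  show 4: "two_param_norm (2 * \<gamma>) (remainder X Y) \<le> ennreal (3 * N)"
    unfolding two_param_norm_le_iff[OF N3]
  proof (intro ballI impI)
    fix \<eta> \<xi> :: real assume *: "\<eta> \<in> {0..1}" "\<xi> \<in> {0..1}"
    show "tensor_norm (remainder X Y \<eta> \<xi>) \<le> 3 * N * \<bar>\<eta> - \<xi>\<bar> powr (2 * \<gamma>)"
      using t3[of "remainder X Y \<eta> \<xi>"] ctrl_semiD(3)[OF cs *(2,1)]
      by (simp add: remainder_def \<omega>_def powr_double abs_minus_commute)
  qed
  have "D_norm_star \<gamma> X Y \<le> ennreal (81 * N) + ennreal (3 * N) + ennreal (81 * N) + ennreal (3 * N)"
    unfolding D_norm_star_def D_norm_def by (intro add_mono 1 2 3 4)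
  also have "\<dots> = ennreal (168 * N)" using N by (simp add: ennreal_plus[symmetric] del: ennreal_plus)
  finally show "D_norm_star \<gamma> X Y \<le> ennreal (168 * N)" .
qed

lemma controlled_space_imp_ctrl_pair:
  assumes "Y \<in> controlled_space \<gamma> X"
  shows "\<exists>N. ctrl_pair N Y" "fst Y 0 = fst Y 1"
proof -
  have Y: "closed_curve (fst Y)" "sup_norm01 (snd Y) < \<infinity>" "hoelder_norm \<gamma> (snd Y) < \<infinity>"
    "two_param_norm (2 * \<gamma>) (remainder X Y) < \<infinity>"
    using assms by (auto simp: controlled_space_def)
  have "compact (fst Y ` {0..1})"
    using Y(1) by (intro compact_continuous_image) (auto simp: closed_curve_def path_def)
  then obtain C where C: "\<forall>v\<in>fst Y ` {0..1}. norm v \<le> C" using bounded_iff compact_imp_bounded by blast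
  have "tensor_norm (fst Y \<xi>) \<le> 3 * \<bar>C\<bar>" if "\<xi> \<in> {0..1}" for \<xi>
    using C that tensor_norm_le[of "fst Y \<xi>"] by force
  then have "sup_norm01 (fst Y) \<le> ennreal (3 * \<bar>C\<bar>)" by (simp add: sup_norm01_le_iff)
  then have "sup_norm01 (fst Y) < \<infinity>" by (simp add: order.strict_trans1)
  then have "D_norm_star \<gamma> X Y < \<infinity>" using Y by (simp add: D_norm_star_def D_norm_def)
  from finite_ennreal_bound[OF this] show "\<exists>N. ctrl_pair N Y"
    using D_norm_star_imp_ctrl_pair enn2real_nonneg by blast
  show "fst Y 0 = fst Y 1" using Y(1) by (simp add: closed_curve_def pathfinish_def pathstart_def)
qed

lemma ctrl_pair_imp_controlled_space:
  assumes Y: "ctrl_pair N Y" and "fst Y 0 = fst Y 1"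
    and "fst Y \<in> extensional {0..1}" "snd Y \<in> extensional {0..1}"
  shows "Y \<in> controlled_space \<gamma> X"
proof -
  have "continuous_on {0..1} (fst Y)"
    using Y ctrlD(1) ctrl_path_continuous unfolding ctrl_pair_def by blast
  moreover have "sup_norm01 (snd Y) < \<infinity>" "hoelder_norm \<gamma> (snd Y) < \<infinity>"
    "two_param_norm (2 * \<gamma>) (remainder X Y) < \<infinity>"
    using ctrl_pair_imp_D_norm_star[OF Y] by (auto intro: order.strict_trans1)
  ultimately show ?thesis
    using assms by (auto simp: controlled_space_def closed_curve_def path_def pathfinish_def pathstart_def)
qed

lemma rough_sum_eq:
  assumes A: "smooth1 B A"
  shows "rough_sum A XX Y x i n q = (\<Sum>k<n. germ (*v) (\<lambda>\<xi>. A (x - fst Y \<xi>))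
    (\<lambda>\<xi>. GD (\<lambda>v. A (x - v)) (fst Y \<xi>) o\<^sub>L matrix_blinfun (snd Y \<xi>)) (fst Y) (deriv_blinfun Y) (q k) (q (Suc k))) $ i"
proof -
  have Z: "((GD (\<lambda>v. A (x - v)) (fst Y \<xi>) o\<^sub>L matrix_blinfun (snd Y \<xi>)) (axis a 1)) $ i $ j = Z_deriv A Y x i j a \<xi>"
    for \<xi> a j
  proof -
    have col: "(snd Y \<xi> *v axis a 1) $ b = snd Y \<xi> $ b $ a" for b
      by (simp add: matrix_vector_mul_component inner_axis)
    show ?thesis
      unfolding smooth1_reflect(2)[OF A] Z_deriv_def
      by (simp add: blinfun.minus_left GD_expansion[OF smooth1D(4)[OF A]] col mult.commute)
  qed
  show ?thesis
    unfolding rough_sum_def sum_component germ_def vector_add_component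
  proof (rule sum.cong[OF refl], rule arg_cong2[where f = "(+)"])
    fix k
    show "(\<Sum>j\<in>UNIV. A (x - fst Y (q k)) $ i $ j * (fst Y (q (Suc k)) $ j - fst Y (q k) $ j))
      = (A (x - fst Y (q k)) *v (fst Y (q (Suc k)) - fst Y (q k))) $ i"
      by (simp add: matrix_vector_mult_def)
    let ?B = "\<lambda>a c. ((GD (\<lambda>v. A (x - v)) (fst Y (q k)) o\<^sub>L matrix_blinfun (snd Y (q k))) (axis a 1)
        *v (matrix_blinfun (snd Y (q k)) (axis c 1)))"
    have B: "?B a c $ i = (\<Sum>j\<in>UNIV. Z_deriv A Y x i j a (q k) * snd Y (q k) $ j $ c)" for a c
      unfolding Z[symmetric] by (simp add: matrix_vector_mult_def axis_def if_distrib cong: if_cong)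
    have "(\<Sum>j\<in>UNIV. \<Sum>a\<in>UNIV. \<Sum>c\<in>UNIV. Z_deriv A Y x i j a (q k) * snd Y (q k) $ j $ c * XX (q k) (q (Suc k)) $ a $ c)
      = (\<Sum>a\<in>UNIV. \<Sum>c\<in>UNIV. \<Sum>j\<in>UNIV. Z_deriv A Y x i j a (q k) * snd Y (q k) $ j $ c * XX (q k) (q (Suc k)) $ a $ c)"
      by (rule trans[OF sum.swap], rule sum.cong[OF refl], rule sum.swap)
    also have "\<dots> = (\<Sum>a\<in>UNIV. \<Sum>c\<in>UNIV. XX (q k) (q (Suc k)) $ a $ c * (?B a c $ i))"
      unfolding B by (simp add: sum_distrib_left mult_ac)
    finally show "(\<Sum>j\<in>UNIV. \<Sum>a\<in>UNIV. \<Sum>c\<in>UNIV. Z_deriv A Y x i j a (q k) * snd Y (q k) $ j $ c * XX (q k) (q (Suc k)) $ a $ c)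
      = (\<Sum>a\<in>UNIV. \<Sum>c\<in>UNIV. (XX (q k) (q (Suc k)) $ a $ c *\<^sub>R ?B a c) $ i)"
      by simp
  qed
qed

text \<open>The compensated sums that define the velocity are the components of sums of germs, so the limit over
all partitions is the dyadic limit.\<close>

lemma velocity_eq_kernel_field:
  assumes A: "smooth1 B A" and Y: "ctrl_pair M Y"
  shows "velocity A XX Y = kernel_field (*v) A (fst Y) (deriv_blinfun Y)"
proof
  fix x
  have y: "ctrl_semi M (fst Y) (deriv_blinfun Y)" using Y ctrlD(1) by (simp add: ctrl_pair_def)
  let ?L = "kernel_field (*v) A (fst Y) (deriv_blinfun Y) x"
  note conv = rough_integral_partitions[OF contractive_matrix_vector_mult
      ctrl_semi_compose[OF smooth1_reflect(1)[OF A, of x] y] y]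
  have "mesh_limit (rough_sum A XX Y x i) (?L $ i)" for i
    unfolding mesh_limit_def
  proof (intro allI impI)
    fix e :: real assume "e > 0"
    from conv[OF this] obtain \<delta> where \<delta>: "\<delta> > 0" "\<And>n q. partition01 n q \<Longrightarrow> (\<forall>k<n. q (Suc k) - q k < \<delta>) \<Longrightarrow>
       norm ((\<Sum>k<n. germ (*v) (\<lambda>\<xi>. A (x - fst Y \<xi>))
    (\<lambda>\<xi>. GD (\<lambda>v. A (x - v)) (fst Y \<xi>) o\<^sub>L matrix_blinfun (snd Y \<xi>)) (fst Y) (deriv_blinfun Y) (q k) (q (Suc k))) - ?L) < e"
      unfolding kernel_field_def line_integral_def by blast
    have "\<bar>rough_sum A XX Y x i n q - ?L $ i\<bar> < e"
      if "partition01 n q" "\<forall>k<n. q (Suc k) - q k < \<delta>" for n q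
      unfolding rough_sum_eq[OF A] vector_minus_component[symmetric]
      using \<delta>(2)[OF that] component_le_norm_cart le_less_trans by blast
    then show "\<exists>\<delta>>0. \<forall>n p. partition01 n p \<longrightarrow> (\<forall>k<n. p (Suc k) - p k < \<delta>) \<longrightarrow> \<bar>rough_sum A XX Y x i n p - ?L $ i\<bar> < e"
      using \<delta>(1) by blast
  qed
  then have "(THE L. mesh_limit (rough_sum A XX Y x i) L) = ?L $ i" for i
    using mesh_limit_unique by (intro the_equality) auto
  then show "velocity A XX Y x = ?L" by (simp add: velocity_def vec_eq_iff)
qed

end

section \<open>From bounded partial derivatives to bounded total derivatives\<close>

definition partials_bounded :: "nat \<Rightarrow> real \<Rightarrow> (real^3 \<Rightarrow> 'v::euclidean_space) \<Rightarrow> bool" where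
  "partials_bounded n c f \<longleftrightarrow> times_differentiable n f \<and>
     (\<forall>bs x. 1 \<le> length bs \<and> length bs \<le> n \<longrightarrow> norm (iter_partial bs f x) \<le> c)"

lemma iter_partial_append: "iter_partial (bs @ [b]) f = iter_partial bs (partial b f)"
  by (induction bs) auto

lemma has_derivative_vec:
  fixes g :: "'n::finite \<Rightarrow> 'a::real_normed_vector \<Rightarrow> 'v::euclidean_space"
  assumes "\<And>b. (g b has_derivative G b) (at x)"
  shows "((\<lambda>x. \<chi> b. g b x) has_derivative (\<lambda>h. \<chi> b. G b h)) (at x)"
proof -
  have bl: "bounded_linear (axis b :: 'v \<Rightarrow> 'v^'n)" for b
    unfolding linear_conv_bounded_linear[symmetric]
    by (rule linearI) (auto simp: vec_eq_iff axis_def)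
  have eq: "(\<chi> b. v b) = (\<Sum>b\<in>UNIV. axis b (v b))" for v :: "'n \<Rightarrow> 'v"
    by (simp add: vec_eq_iff axis_def sum_component)
  show ?thesis
    unfolding eq by (intro has_derivative_sum bounded_linear.has_derivative[OF bl] assms)
qed

text \<open>The norm in the hypothesis is that of \<open>\<nabla>A\<close> as a field of its own; its partial derivatives are the
partial derivatives of \<open>A\<close> of one order more, with the additional index innermost.\<close>

lemma iter_partial_grad:
  assumes "times_differentiable n f" "length bs < n"
  shows "iter_partial bs (grad f) = (\<lambda>x. \<chi> b. iter_partial (bs @ [b]) f x)"
  using assms(2)
proof (induction bs)
  case Nil
  then show ?case by (simp add: fun_eq_iff grad_def)
next
  case (Cons c bs)
  have IH: "iter_partial bs (grad f) = (\<lambda>x. \<chi> b. iter_partial (bs @ [b]) f x)"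
    using Cons by simp
  have "partial c (\<lambda>x. \<chi> b. iter_partial (bs @ [b]) f x) x = (\<chi> b. partial c (iter_partial (bs @ [b]) f) x)" for x
  proof -
    have "iter_partial (bs @ [b]) f differentiable (at x)" for b
      using assms(1) Cons.prems by (simp add: times_differentiable_def)
    then have "((\<lambda>x. \<chi> b. iter_partial (bs @ [b]) f x) has_derivative
        (\<lambda>h. \<chi> b. frechet_derivative (iter_partial (bs @ [b]) f) (at x) h)) (at x)"
      by (intro has_derivative_vec) (simp add: frechet_derivative_works)
    from frechet_derivative_at[OF this, symmetric] show ?thesis by (simp add: partial_def)
  qed
  then show ?case by (simp add: IH fun_eq_iff)
qed

lemma field_norm_imp_partials_bounded:
  assumes d: "times_differentiable (Suc n) f" and fin: "field_norm n (grad f) < \<infinity>"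
  shows "partials_bounded (Suc n) (enn2real (field_norm n (grad f))) f"
  unfolding partials_bounded_def
proof (intro conjI allI impI d)
  fix bs :: "3 list" and x assume "1 \<le> length bs \<and> length bs \<le> Suc n"
  then obtain cs b where bs: "bs = cs @ [b]" "length cs \<le> n"
    by (cases bs rule: rev_cases) auto
  let ?S = "{ds :: 3 list. length ds = length cs}"
  have S: "finite ?S" using finite_lists_length_eq[of "UNIV :: 3 set" "length cs"] by simp
  have "norm (iter_partial bs f x) = norm (iter_partial cs (grad f) x $ b)"
    using iter_partial_grad[OF d, of cs] bs by simp
  also have "\<dots> \<le> tensor_norm (iter_partial cs (grad f) x)"
    using Finite_Cartesian_Product.norm_nth_le norm_le_tensor_norm order_trans by blast
  also have "\<dots> \<le> (\<Sum>ds\<in>?S. tensor_norm (iter_partial ds (grad f) x))"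
    using S by (intro member_le_sum) (auto simp: tensor_norm_def intro: sum_nonneg)
  finally have "ennreal (norm (iter_partial bs f x)) \<le> ennreal (\<Sum>ds\<in>?S. tensor_norm (iter_partial ds (grad f) x))"
    by (rule ennreal_leI)
  also have "\<dots> \<le> deriv_norm (length cs) (grad f)"
    unfolding deriv_norm_def by (rule SUP_upper) simp
  also have "\<dots> \<le> field_norm n (grad f)"
    unfolding field_norm_def using bs by (intro member_le_sum) auto
  also have "\<dots> \<le> ennreal (enn2real (field_norm n (grad f)))"
    by (rule finite_ennreal_bound[OF fin])
  finally show "norm (iter_partial bs f x) \<le> enn2real (field_norm n (grad f))"
    by (simp add: ennreal_le_iff)
qed

lemma partials_bounded_partial:
  assumes "partials_bounded (Suc n) c f"
  shows "partials_bounded n c (partial b f)" "f differentiable (at x)" "norm (partial b f x) \<le> c"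
proof -
  have "iter_partial bs (partial b f) differentiable (at x)" if "length bs < n" for bs x
    using assms that unfolding partials_bounded_def times_differentiable_def iter_partial_append[symmetric]
    by simp
  moreover have "norm (iter_partial bs (partial b f) x) \<le> c" if "length bs \<le> n" for bs x
    using assms that unfolding partials_bounded_def iter_partial_append[symmetric] by simp
  ultimately show "partials_bounded n c (partial b f)" "norm (partial b f x) \<le> c"
    by (auto simp: partials_bounded_def times_differentiable_def dest: meta_spec[of _ "[]"])
  show "f differentiable (at x)"
    using assms by (auto simp: partials_bounded_def times_differentiable_def dest: spec[of _ "[]"])
qed

lemma GD_add:
  assumes "f differentiable (at x)" "g differentiable (at x)"
  shows "GD (\<lambda>x. f x + g x) x = GD f x + GD g x"
  by (rule GD_eqI, rule has_derivative_eq_rhs[OF has_derivative_add[OF GD_works[OF assms(1)] GD_works[OF assms(2)]]])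
     (simp add: fun_eq_iff blinfun.add_left)

lemma smooth1_add:
  assumes "smooth1 B f" "smooth1 C g"
  shows "smooth1 (B + C) (\<lambda>x. f x + g x)"
proof -
  have eq: "GD (\<lambda>x. f x + g x) x = GD f x + GD g x" for x
    using assms by (intro GD_add smooth1D(4))
  have "norm (GD f x + GD g x - (GD f y + GD g y)) \<le> (B + C) * norm (x - y)" for x y
    using norm_triangle_mono[OF smooth1D(3)[OF assms(1), of x y] smooth1D(3)[OF assms(2), of x y]]
    by (simp add: algebra_simps)
  then show ?thesis
    using assms by (auto simp: smooth1_def eq intro: norm_triangle_mono)
qed

lemma smooth2_add:
  assumes "smooth2 B f" "smooth2 C g"
  shows "smooth2 (B + C) (\<lambda>x. f x + g x)"
proof -
  have eq: "GD (\<lambda>x. f x + g x) = (\<lambda>x. GD f x + GD g x)"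
    using assms by (auto simp: smooth2_def GD_add)
  show ?thesis
    using smooth1_add[OF smooth2D(1)[OF assms(1)] smooth2D(1)[OF assms(2)]] assms
    by (auto simp: smooth2_def eq intro: norm_triangle_mono)
qed

lemma smooth3_add:
  assumes "smooth3 B f" "smooth3 C g"
  shows "smooth3 (B + C) (\<lambda>x. f x + g x)"
proof -
  have eq: "GD (\<lambda>x. f x + g x) = (\<lambda>x. GD f x + GD g x)"
    using assms by (auto simp: smooth3_def GD_add)
  show ?thesis
    using smooth2_add[OF smooth3D(1)[OF assms(1)] smooth3D(1)[OF assms(2)]] assms
    by (auto simp: smooth3_def eq intro: norm_triangle_mono)
qed

text \<open>Composing a field with a contraction composes its derivative with another contraction; this makes
the smoothness classes stable under contractions by induction on the order.\<close>

definition left_compose ::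
  "('a::real_normed_vector \<Rightarrow>\<^sub>L 'b::real_normed_vector) \<Rightarrow>
    ('c::real_normed_vector \<Rightarrow>\<^sub>L 'a) \<Rightarrow>\<^sub>L ('c \<Rightarrow>\<^sub>L 'b)" where
  "left_compose T = Blinfun (\<lambda>L. T o\<^sub>L L)"

lemma left_compose_apply [simp]: "blinfun_apply (left_compose T) L = T o\<^sub>L L"
  unfolding left_compose_def
  by (subst bounded_linear_Blinfun_apply)
     (rule bounded_bilinear.bounded_linear_right[OF bounded_bilinear_blinfun_compose], rule refl)

lemma norm_left_compose: "norm (left_compose T) \<le> norm T"
  by (rule norm_blinfun_bound) (auto simp: norm_blinfun_compose)

lemma GD_blinfun:
  assumes "f differentiable (at x)"
  shows "GD (\<lambda>x. blinfun_apply T (f x)) x = T o\<^sub>L GD f x" "(\<lambda>x. blinfun_apply T (f x)) differentiable (at x)"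
proof -
  have "((\<lambda>x. blinfun_apply T (f x)) has_derivative blinfun_apply (T o\<^sub>L GD f x)) (at x)"
    by (rule has_derivative_eq_rhs[OF bounded_linear.has_derivative[OF blinfun.bounded_linear_right GD_works[OF assms]]])
       (simp add: fun_eq_iff)
  then show "GD (\<lambda>x. blinfun_apply T (f x)) x = T o\<^sub>L GD f x" "(\<lambda>x. blinfun_apply T (f x)) differentiable (at x)"
    using GD_eqI by (auto simp: differentiable_def)
qed

lemma norm_contraction_compose: "norm T \<le> 1 \<Longrightarrow> norm L \<le> B \<Longrightarrow> norm (T o\<^sub>L L) \<le> B"
  using norm_blinfun_compose_le[of T 1 L B] by simp

lemma smooth1_blinfun:
  assumes f: "smooth1 B f" and T: "norm T \<le> 1"
  shows "smooth1 B (\<lambda>x. blinfun_apply T (f x))"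
proof -
  have "(T o\<^sub>L GD f x) - (T o\<^sub>L GD f y) = T o\<^sub>L (GD f x - GD f y)" for x y
    by (rule blinfun_eqI) (simp add: blinfun.diff_left blinfun.diff_right)
  then have "norm ((T o\<^sub>L GD f x) - (T o\<^sub>L GD f y)) \<le> B * norm (x - y)" for x y
    using norm_contraction_compose[OF T smooth1D(3)[OF f]] by simp
  then show ?thesis
    using f norm_contraction_compose[OF T, of "GD f _"] by (auto simp: smooth1_def GD_blinfun)
qed

lemma smooth2_blinfun:
  assumes f: "smooth2 B f" and T: "norm T \<le> 1"
  shows "smooth2 B (\<lambda>x. blinfun_apply T (f x))"
proof -
  have eq: "GD (\<lambda>x. blinfun_apply T (f x)) = (\<lambda>x. blinfun_apply (left_compose T) (GD f x))"
    using f by (auto simp: smooth2_def GD_blinfun)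
  have "smooth1 B (\<lambda>x. blinfun_apply (left_compose T) (GD f x))"
    by (rule smooth1_blinfun[OF smooth2D(1)[OF f] order_trans[OF norm_left_compose T]])
  then show ?thesis
    using f norm_contraction_compose[OF T, of "GD f _"] unfolding smooth2_def eq by (auto simp: GD_blinfun)
qed

lemma smooth3_blinfun:
  assumes f: "smooth3 B f" and T: "norm T \<le> 1"
  shows "smooth3 B (\<lambda>x. blinfun_apply T (f x))"
proof -
  have eq: "GD (\<lambda>x. blinfun_apply T (f x)) = (\<lambda>x. blinfun_apply (left_compose T) (GD f x))"
    using f by (auto simp: smooth3_def GD_blinfun)
  have "smooth2 B (\<lambda>x. blinfun_apply (left_compose T) (GD f x))"
    by (rule smooth2_blinfun[OF smooth3D(1)[OF f] order_trans[OF norm_left_compose T]])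
  then show ?thesis
    using f norm_contraction_compose[OF T, of "GD f _"] unfolding smooth3_def eq by (auto simp: GD_blinfun)
qed

text \<open>The tensor product with the coordinate form \<open>dx\<^sub>b\<close>: the total derivative is
\<open>\<Sum>\<^sub>b dx\<^sub>b \<otimes> \<partial>\<^sub>b f\<close>, a sum of contractions of the partial derivatives.\<close>

definition coordinate_tensor :: "3 \<Rightarrow> 'v::real_normed_vector \<Rightarrow>\<^sub>L ((real^3) \<Rightarrow>\<^sub>L 'v)" where
  "coordinate_tensor b = Blinfun (\<lambda>v. Blinfun (\<lambda>h. h $ b *\<^sub>R v))"

lemma coordinate_tensor:
  fixes v :: "'v::real_normed_vector"
  shows "blinfun_apply (blinfun_apply (coordinate_tensor b) v) h = h $ b *\<^sub>R v"
    and "norm (coordinate_tensor b :: 'v \<Rightarrow>\<^sub>L ((real^3) \<Rightarrow>\<^sub>L 'v)) \<le> 1"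
proof -
  define T where "T v = Blinfun (\<lambda>h :: real^3. h $ b *\<^sub>R v)" for v :: 'v
  have T: "blinfun_apply (T v) h = h $ b *\<^sub>R v" for v h
    unfolding T_def
    by (subst bounded_linear_Blinfun_apply)
       (intro bounded_linear_scaleR_const bounded_linear_vec_nth, rule refl)
  have nT: "norm (T v) \<le> norm v" for v
    by (rule norm_blinfun_bound) (auto simp: T mult.commute component_le_norm_cart mult_left_mono)
  have "bounded_linear T"
  proof
    show "\<exists>K. \<forall>v. norm (T v) \<le> norm v * K" using nT by (intro exI[of _ 1]) auto
  qed (rule blinfun_eqI; simp add: T blinfun.add_left blinfun.scaleR_left scaleR_add_right)+
  then have c: "blinfun_apply (coordinate_tensor b) = T"
    unfolding coordinate_tensor_def T_def[symmetric] by (simp add: bounded_linear_Blinfun_apply)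
  show "blinfun_apply (blinfun_apply (coordinate_tensor b) v) h = h $ b *\<^sub>R v" by (simp add: c T)
  show "norm (coordinate_tensor b :: 'v \<Rightarrow>\<^sub>L ((real^3) \<Rightarrow>\<^sub>L 'v)) \<le> 1"
    by (rule norm_blinfun_bound) (auto simp: c nT)
qed

lemma GD_partials:
  fixes f :: "real^3 \<Rightarrow> 'v::euclidean_space"
  assumes "\<And>x. f differentiable (at x)"
  shows "GD f = (\<lambda>x. coordinate_tensor 1 (partial 1 f x) + coordinate_tensor 2 (partial 2 f x)
    + coordinate_tensor 3 (partial 3 f x))"
proof
  show "GD f x = coordinate_tensor 1 (partial 1 f x) + coordinate_tensor 2 (partial 2 f x)
    + coordinate_tensor 3 (partial 3 f x)" for x
    by (rule blinfun_eqI) (simp add: GD_expansion[OF assms] sum_3 blinfun.add_left coordinate_tensor(1))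
qed

lemma norm_GD_partials:
  fixes f :: "real^3 \<Rightarrow> 'v::euclidean_space"
  assumes "\<And>x. f differentiable (at x)" "\<And>b x. norm (partial b f x) \<le> c"
  shows "norm (GD f x) \<le> 3 * c"
proof -
  have "norm (coordinate_tensor b (partial b f x)) \<le> c" for b
    using norm_blinfun_le[OF coordinate_tensor(2) assms(2)] by simp
  then have "norm (GD f x) \<le> c + c + c"
    unfolding GD_partials[OF assms(1)] by (intro norm_triangle_mono)
  then show ?thesis by simp
qed

text \<open>One order of partial derivatives is spent on the Lipschitz bound for the last derivative. Each
passage from partial to total derivatives costs a factor three.\<close>

lemma partials_bounded_smooth1:
  assumes f: "partials_bounded 2 c f"
  shows "smooth1 (9 * c) f"
proof -
  have f2: "partials_bounded (Suc (Suc 0)) c f" using f by (simp add: numeral_2_eq_2)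
  note p = partials_bounded_partial[OF f2]
  note pp = partials_bounded_partial[OF p(1)]
  have c: "c \<ge> 0" using order_trans[OF norm_ge_zero p(3)] .
  have g: "norm (GD f x) \<le> 3 * c" for x by (rule norm_GD_partials[OF p(2,3)])
  have lip: "norm (partial b f x - partial b f y) \<le> 3 * c * norm (x - y)" for b x y
    by (rule lipschitz_of_derivative_bound[where f' = "GD (partial b f)"])
       (intro GD_works pp(2) norm_GD_partials pp(3))+
  have l: "norm (coordinate_tensor b (partial b f x - partial b f y)) \<le> 3 * c * norm (x - y)" for b x y
    using norm_blinfun_le[OF coordinate_tensor(2) lip, of b b x y] by simp
  have "norm (GD f x - GD f y) \<le> 9 * c * norm (x - y)" for x y
  proof -
    have "GD f x - GD f y = coordinate_tensor 1 (partial 1 f x - partial 1 f y)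
      + coordinate_tensor 2 (partial 2 f x - partial 2 f y) + coordinate_tensor 3 (partial 3 f x - partial 3 f y)"
      by (simp add: GD_partials[OF p(2)] blinfun.diff_right)
    also have "norm \<dots> \<le> 3 * c * norm (x - y) + 3 * c * norm (x - y) + 3 * c * norm (x - y)"
      by (intro norm_triangle_mono l)
    finally show ?thesis by simp
  qed
  moreover have "norm (GD f x) \<le> 9 * c" for x using g[of x] c by simp
  ultimately show ?thesis using p(2) by (auto simp: smooth1_def)
qed

lemma partials_bounded_smooth2:
  assumes f: "partials_bounded 3 c f"
  shows "smooth2 (27 * c) f"
proof -
  have f3: "partials_bounded (Suc 2) c f" using f by (simp add: eval_nat_numeral)
  note p = partials_bounded_partial[OF f3]
  have c: "c \<ge> 0" using order_trans[OF norm_ge_zero p(3)] .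
  have s: "smooth1 (9 * c) (\<lambda>x. coordinate_tensor b (partial b f x))" for b
    by (rule smooth1_blinfun[OF partials_bounded_smooth1[OF p(1)] coordinate_tensor(2)])
  have "smooth1 (9 * c + 9 * c + 9 * c) (GD f)"
    unfolding GD_partials[OF p(2)] by (intro smooth1_add s)
  moreover have "norm (GD f x) \<le> 27 * c" for x using norm_GD_partials[OF p(2,3), of x] c by simp
  ultimately show ?thesis using p(2) by (simp add: smooth2_def)
qed

lemma partials_bounded_smooth3:
  assumes f: "partials_bounded 4 c f"
  shows "smooth3 (81 * c) f"
proof -
  have f3: "partials_bounded (Suc 3) c f" using f by (simp add: eval_nat_numeral)
  note p = partials_bounded_partial[OF f3]
  have c: "c \<ge> 0" using order_trans[OF norm_ge_zero p(3)] .
  have s: "smooth2 (27 * c) (\<lambda>x. coordinate_tensor b (partial b f x))" for b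
    by (rule smooth2_blinfun[OF partials_bounded_smooth2[OF p(1)] coordinate_tensor(2)])
  have "smooth2 (27 * c + 27 * c + 27 * c) (GD f)"
    unfolding GD_partials[OF p(2)] by (intro smooth2_add s)
  moreover have "norm (GD f x) \<le> 81 * c" for x using norm_GD_partials[OF p(2,3), of x] c by simp
  ultimately show ?thesis using p(2) by (simp add: smooth3_def)
qed

lemma partials_bounded_smooth4:
  assumes f: "partials_bounded 5 c f"
  shows "smooth4 (243 * c) f"
proof -
  have f3: "partials_bounded (Suc 4) c f" using f by (simp add: eval_nat_numeral)
  note p = partials_bounded_partial[OF f3]
  have c: "c \<ge> 0" using order_trans[OF norm_ge_zero p(3)] .
  have s: "smooth3 (81 * c) (\<lambda>x. coordinate_tensor b (partial b f x))" for b
    by (rule smooth3_blinfun[OF partials_bounded_smooth3[OF p(1)] coordinate_tensor(2)])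
  have "smooth3 (81 * c + 81 * c + 81 * c) (GD f)"
    unfolding GD_partials[OF p(2)] by (intro smooth3_add s)
  moreover have "norm (GD f x) \<le> 243 * c" for x using norm_GD_partials[OF p(2,3), of x] c by simp
  ultimately show ?thesis using p(2) by (simp add: smooth4_def)
qed

section \<open>The evolution map on bounded continuous families of controlled paths\<close>

lemma norm_integral_le:
  fixes f :: "real \<Rightarrow> 'b::banach"
  assumes "f integrable_on S" "\<And>s. s \<in> S \<Longrightarrow> norm (f s) \<le> m s * c" "(m has_integral K) S"
  shows "norm (integral S f) \<le> K * c"
proof -
  have m: "((\<lambda>s. m s * c) has_integral (K * c)) S" by (rule has_integral_mult_left[OF assms(3)])
  have "norm (integral S f) \<le> integral S (\<lambda>s. m s * c)"
    by (rule integral_norm_bound_integral[OF assms(1) has_integral_integrable[OF m] assms(2)])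
  then show ?thesis unfolding integral_unique[OF m] .
qed

lemma geometric_convergent:
  fixes u :: "nat \<Rightarrow> 'a::banach"
  assumes "\<And>m n. n \<le> m \<Longrightarrow> norm (u m - u n) \<le> C * (1/2)^n"
  shows "convergent u"
proof -
  have lim: "(\<lambda>n. C * (1/2)^n) \<longlonglongrightarrow> 0"
    using tendsto_mult[OF tendsto_const[of C] LIMSEQ_realpow_zero[of "1/2"]] by simp
  have "Cauchy u"
    unfolding Cauchy_altdef2
  proof (intro allI impI)
    fix e :: real assume "e > 0"
    then obtain n where "C * (1/2)^n < e"
      using order_tendstoD(2)[OF lim] by (auto simp: eventually_sequentially)
    then show "\<exists>N. \<forall>n\<ge>N. dist (u n) (u N) < e"
      using assms by (intro exI[of _ n]) (auto simp: dist_norm intro: le_less_trans)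
  qed
  then show ?thesis by (simp add: Cauchy_convergent_iff)
qed

context rough begin

lemma ctrl_transfer:
  assumes "ctrl N z z'" "\<And>\<xi>. \<xi> \<in> {0..1} \<Longrightarrow> z \<xi> = y \<xi>" "\<And>\<xi>. \<xi> \<in> {0..1} \<Longrightarrow> z' \<xi> = y' \<xi>"
  shows "ctrl N y y'"
  using assms ctrl_cong[of z y z' y' N] by blast

lemma ctrl_integral:
  fixes z :: "real \<Rightarrow> real \<Rightarrow> 'b::banach"
  assumes z: "\<And>s. s \<in> S \<Longrightarrow> ctrl (m s) (z s) (z' s)" and m: "(m has_integral K) S"
    and int: "\<And>\<xi>. \<xi> \<in> {0..1} \<Longrightarrow> (\<lambda>s. z s \<xi>) integrable_on S"
      "\<And>\<xi>. \<xi> \<in> {0..1} \<Longrightarrow> (\<lambda>s. z' s \<xi>) integrable_on S"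
  shows "ctrl K (\<lambda>\<xi>. integral S (\<lambda>s. z s \<xi>)) (\<lambda>\<xi>. integral S (\<lambda>s. z' s \<xi>))"
  unfolding ctrl_def ctrl_semi_def
proof (intro conjI ballI)
  fix \<xi> :: real assume \<xi>: "\<xi> \<in> {0..1}"
  show "norm (integral S (\<lambda>s. z s \<xi>)) \<le> K"
    using norm_integral_le[OF int(1)[OF \<xi>] _ m, of 1] ctrlD(2)[OF z \<xi>] by simp
  show "norm (integral S (\<lambda>s. z' s \<xi>)) \<le> K"
    using norm_integral_le[OF int(2)[OF \<xi>] _ m, of 1] ctrl_semiD(1)[OF ctrlD(1)[OF z] \<xi>] by simp
  fix \<eta> :: real assume \<eta>: "\<eta> \<in> {0..1}"
  have "norm (integral S (\<lambda>s. z' s \<xi> - z' s \<eta>)) \<le> K * \<omega> \<xi> \<eta>"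
    by (rule norm_integral_le[OF integrable_diff[OF int(2)[OF \<xi>] int(2)[OF \<eta>]]
          ctrl_semiD(2)[OF ctrlD(1)[OF z] \<xi> \<eta>] m])
  then show "norm (integral S (\<lambda>s. z' s \<xi>) - integral S (\<lambda>s. z' s \<eta>)) \<le> K * \<omega> \<xi> \<eta>"
    by (simp add: integral_diff[OF int(2)[OF \<xi>] int(2)[OF \<eta>]])
  have bl: "bounded_linear (\<lambda>L. blinfun_apply L (X \<xi> - X \<eta>))" by (rule blinfun.bounded_linear_left)
  have i: "(\<lambda>s. z' s \<eta> (X \<xi> - X \<eta>)) integrable_on S"
    "integral S (\<lambda>s. z' s \<eta> (X \<xi> - X \<eta>)) = integral S (\<lambda>s. z' s \<eta>) (X \<xi> - X \<eta>)"
    using integrable_linear[OF int(2)[OF \<eta>] bl] integral_linear[OF int(2)[OF \<eta>] bl] by (simp_all add: o_def)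
  have "norm (integral S (\<lambda>s. z s \<xi> - z s \<eta> - z' s \<eta> (X \<xi> - X \<eta>))) \<le> K * (\<omega> \<xi> \<eta>)\<^sup>2"
    by (rule norm_integral_le[OF integrable_diff[OF integrable_diff[OF int(1)[OF \<xi>] int(1)[OF \<eta>]] i(1)]
          ctrl_semiD(3)[OF ctrlD(1)[OF z] \<xi> \<eta>] m])
  then show "norm (integral S (\<lambda>s. z s \<xi>) - integral S (\<lambda>s. z s \<eta>)
      - integral S (\<lambda>s. z' s \<eta>) (X \<xi> - X \<eta>)) \<le> K * (\<omega> \<xi> \<eta>)\<^sup>2"
    by (simp add: integral_diff[OF integrable_diff[OF int(1)[OF \<xi>] int(1)[OF \<eta>]] i(1)]
        integral_diff[OF int(1)[OF \<xi>] int(1)[OF \<eta>]] i(2))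
qed

lemma ctrl_limit:
  assumes z: "\<forall>\<^sub>F n in sequentially. ctrl N (z n) (z' n)"
    and lim: "\<And>\<xi>. \<xi> \<in> {0..1} \<Longrightarrow> (\<lambda>n. z n \<xi>) \<longlonglongrightarrow> y \<xi>" "\<And>\<xi>. \<xi> \<in> {0..1} \<Longrightarrow> (\<lambda>n. z' n \<xi>) \<longlonglongrightarrow> y' \<xi>"
  shows "ctrl N y y'"
proof -
  have le: "norm a \<le> c" if "u \<longlonglongrightarrow> a" "\<And>n. ctrl N (z n) (z' n) \<Longrightarrow> norm (u n) \<le> c"
    for u and a :: "'c::real_normed_vector" and c
    by (rule tendsto_upperbound[OF tendsto_norm[OF that(1)]]) (use z that(2) in \<open>auto elim: eventually_mono\<close>)
  show ?thesis
    unfolding ctrl_def ctrl_semi_def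
  proof (intro conjI ballI)
    fix \<xi> :: real assume \<xi>: "\<xi> \<in> {0..1}"
    show "norm (y \<xi>) \<le> N"
      by (rule le[OF lim(1)[OF \<xi>]], drule ctrlD(2)[OF _ \<xi>], assumption)
    show "norm (y' \<xi>) \<le> N"
      by (rule le[OF lim(2)[OF \<xi>]], drule ctrl_semiD(1)[OF ctrlD(1) \<xi>], assumption)
    fix \<eta> :: real assume \<eta>: "\<eta> \<in> {0..1}"
    show "norm (y' \<xi> - y' \<eta>) \<le> N * \<omega> \<xi> \<eta>"
      by (rule le[OF tendsto_diff[OF lim(2)[OF \<xi>] lim(2)[OF \<eta>]]],
          drule ctrl_semiD(2)[OF ctrlD(1) \<xi> \<eta>], assumption)
    show "norm (y \<xi> - y \<eta> - y' \<eta> (X \<xi> - X \<eta>)) \<le> N * (\<omega> \<xi> \<eta>)\<^sup>2"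
      by (rule le[OF tendsto_diff[OF tendsto_diff[OF lim(1)[OF \<xi>] lim(1)[OF \<eta>]]
            bounded_linear.tendsto[OF blinfun.bounded_linear_left lim(2)[OF \<eta>]]]],
          drule ctrl_semiD(3)[OF ctrlD(1) \<xi> \<eta>], assumption)
  qed
qed

definition pair_limit :: "(nat \<Rightarrow> controlled) \<Rightarrow> controlled \<Rightarrow> bool" where
  "pair_limit u Y \<longleftrightarrow> (\<forall>\<xi>\<in>{0..1}. (\<lambda>n. fst (u n) \<xi>) \<longlonglongrightarrow> fst Y \<xi> \<and> (\<lambda>n. snd (u n) \<xi>) \<longlonglongrightarrow> snd Y \<xi>)"

lemma ctrl_pair_limit:
  assumes "\<forall>\<^sub>F n in sequentially. ctrl_pair N (u n)" "pair_limit u Y"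
  shows "ctrl_pair N Y"
  unfolding ctrl_pair_def
  by (rule ctrl_limit[of N "\<lambda>n. fst (u n)" "\<lambda>n. deriv_blinfun (u n)"])
     (use assms in \<open>auto simp: ctrl_pair_def pair_limit_def
        intro: bounded_linear.tendsto[OF bounded_linear_matrix_blinfun]\<close>)

lemma pair_limit_diff:
  "pair_limit u Y \<Longrightarrow> pair_limit v Z \<Longrightarrow> pair_limit (\<lambda>n. controlled_diff (u n) (v n)) (controlled_diff Y Z)"
  by (auto simp: pair_limit_def controlled_diff_def intro: tendsto_diff)

lemma pair_limit_const: "pair_limit (\<lambda>n. Y) Y"
  by (simp add: pair_limit_def)

lemma ctrl_pair_mono: "ctrl_pair N Y \<Longrightarrow> N \<le> M \<Longrightarrow> ctrl_pair M Y"
  unfolding ctrl_pair_def by (rule ctrl_mono)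

lemma ctrl_pair_diff_iff:
  "ctrl_pair d (controlled_diff Y Z) \<longleftrightarrow>
    ctrl d (\<lambda>\<xi>. fst Y \<xi> - fst Z \<xi>) (\<lambda>\<xi>. matrix_blinfun (snd Y \<xi>) - matrix_blinfun (snd Z \<xi>))"
  by (simp add: ctrl_pair_def controlled_diff_def matrix_blinfun_diff)

lemma ctrl_pair_diff: "ctrl_pair N Y \<Longrightarrow> ctrl_pair M Z \<Longrightarrow> ctrl_pair (N + M) (controlled_diff Y Z)"
  unfolding ctrl_pair_diff_iff unfolding ctrl_pair_def by (rule ctrl_diff)

lemma ctrl_pair_diff_trans:
  assumes "ctrl_pair c (controlled_diff Y Z)" "ctrl_pair d (controlled_diff Z W)"
  shows "ctrl_pair (c + d) (controlled_diff Y W)"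
  using ctrl_add[OF assms[unfolded ctrl_pair_diff_iff]] by (simp add: ctrl_pair_diff_iff)

lemma ctrl_pair_diff_sym: "ctrl_pair c (controlled_diff Y Z) \<Longrightarrow> ctrl_pair c (controlled_diff Z Y)"
  unfolding ctrl_pair_diff_iff by (rule ctrl_commute)

lemma ctrl_pair_from_diff:
  assumes "ctrl_pair c (controlled_diff Y Z)" "ctrl_pair d Z"
  shows "ctrl_pair (c + d) Y"
  using ctrl_add[OF assms(1)[unfolded ctrl_pair_diff_iff] assms(2)[unfolded ctrl_pair_def]]
  by (simp add: ctrl_pair_def)

lemma ctrl_pair_diff_self: "ctrl_pair 0 (controlled_diff Y Y)"
  by (simp add: ctrl_pair_diff_iff ctrl_def ctrl_semi_def blinfun.zero_left)

lemma ctrl_pair_norm: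
  assumes "ctrl_pair d (controlled_diff Y Z)" "\<xi> \<in> {0..1}"
  shows "norm (fst Y \<xi> - fst Z \<xi>) \<le> d" "norm (snd Y \<xi> - snd Z \<xi>) \<le> 9 * d"
proof -
  note c = assms(1)[unfolded ctrl_pair_diff_iff]
  show "norm (fst Y \<xi> - fst Z \<xi>) \<le> d" by (rule ctrlD(2)[OF c assms(2)])
  have m: "norm (matrix_blinfun (snd Y \<xi>) - matrix_blinfun (snd Z \<xi>)) \<le> d"
    by (rule ctrl_semiD(1)[OF ctrlD(1)[OF c] assms(2)])
  show "norm (snd Y \<xi> - snd Z \<xi>) \<le> 9 * d"
    using norm_le_matrix_blinfun[of "snd Y \<xi> - snd Z \<xi>"] m by (simp add: matrix_blinfun_diff)
qed

definition transport :: "(real^3 \<Rightarrow> real^3^3) \<Rightarrow> controlled \<Rightarrow> controlled" where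
  "transport A Y = (\<lambda>\<xi>. velocity A XX Y (fst Y \<xi>),
     \<lambda>\<xi>. jacobian (velocity A XX Y) (at (fst Y \<xi>)) ** snd Y \<xi>)"

text \<open>The elements of \<open>C([0,T], D\<^sub>X)\<close> in a given ball, without the convention on values outside the
domain; the radius is what the constants of the estimates depend on.\<close>

definition admissible :: "real \<Rightarrow> real \<Rightarrow> (real \<Rightarrow> controlled) \<Rightarrow> bool" where
  "admissible M T y \<longleftrightarrow> (\<forall>t\<in>{0..T}. fst (y t) 0 = fst (y t) 1 \<and> ctrl_pair M (y t) \<and>
     (\<forall>e>0. \<exists>\<delta>>0. \<forall>s\<in>{0..T}. \<bar>s - t\<bar> < \<delta> \<longrightarrow> ctrl_pair e (controlled_diff (y s) (y t))))"

lemma admissibleD: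
  assumes "admissible M T y" "t \<in> {0..T}"
  shows "fst (y t) 0 = fst (y t) 1" "ctrl_pair M (y t)"
    "e > 0 \<Longrightarrow> \<exists>\<delta>>0. \<forall>s\<in>{0..T}. \<bar>s - t\<bar> < \<delta> \<longrightarrow> ctrl_pair e (controlled_diff (y s) (y t))"
  using assms by (auto simp: admissible_def)

lemma admissible_mono: "admissible M T y \<Longrightarrow> M \<le> N \<Longrightarrow> admissible N T y"
  unfolding admissible_def using ctrl_pair_mono by blast

lemma admissibleI_lipschitz:
  assumes "\<And>t. t \<in> {0..T} \<Longrightarrow> fst (y t) 0 = fst (y t) 1" "\<And>t. t \<in> {0..T} \<Longrightarrow> ctrl_pair M (y t)"
    and lip: "\<And>s t. s \<in> {0..T} \<Longrightarrow> t \<in> {0..T} \<Longrightarrow> ctrl_pair (g * \<bar>s - t\<bar>) (controlled_diff (y s) (y t))"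
  shows "admissible M T y"
  unfolding admissible_def
proof (intro ballI conjI allI impI assms)
  fix t e :: real assume t: "t \<in> {0..T}" and "e > 0"
  let ?d = "e / (\<bar>g\<bar> + 1)"
  have "ctrl_pair e (controlled_diff (y s) (y t))" if "s \<in> {0..T}" "\<bar>s - t\<bar> < ?d" for s
  proof (rule ctrl_pair_mono[OF lip[OF that(1) t]])
    have "g * \<bar>s - t\<bar> \<le> (\<bar>g\<bar> + 1) * \<bar>s - t\<bar>" by (intro mult_right_mono) auto
    also have "\<dots> \<le> (\<bar>g\<bar> + 1) * ?d" using that by (intro mult_left_mono) auto
    also have "\<dots> = e" by simp
    finally show "g * \<bar>s - t\<bar> \<le> e" .
  qed
  moreover have "?d > 0" using \<open>e > 0\<close> by simp
  ultimately show "\<exists>\<delta>>0. \<forall>s\<in>{0..T}. \<bar>s - t\<bar> < \<delta> \<longrightarrow> ctrl_pair e (controlled_diff (y s) (y t))" by blast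
qed

end

text \<open>The two constants are kept apart because only \<open>B\<close> may enter the lifetime.\<close>

locale filament = rough +
  fixes A :: "real^3 \<Rightarrow> real^3^3" and B B' :: real
  assumes A3: "smooth3 B A" and A4: "smooth4 B' A"
begin

lemma transport_eq:
  assumes Y: "ctrl_pair M Y" and c: "fst Y 0 = fst Y 1"
  shows "fst (transport A Y) = (\<lambda>\<xi>. kernel_field (*v) A (fst Y) (deriv_blinfun Y) (fst Y \<xi>))"
    and "matrix_blinfun (snd (transport A Y) \<xi>) =
      GD (kernel_field (*v) A (fst Y) (deriv_blinfun Y)) (fst Y \<xi>) o\<^sub>L matrix_blinfun (snd Y \<xi>)"
proof -
  have A1: "smooth1 B A" by (rule smooth2D(2)[OF smooth3D(2)[OF A3]])
  note v = velocity_eq_kernel_field[OF A1 Y]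
  have cs: "ctrl_semi M (fst Y) (deriv_blinfun Y)" using Y ctrlD(1) by (simp add: ctrl_pair_def)
  show "fst (transport A Y) = (\<lambda>\<xi>. kernel_field (*v) A (fst Y) (deriv_blinfun Y) (fst Y \<xi>))"
    by (simp add: transport_def v)
  show "matrix_blinfun (snd (transport A Y) \<xi>) =
      GD (kernel_field (*v) A (fst Y) (deriv_blinfun Y)) (fst Y \<xi>) o\<^sub>L matrix_blinfun (snd Y \<xi>)"
    using smooth1D(4)[OF smooth1_kernel_field[OF contractive_matrix_vector_mult A3 cs c]]
    by (simp add: transport_def v matrix_blinfun_mult matrix_blinfun_jacobian)
qed

lemma transport_bound:
  assumes Y: "ctrl_pair M Y" and c: "fst Y 0 = fst Y 1"
  shows "ctrl_pair (transport_growth B M) (transport A Y)"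
  unfolding ctrl_pair_def transport_eq[OF assms]
  by (rule ctrl_transport[OF contractive_matrix_vector_mult A3 _ c])
     (use Y ctrlD(1) in \<open>simp add: ctrl_pair_def\<close>)

lemma transport_lipschitz:
  assumes Y: "ctrl_pair M Y" "fst Y 0 = fst Y 1" and Z: "ctrl_pair M Z" "fst Z 0 = fst Z 1"
    and d: "ctrl_pair d (controlled_diff Y Z)"
  shows "ctrl_pair (transport_lip_const B' M * d) (controlled_diff (transport A Y) (transport A Z))"
proof -
  have "ctrl (transport_lip_const B' M * d) (\<lambda>\<xi>. fst (transport A Y) \<xi> - fst (transport A Z) \<xi>)
      (\<lambda>\<xi>. matrix_blinfun (snd (transport A Y) \<xi>) - matrix_blinfun (snd (transport A Z) \<xi>))"
    unfolding transport_eq[OF Y] transport_eq[OF Z]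
    by (rule ctrl_transport_diff[OF contractive_matrix_vector_mult A4 _ Y(2) _ Z(2) d[unfolded ctrl_pair_diff_iff]])
       (use Y(1) Z(1) ctrlD(1) in \<open>simp_all add: ctrl_pair_def\<close>)
  then show ?thesis by (simp add: ctrl_pair_diff_iff)
qed

lemma transport_lip_const_nonneg:
  assumes "M \<ge> 0"
  shows "transport_lip_const B' M \<ge> 0"
  using smooth1_nonneg[OF smooth2D(2)[OF smooth3D(2)[OF smooth4D(2)[OF A4]]]] K_nonneg[OF assms] growth_nonneg[OF assms]
  by (simp add: transport_lip_const_def)

lemma transport_growth_nonneg:
  assumes "M \<ge> 0"
  shows "transport_growth B M \<ge> 0"
  using smooth1_nonneg[OF smooth2D(2)[OF smooth3D(2)[OF A3]]] K_nonneg[OF assms] growth_nonneg[OF assms]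
  by (simp add: transport_growth_def)

lemma ctrl_pair_nonneg: "ctrl_pair M Y \<Longrightarrow> M \<ge> 0"
  unfolding ctrl_pair_def by (rule ctrl_nonneg)

lemma transport_continuous:
  assumes y: "admissible M T y" and \<xi>: "\<xi> \<in> {0..1}"
  shows "continuous_on {0..T} (\<lambda>s. fst (transport A (y s)) \<xi>)"
    "continuous_on {0..T} (\<lambda>s. snd (transport A (y s)) \<xi>)"
    "continuous_on {0..T} (\<lambda>s. matrix_blinfun (snd (transport A (y s)) \<xi>))"
proof -
  have key: "\<exists>\<delta>>0. \<forall>s\<in>{0..T}. \<bar>s - t\<bar> < \<delta> \<longrightarrow>
      norm (fst (transport A (y s)) \<xi> - fst (transport A (y t)) \<xi>) < e \<and>
      norm (snd (transport A (y s)) \<xi> - snd (transport A (y t)) \<xi>) < e"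
    if t: "t \<in> {0..T}" and e: "e > 0" for t e
  proof -
    let ?L = "transport_lip_const B' M"
    have L: "?L \<ge> 0"
      using transport_lip_const_nonneg ctrl_pair_nonneg[OF admissibleD(2)[OF y t]] by blast
    \<comment> \<open>The factor 9 compares the norm of a matrix with the norm of its linear map.\<close>
    define P where "P = 9 * ?L + 1"
    define d where "d = e / P / 2"
    have "P > 0" using L by (simp add: P_def)
    then have "d > 0" "P * d = e / 2" using e by (simp_all add: d_def)
    then have d: "d > 0" "9 * ?L * d < e" using e by (simp_all add: P_def distrib_right)
    from admissibleD(3)[OF y t d(1)] obtain \<delta> where \<delta>: "\<delta> > 0"
      "\<And>s. s \<in> {0..T} \<Longrightarrow> \<bar>s - t\<bar> < \<delta> \<Longrightarrow> ctrl_pair d (controlled_diff (y s) (y t))" by blast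
    show ?thesis
    proof (intro exI[of _ \<delta>] conjI ballI impI \<delta>(1))
      fix s assume s: "s \<in> {0..T}" "\<bar>s - t\<bar> < \<delta>"
      note b = ctrl_pair_norm[OF transport_lipschitz[OF admissibleD(2,1)[OF y s(1)] admissibleD(2,1)[OF y t]
            \<delta>(2)[OF s]] \<xi>]
      have "?L * d \<ge> 0" using L d by simp
      then show "norm (fst (transport A (y s)) \<xi> - fst (transport A (y t)) \<xi>) < e"
        "norm (snd (transport A (y s)) \<xi> - snd (transport A (y t)) \<xi>) < e"
        using b d(2) by simp_all
    qed
  qed
  show "continuous_on {0..T} (\<lambda>s. fst (transport A (y s)) \<xi>)"
    unfolding continuous_on_iff dist_norm real_norm_def using key by meson
  show s: "continuous_on {0..T} (\<lambda>s. snd (transport A (y s)) \<xi>)"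
    unfolding continuous_on_iff dist_norm real_norm_def using key by meson
  show "continuous_on {0..T} (\<lambda>s. matrix_blinfun (snd (transport A (y s)) \<xi>))"
    by (rule bounded_linear.continuous_on[OF bounded_linear_matrix_blinfun s])
qed

abbreviation "F T \<equiv> evolution_map A X XX T"

lemma evolution_map_eq:
  assumes "t \<in> {0..T}" "\<xi> \<in> {0..1}"
  shows "fst (F T y t) \<xi> = X \<xi> + integral {0..t} (\<lambda>s. fst (transport A (y s)) \<xi>)"
    "snd (F T y t) \<xi> = mat 1 + integral {0..t} (\<lambda>s. snd (transport A (y s)) \<xi>)"
  using assms by (simp_all add: evolution_map_def transport_def)

lemma transport_integrable:
  assumes y: "admissible M T y" and \<xi>: "\<xi> \<in> {0..1}" and st: "0 \<le> s" "t \<le> T"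
  shows "(\<lambda>r. fst (transport A (y r)) \<xi>) integrable_on {s..t}"
    "(\<lambda>r. snd (transport A (y r)) \<xi>) integrable_on {s..t}"
    "(\<lambda>r. matrix_blinfun (snd (transport A (y r)) \<xi>)) integrable_on {s..t}"
  using transport_continuous[OF y \<xi>] st
  by (auto intro!: integrable_continuous_real elim: continuous_on_subset)

lemma evolution_map_closed:
  assumes y: "admissible M T y" and t: "t \<in> {0..T}"
  shows "fst (F T y t) 0 = fst (F T y t) 1"
proof -
  have "integral {0..t} (\<lambda>s. fst (transport A (y s)) 0) = integral {0..t} (\<lambda>s. fst (transport A (y s)) 1)"
    by (rule integral_cong) (use admissibleD(1)[OF y] t in \<open>simp add: transport_def\<close>)
  then show ?thesis using X_closed evolution_map_eq[OF t, of 0] evolution_map_eq[OF t, of 1] by simp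
qed

text \<open>The integrand is bounded in the controlled norm, hence the evolution is Lipschitz in that norm; this
yields both invariance of the ball and continuity in time.\<close>

lemma evolution_map_lipschitz_le:
  assumes y: "admissible M T y" and st: "0 \<le> s" "s \<le> t" "t \<le> T"
  shows "ctrl_pair (transport_growth B M * (t - s)) (controlled_diff (F T y t) (F T y s))"
proof -
  have t: "t \<in> {0..T}" and s: "s \<in> {0..T}" using st by auto
  have "ctrl (transport_growth B M * (t - s)) (\<lambda>\<xi>. integral {s..t} (\<lambda>r. fst (transport A (y r)) \<xi>))
      (\<lambda>\<xi>. integral {s..t} (\<lambda>r. matrix_blinfun (snd (transport A (y r)) \<xi>)))"
  proof (rule ctrl_integral)
    show "ctrl (transport_growth B M) (fst (transport A (y r))) (deriv_blinfun (transport A (y r)))" if "r \<in> {s..t}" for r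
      using transport_bound admissibleD[OF y, of r] that st by (simp add: ctrl_pair_def)
    show "((\<lambda>r. transport_growth B M) has_integral transport_growth B M * (t - s)) {s..t}"
      using has_integral_const_real[of "transport_growth B M" s t] st by (simp add: mult.commute)
  qed (use transport_integrable[OF y _ st(1,3)] in auto)
  moreover have "integral {s..t} (\<lambda>r. fst (transport A (y r)) \<xi>) = fst (F T y t) \<xi> - fst (F T y s) \<xi>"
    if "\<xi> \<in> {0..1}" for \<xi>
    using Henstock_Kurzweil_Integration.integral_combine[OF st(1,2) transport_integrable(1)[OF y that order_refl st(3)]]
    by (simp add: evolution_map_eq[OF t that] evolution_map_eq[OF s that] algebra_simps)
  moreover have "integral {s..t} (\<lambda>r. matrix_blinfun (snd (transport A (y r)) \<xi>))
      = matrix_blinfun (snd (F T y t) \<xi>) - matrix_blinfun (snd (F T y s) \<xi>)" if "\<xi> \<in> {0..1}" for \<xi>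
  proof -
    have "integral {s..t} (\<lambda>r. matrix_blinfun (snd (transport A (y r)) \<xi>))
        = matrix_blinfun (integral {s..t} (\<lambda>r. snd (transport A (y r)) \<xi>))"
      using integral_linear[OF transport_integrable(2)[OF y that st(1,3)] bounded_linear_matrix_blinfun]
      by (simp add: o_def)
    also have "integral {s..t} (\<lambda>r. snd (transport A (y r)) \<xi>) = snd (F T y t) \<xi> - snd (F T y s) \<xi>"
      using Henstock_Kurzweil_Integration.integral_combine[OF st(1,2) transport_integrable(2)[OF y that order_refl st(3)]]
      by (simp add: evolution_map_eq[OF t that] evolution_map_eq[OF s that] algebra_simps)
    finally show ?thesis by (simp add: matrix_blinfun_diff)
  qed
  ultimately show ?thesis unfolding ctrl_pair_diff_iff by (rule ctrl_transfer)
qed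

lemma evolution_map_lipschitz:
  assumes y: "admissible M T y" and st: "s \<in> {0..T}" "t \<in> {0..T}"
  shows "ctrl_pair (transport_growth B M * \<bar>s - t\<bar>) (controlled_diff (F T y s) (F T y t))"
proof (cases "s \<le> t")
  case True
  then show ?thesis
    using ctrl_pair_diff_sym[OF evolution_map_lipschitz_le[OF y, of s t]] st by (simp add: abs_minus_commute)
next
  case False
  then show ?thesis using evolution_map_lipschitz_le[OF y, of t s] st by simp
qed

lemma ctrl_pair_X: "ctrl_pair \<kappa> (X, \<lambda>\<xi>. mat 1)"
  unfolding ctrl_pair_def ctrl_def ctrl_semi_def
  using X_le \<kappa> norm_blinfun_id_le order_trans by (auto simp: matrix_blinfun_mat_1)

lemma evolution_map_bound:
  assumes y: "admissible M T y" and t: "t \<in> {0..T}"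
  shows "ctrl_pair (transport_growth B M * t + \<kappa>) (F T y t)"
proof -
  have 0: "0 \<in> {0..T}" using t by simp
  have "ctrl_pair \<kappa> (F T y 0)"
    unfolding ctrl_pair_def
    by (rule ctrl_transfer[OF ctrl_pair_X[unfolded ctrl_pair_def]]) (simp_all add: evolution_map_eq[OF 0])
  from ctrl_pair_from_diff[OF evolution_map_lipschitz[OF y t 0] this] show ?thesis using t by simp
qed

lemma evolution_map_admissible:
  assumes "admissible M T y" "transport_growth B M * T + \<kappa> \<le> N" "M \<ge> 0"
  shows "admissible N T (F T y)"
proof (rule admissibleI_lipschitz[OF evolution_map_closed[OF assms(1)] _ evolution_map_lipschitz[OF assms(1)]])
  fix t assume t: "t \<in> {0..T}"
  have "transport_growth B M * t \<le> transport_growth B M * T"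
    using t transport_growth_nonneg[OF assms(3)] by (intro mult_left_mono) auto
  then show "ctrl_pair N (F T y t)"
    using ctrl_pair_mono[OF evolution_map_bound[OF assms(1) t]] assms(2) by simp
qed

abbreviation "\<Lambda> \<equiv> transport_lip_const B'"

text \<open>\<open>\<integral>\<^sub>0\<^sup>t \<Lambda> c e\<^sup>2\<^sup>\<Lambda>\<^sup>s ds \<le> (c/2) e\<^sup>2\<^sup>\<Lambda>\<^sup>t\<close>: under the exponential weight the evolution map halves distances
on an interval of any length, as long as both evolutions are in the ball of radius \<open>M\<close>.\<close>

lemma evolution_map_contraction:
  assumes y: "admissible M T y" and z: "admissible M T z" and "c \<ge> 0"
    and d: "\<And>t. t \<in> {0..T} \<Longrightarrow> ctrl_pair (c * exp (2 * \<Lambda> M * t)) (controlled_diff (y t) (z t))"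
    and t: "t \<in> {0..T}"
  shows "ctrl_pair (c / 2 * exp (2 * \<Lambda> M * t)) (controlled_diff (F T y t) (F T z t))"
proof -
  have t': "0 \<le> t" "t \<le> T" using t by auto
  let ?m = "\<lambda>s. \<Lambda> M * (c * exp (2 * \<Lambda> M * s))"
  let ?K = "c / 2 * exp (2 * \<Lambda> M * t) - c / 2"
  have "ctrl ?K (\<lambda>\<xi>. integral {0..t} (\<lambda>s. fst (transport A (y s)) \<xi> - fst (transport A (z s)) \<xi>))
     (\<lambda>\<xi>. integral {0..t} (\<lambda>s. matrix_blinfun (snd (transport A (y s)) \<xi>) - matrix_blinfun (snd (transport A (z s)) \<xi>)))"
  proof (rule ctrl_integral)
    fix s assume "s \<in> {0..t}"
    then have s: "s \<in> {0..T}" using t by auto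
    have "ctrl_pair (?m s) (controlled_diff (transport A (y s)) (transport A (z s)))"
      by (rule transport_lipschitz[OF admissibleD(2,1)[OF y s] admissibleD(2,1)[OF z s] d[OF s]])
    then show "ctrl (?m s) (\<lambda>\<xi>. fst (transport A (y s)) \<xi> - fst (transport A (z s)) \<xi>)
      (\<lambda>\<xi>. matrix_blinfun (snd (transport A (y s)) \<xi>) - matrix_blinfun (snd (transport A (z s)) \<xi>))"
      unfolding ctrl_pair_diff_iff .
  next
    have "(?m has_integral (c / 2 * exp (2 * \<Lambda> M * t) - c / 2 * exp (2 * \<Lambda> M * 0))) {0..t}"
      by (rule fundamental_theorem_of_calculus[OF t'(1)])
         (auto intro!: derivative_eq_intros simp: has_real_derivative_iff_has_vector_derivative[symmetric])
    then show "(?m has_integral ?K) {0..t}" by simp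
  qed (use transport_integrable[OF y _ order_refl t'(2)] transport_integrable[OF z _ order_refl t'(2)]
      in \<open>auto intro: integrable_diff\<close>)
  moreover have "integral {0..t} (\<lambda>s. fst (transport A (y s)) \<xi> - fst (transport A (z s)) \<xi>)
      = fst (F T y t) \<xi> - fst (F T z t) \<xi>" if "\<xi> \<in> {0..1}" for \<xi>
    using transport_integrable[OF y that order_refl t'(2)] transport_integrable[OF z that order_refl t'(2)]
    by (simp add: evolution_map_eq[OF t that] integral_diff)
  moreover have "integral {0..t} (\<lambda>s. matrix_blinfun (snd (transport A (y s)) \<xi>) - matrix_blinfun (snd (transport A (z s)) \<xi>))
      = matrix_blinfun (snd (F T y t) \<xi>) - matrix_blinfun (snd (F T z t) \<xi>)" if "\<xi> \<in> {0..1}" for \<xi>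
  proof -
    note iy = transport_integrable[OF y that order_refl t'(2)] and iz = transport_integrable[OF z that order_refl t'(2)]
    have "integral {0..t} (\<lambda>s. matrix_blinfun (snd (transport A (y s)) \<xi> - snd (transport A (z s)) \<xi>))
        = matrix_blinfun (integral {0..t} (\<lambda>s. snd (transport A (y s)) \<xi> - snd (transport A (z s)) \<xi>))"
      using integral_linear[OF integrable_diff[OF iy(2) iz(2)] bounded_linear_matrix_blinfun] by (simp add: o_def)
    also have "integral {0..t} (\<lambda>s. snd (transport A (y s)) \<xi> - snd (transport A (z s)) \<xi>)
      = snd (F T y t) \<xi> - snd (F T z t) \<xi>"
      using iy iz by (simp add: evolution_map_eq[OF t that] integral_diff)
    finally show ?thesis by (simp add: matrix_blinfun_diff)
  qed
  ultimately have "ctrl_pair ?K (controlled_diff (F T y t) (F T z t))"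
    unfolding ctrl_pair_diff_iff by (rule ctrl_transfer)
  then show ?thesis by (rule ctrl_pair_mono) (use \<open>c \<ge> 0\<close> in simp)
qed

lemma half_power_times_le_imp_zero:
  assumes "\<And>n. norm (v :: 'v::real_normed_vector) \<le> C * (1/2)^n"
  shows "v = 0"
proof -
  have "(\<lambda>n. C * (1/2)^n) \<longlonglongrightarrow> C * 0"
    by (intro tendsto_mult tendsto_const LIMSEQ_realpow_zero) auto
  then have "norm v \<le> C * 0" using assms by (intro LIMSEQ_le_const) auto
  then show ?thesis by simp
qed

text \<open>Starting from the trivial distance \<open>2M\<close>, the contraction can be applied to the pair of fixed points
arbitrarily often.\<close>

lemma fixed_point_unique:
  assumes y: "admissible M T y" "F T y = y" and z: "admissible M T z" "F T z = z"
    and t: "t \<in> {0..T}" and \<xi>: "\<xi> \<in> {0..1}"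
  shows "fst (y t) \<xi> = fst (z t) \<xi>" "snd (y t) \<xi> = snd (z t) \<xi>"
proof -
  have M: "M \<ge> 0" using ctrl_pair_nonneg[OF admissibleD(2)[OF y(1) t]] .
  have \<Lambda>: "\<Lambda> M \<ge> 0" by (rule transport_lip_const_nonneg[OF M])
  have "ctrl_pair (2 * M * (1/2)^n * exp (2 * \<Lambda> M * t)) (controlled_diff (y t) (z t))"
    if "t \<in> {0..T}" for n t
    using that
  proof (induction n arbitrary: t)
    case 0
    have "2 * M * 1 \<le> 2 * M * exp (2 * \<Lambda> M * t)" using M \<Lambda> 0 by (intro mult_left_mono) auto
    then show ?case
      using ctrl_pair_mono[OF ctrl_pair_diff[OF admissibleD(2)[OF y(1) 0] admissibleD(2)[OF z(1) 0]]] by simp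
  next
    case (Suc n)
    have "ctrl_pair (2 * M * (1/2)^n / 2 * exp (2 * \<Lambda> M * t)) (controlled_diff (F T y t) (F T z t))"
      by (rule evolution_map_contraction[OF y(1) z(1) _ Suc.IH Suc.prems]) (use M in auto)
    then show ?case by (simp add: y z mult_ac)
  qed
  note b = ctrl_pair_norm[OF this[OF t] \<xi>]
  have "fst (y t) \<xi> - fst (z t) \<xi> = 0"
    by (rule half_power_times_le_imp_zero[of _ "2 * M * exp (2 * \<Lambda> M * t)"]) (use b(1) in \<open>simp add: mult_ac\<close>)
  moreover have "snd (y t) \<xi> - snd (z t) \<xi> = 0"
    by (rule half_power_times_le_imp_zero[of _ "9 * (2 * M * exp (2 * \<Lambda> M * t))"]) (use b(2) in \<open>simp add: mult_ac\<close>)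
  ultimately show "fst (y t) \<xi> = fst (z t) \<xi>" "snd (y t) \<xi> = snd (z t) \<xi>" by simp_all
qed

end

section \<open>Existence and uniqueness of the evolution\<close>

context filament begin

lemma F_extensional: "F T y \<in> extensional {0..T}"
  "t \<in> {0..T} \<Longrightarrow> fst (F T y t) \<in> extensional {0..1} \<and> snd (F T y t) \<in> extensional {0..1}"
  by (simp_all add: evolution_map_def)

lemma evolution_ext:
  assumes y: "y \<in> extensional {0..T}" "\<And>t. t \<in> {0..T} \<Longrightarrow> fst (y t) \<in> extensional {0..1} \<and> snd (y t) \<in> extensional {0..1}"
    and z: "z \<in> extensional {0..T}" "\<And>t. t \<in> {0..T} \<Longrightarrow> fst (z t) \<in> extensional {0..1} \<and> snd (z t) \<in> extensional {0..1}"
    and eq: "\<And>t \<xi>. t \<in> {0..T} \<Longrightarrow> \<xi> \<in> {0..1} \<Longrightarrow> fst (y t) \<xi> = fst (z t) \<xi> \<and> snd (y t) \<xi> = snd (z t) \<xi>"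
  shows "y = z"
proof (rule extensionalityI[OF y(1) z(1)])
  fix t assume t: "t \<in> {0..T}"
  show "y t = z t"
    using y(2)[OF t] z(2)[OF t] eq[OF t] by (intro prod_eqI extensionalityI[of _ "{0..1}"]) auto
qed

text \<open>The limit of the Picard iterates is taken pointwise; bounds in the controlled norm pass to pointwise
limits, which replaces the completeness of \<open>D\<^sub>X\<close>.\<close>

lemma fixed_point_exists:
  assumes T: "T > 0" and small: "transport_growth B (\<kappa> + 1) * T \<le> 1"
  shows "\<exists>y. admissible (\<kappa> + 1) T y \<and> F T y = y"
proof -
  define M where "M = \<kappa> + 1"
  have M: "M \<ge> 0" using \<kappa> by (simp add: M_def)
  have \<Lambda>: "\<Lambda> M \<ge> 0" by (rule transport_lip_const_nonneg[OF M])
  define u where "u n = (F T ^^ n) (\<lambda>t. (X, \<lambda>\<xi>. mat 1))" for n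
  have u_Suc: "u (Suc n) = F T (u n)" for n by (simp add: u_def)
  have u_adm: "admissible M T (u n)" for n
  proof (induction n)
    case 0
    have "ctrl_pair M (X, \<lambda>\<xi>. mat 1)" by (rule ctrl_pair_mono[OF ctrl_pair_X]) (simp add: M_def)
    then show ?case
      using X_closed ctrl_pair_diff_self by (intro admissibleI_lipschitz[where g = 0]) (auto simp: u_def)
  next
    case (Suc n)
    show ?case
      unfolding u_Suc by (rule evolution_map_admissible[OF Suc _ M]) (use small in \<open>simp add: M_def\<close>)
  qed
  let ?e = "\<lambda>t. exp (2 * \<Lambda> M * t)"
  have increment: "ctrl_pair (2 * M * (1/2)^n * ?e t) (controlled_diff (u (Suc n) t) (u n t))" if "t \<in> {0..T}" for n t
    using that
  proof (induction n arbitrary: t)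
    case 0
    have "2 * M * 1 \<le> 2 * M * ?e t" using M \<Lambda> 0 by (intro mult_left_mono) auto
    then show ?case
      using ctrl_pair_mono[OF ctrl_pair_diff[OF admissibleD(2)[OF u_adm 0] admissibleD(2)[OF u_adm 0]]] by simp
  next
    case (Suc n)
    have "ctrl_pair (2 * M * (1/2)^n / 2 * ?e t) (controlled_diff (F T (u (Suc n)) t) (F T (u n) t))"
      by (rule evolution_map_contraction[OF u_adm u_adm _ Suc.IH Suc.prems]) (use M in auto)
    then show ?case unfolding u_Suc by (simp add: mult_ac)
  qed
  have tele: "ctrl_pair (4 * M * ?e t * ((1/2)^n - (1/2)^m)) (controlled_diff (u m t) (u n t))"
    if t: "t \<in> {0..T}" and "n \<le> m" for n m t
    using \<open>n \<le> m\<close>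
  proof (induction m rule: dec_induct)
    case base
    then show ?case using ctrl_pair_diff_self by simp
  next
    case (step m)
    have "2 * M * (1/2)^m * ?e t + 4 * M * ?e t * ((1/2)^n - (1/2)^m) = 4 * M * ?e t * ((1/2)^n - (1/2)^Suc m)"
      by (simp add: algebra_simps)
    then show ?case using ctrl_pair_diff_trans[OF increment[OF t] step.IH] by simp
  qed
  have near: "ctrl_pair (4 * M * (1/2)^n * ?e t) (controlled_diff (u m t) (u n t))"
    if "t \<in> {0..T}" and "n \<le> m" for n m t
    by (rule ctrl_pair_mono[OF tele[OF that]]) (use M in \<open>simp add: algebra_simps\<close>)
  have conv: "convergent (\<lambda>n. fst (u n t) \<xi>)" "convergent (\<lambda>n. snd (u n t) \<xi>)"
    if t: "t \<in> {0..T}" and \<xi>: "\<xi> \<in> {0..1}" for t \<xi>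
  proof -
    note b = ctrl_pair_norm[OF near[OF t] \<xi>]
    show "convergent (\<lambda>n. fst (u n t) \<xi>)"
      by (rule geometric_convergent[of _ "4 * M * ?e t"]) (use b(1) in \<open>simp add: mult_ac\<close>)
    show "convergent (\<lambda>n. snd (u n t) \<xi>)"
      by (rule geometric_convergent[of _ "9 * (4 * M * ?e t)"]) (use b(2) in \<open>simp add: mult_ac\<close>)
  qed
  \<comment> \<open>Restriction outside the domain makes the limit an extensional function, as fixed points must be.\<close>
  define y where "y = (\<lambda>t\<in>{0..T}. (\<lambda>\<xi>\<in>{0..1}. lim (\<lambda>n. fst (u n t) \<xi>), \<lambda>\<xi>\<in>{0..1}. lim (\<lambda>n. snd (u n t) \<xi>)))"
  have lim: "pair_limit (\<lambda>n. u n t) (y t)" if "t \<in> {0..T}" for t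
    using conv[OF that] that by (auto simp: pair_limit_def y_def convergent_LIMSEQ_iff)
  have close: "ctrl_pair (4 * M * (1/2)^n * ?e t) (controlled_diff (y t) (u n t))" if t: "t \<in> {0..T}" for n t
    by (rule ctrl_pair_limit[OF _ pair_limit_diff[OF lim[OF t] pair_limit_const]])
       (use near[OF t] in \<open>auto simp: eventually_sequentially\<close>)
  have y_adm: "admissible M T y"
  proof (rule admissibleI_lipschitz)
    fix t assume t: "t \<in> {0..T}"
    show "fst (y t) 0 = fst (y t) 1"
      using t admissibleD(1)[OF u_adm t] by (simp add: y_def)
    show "ctrl_pair M (y t)"
      by (rule ctrl_pair_limit[OF _ lim[OF t]]) (use admissibleD(2)[OF u_adm t] in simp)
    fix s assume s: "s \<in> {0..T}"
    show "ctrl_pair (transport_growth B M * \<bar>s - t\<bar>) (controlled_diff (y s) (y t))"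
    proof (rule ctrl_pair_limit[OF _ pair_limit_diff[OF lim[OF s] lim[OF t]]])
      have "ctrl_pair (transport_growth B M * \<bar>s - t\<bar>) (controlled_diff (u (Suc n) s) (u (Suc n) t))" for n
        unfolding u_Suc by (rule evolution_map_lipschitz[OF u_adm s t])
      then show "\<forall>\<^sub>F n in sequentially. ctrl_pair (transport_growth B M * \<bar>s - t\<bar>) (controlled_diff (u n s) (u n t))"
        by (subst eventually_sequentially_Suc[symmetric]) simp
    qed
  qed
  have "F T y = y"
  proof (rule evolution_ext[OF F_extensional])
    show "y \<in> extensional {0..T}" by (simp add: y_def)
    show "fst (y t) \<in> extensional {0..1} \<and> snd (y t) \<in> extensional {0..1}" if "t \<in> {0..T}" for t
      using that by (simp add: y_def)
    fix t \<xi> :: real assume t: "t \<in> {0..T}" and \<xi>: "\<xi> \<in> {0..1}"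
    have Fy: "ctrl_pair (4 * M * (1/2)^n / 2 * ?e t) (controlled_diff (F T y t) (u (Suc n) t))" for n
      unfolding u_Suc by (rule evolution_map_contraction[OF y_adm u_adm _ close t]) (use M in auto)
    have "ctrl_pair (4 * M * ?e t * (1/2)^n) (controlled_diff (F T y t) (y t))" for n
    proof (rule ctrl_pair_mono[OF ctrl_pair_diff_trans[OF Fy ctrl_pair_diff_sym[OF close[OF t, of "Suc n"]]]])
      show "4 * M * (1/2)^n / 2 * ?e t + 4 * M * (1/2)^Suc n * ?e t \<le> 4 * M * ?e t * (1/2)^n"
        by (simp add: mult_ac)
    qed
    note b = ctrl_pair_norm[OF this \<xi>]
    have "fst (F T y t) \<xi> - fst (y t) \<xi> = 0"
      by (rule half_power_times_le_imp_zero[OF b(1)])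
    moreover have "snd (F T y t) \<xi> - snd (y t) \<xi> = 0"
      by (rule half_power_times_le_imp_zero[of _ "9 * (4 * M * ?e t)"]) (use b(2) in \<open>simp add: mult_ac\<close>)
    ultimately show "fst (F T y t) \<xi> = fst (y t) \<xi> \<and> snd (F T y t) \<xi> = snd (y t) \<xi>" by simp
  qed
  with y_adm show ?thesis unfolding M_def by blast
qed

lemma controlled_evolutionsI:
  assumes y: "admissible M T y" and ext: "y \<in> extensional {0..T}"
    "\<And>t. t \<in> {0..T} \<Longrightarrow> fst (y t) \<in> extensional {0..1} \<and> snd (y t) \<in> extensional {0..1}"
  shows "y \<in> controlled_evolutions \<gamma> X T"
proof -
  have "((\<lambda>s. D_norm_star \<gamma> X (controlled_diff (y s) (y t))) \<longlongrightarrow> 0) (at t within {0..T})" if t: "t \<in> {0..T}" for t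
  proof (rule order_tendstoI)
    fix a :: ennreal assume "0 < a"
    then obtain b where b: "0 < b" "b < a" using dense by blast
    then obtain r where r: "b = ennreal r" "r > 0"
      by (cases b) (auto simp: ennreal_less_zero_iff)
    then have "r / 168 > 0" by simp
    from admissibleD(3)[OF y t this] obtain \<delta> where \<delta>: "\<delta> > 0"
      "\<And>s. s \<in> {0..T} \<Longrightarrow> \<bar>s - t\<bar> < \<delta> \<Longrightarrow> ctrl_pair (r / 168) (controlled_diff (y s) (y t))" by blast
    have "D_norm_star \<gamma> X (controlled_diff (y s) (y t)) < a" if "s \<in> {0..T}" "dist s t < \<delta>" for s
      using ctrl_pair_imp_D_norm_star(5)[OF \<delta>(2)[OF that[unfolded dist_real_def]]] b r by auto
    then show "\<forall>\<^sub>F s in at t within {0..T}. D_norm_star \<gamma> X (controlled_diff (y s) (y t)) < a"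
      using \<delta>(1) by (auto simp: eventually_at)
  qed auto
  then show ?thesis
    using ext ctrl_pair_imp_controlled_space[OF admissibleD(2,1)[OF y]] by (simp add: controlled_evolutions_def)
qed

text \<open>Local boundedness follows from continuity, and bisection of \<open>[0,T]\<close> makes it global.\<close>

lemma controlled_evolutions_admissible:
  assumes T: "T > 0" and y: "y \<in> controlled_evolutions \<gamma> X T"
  shows "\<exists>M. admissible M T y"
proof -
  have sp: "y t \<in> controlled_space \<gamma> X" if "t \<in> {0..T}" for t
    using y that by (simp add: controlled_evolutions_def)
  have cont: "\<exists>\<delta>>0. \<forall>s\<in>{0..T}. \<bar>s - t\<bar> < \<delta> \<longrightarrow> ctrl_pair e (controlled_diff (y s) (y t))"
    if t: "t \<in> {0..T}" and e: "e > 0" for t e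
  proof -
    have "\<forall>\<^sub>F s in at t within {0..T}. D_norm_star \<gamma> X (controlled_diff (y s) (y t)) < ennreal e"
      using y t e by (intro order_tendstoD(2)[where y = 0]) (auto simp: controlled_evolutions_def)
    then obtain \<delta> where \<delta>: "\<delta> > 0" "\<And>s. s \<in> {0..T} \<Longrightarrow> s \<noteq> t \<Longrightarrow> dist s t < \<delta> \<Longrightarrow>
        D_norm_star \<gamma> X (controlled_diff (y s) (y t)) < ennreal e"
      unfolding eventually_at by blast
    have "ctrl_pair e (controlled_diff (y s) (y t))" if "s \<in> {0..T}" "\<bar>s - t\<bar> < \<delta>" for s
    proof (cases "s = t")
      case True
      then show ?thesis using ctrl_pair_mono[OF ctrl_pair_diff_self] e by simp
    next
      case False
      then show ?thesis
        using \<delta>(2)[OF that(1) False] that(2) e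
        by (intro D_norm_star_imp_ctrl_pair) (auto simp: dist_real_def)
    qed
    then show ?thesis using \<delta>(1) by blast
  qed
  have "\<exists>M. \<forall>s\<in>{0..T}. s \<in> {0..T} \<longrightarrow> ctrl_pair M (y s)"
  proof (rule Bolzano[of 0 T "\<lambda>a b. \<exists>M. \<forall>s\<in>{a..b}. s \<in> {0..T} \<longrightarrow> ctrl_pair M (y s)"])
    fix a b c :: real
    assume "\<exists>M. \<forall>s\<in>{a..b}. s \<in> {0..T} \<longrightarrow> ctrl_pair M (y s)" "\<exists>M. \<forall>s\<in>{b..c}. s \<in> {0..T} \<longrightarrow> ctrl_pair M (y s)"
    then obtain M N where MN: "\<And>s. s \<in> {a..b} \<Longrightarrow> s \<in> {0..T} \<Longrightarrow> ctrl_pair M (y s)"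
      "\<And>s. s \<in> {b..c} \<Longrightarrow> s \<in> {0..T} \<Longrightarrow> ctrl_pair N (y s)" by blast
    have "ctrl_pair (max M N) (y s)" if "s \<in> {a..c}" "s \<in> {0..T}" for s
      using MN[of s] that by (cases "s \<le> b") (auto intro: ctrl_pair_mono)
    then show "\<exists>M. \<forall>s\<in>{a..c}. s \<in> {0..T} \<longrightarrow> ctrl_pair M (y s)" by blast
  next
    fix t assume "0 \<le> t" "t \<le> T"
    then have t: "t \<in> {0..T}" by simp
    obtain N where N: "ctrl_pair N (y t)" using controlled_space_imp_ctrl_pair(1)[OF sp[OF t]] by blast
    obtain \<delta> where \<delta>: "\<delta> > 0" "\<And>s. s \<in> {0..T} \<Longrightarrow> \<bar>s - t\<bar> < \<delta> \<Longrightarrow> ctrl_pair 1 (controlled_diff (y s) (y t))"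
      using cont[OF t, of 1] by auto
    have "ctrl_pair (1 + N) (y s)" if "a \<le> t" "t \<le> b" "b - a < \<delta>" "s \<in> {a..b}" "s \<in> {0..T}" for a b s
      using ctrl_pair_from_diff[OF \<delta>(2)[OF that(5)] N] that by auto
    then show "\<exists>d>0. \<forall>a b. a \<le> t \<and> t \<le> b \<and> b - a < d \<longrightarrow> (\<exists>M. \<forall>s\<in>{a..b}. s \<in> {0..T} \<longrightarrow> ctrl_pair M (y s))"
      using \<delta>(1) by blast
  qed (use T in simp)
  then obtain M where "\<And>s. s \<in> {0..T} \<Longrightarrow> ctrl_pair M (y s)" by blast
  then show ?thesis
    using cont controlled_space_imp_ctrl_pair(2)[OF sp] unfolding admissible_def by blast
qed

lemma unique_evolution:
  assumes T: "T > 0" and small: "transport_growth B (\<kappa> + 1) * T \<le> 1"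
  shows "\<exists>!Y. Y \<in> controlled_evolutions \<gamma> X T \<and> F T Y = Y"
proof -
  obtain y where y: "admissible (\<kappa> + 1) T y" "F T y = y" using fixed_point_exists[OF assms] by blast
  have ext: "z \<in> extensional {0..T} \<and> (\<forall>t\<in>{0..T}. fst (z t) \<in> extensional {0..1} \<and> snd (z t) \<in> extensional {0..1})"
    if "F T z = z" for z
    using F_extensional[where T = T and y = z] that by metis
  show ?thesis
  proof (rule ex1I)
    show "y \<in> controlled_evolutions \<gamma> X T \<and> F T y = y"
      using controlled_evolutionsI[OF y(1)] ext[OF y(2)] y(2) by blast
    fix z assume z: "z \<in> controlled_evolutions \<gamma> X T \<and> F T z = z"
    then obtain M where M: "admissible M T z" using controlled_evolutions_admissible[OF T] by blast
    \<comment> \<open>A fixed point need not lie in the ball of the iteration, but some ball contains both.\<close>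
    define N where "N = max M (\<kappa> + 1)"
    have "admissible N T z" "admissible N T y"
      using admissible_mono[OF M] admissible_mono[OF y(1)] by (auto simp: N_def)
    then have eq: "fst (z t) \<xi> = fst (y t) \<xi> \<and> snd (z t) \<xi> = snd (y t) \<xi>"
      if "t \<in> {0..T}" "\<xi> \<in> {0..1}" for t \<xi>
      using fixed_point_unique that z y(2) by blast
    show "z = y"
      using ext[OF conjunct2[OF z]] ext[OF y(2)] eq by (intro evolution_ext) auto
  qed
qed

end

theorem theorem3:
  fixes \<gamma> :: real
    and X :: "real \<Rightarrow> real^3"
    and XX :: "real \<Rightarrow> real \<Rightarrow> real^3^3"
    and K :: ennreal
  assumes "\<gamma> > 1/3"
    and "rough_path \<gamma> X XX"
  shows "\<exists>T0>0. \<forall>A :: real^3 \<Rightarrow> real^3^3.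
           times_differentiable 5 A \<longrightarrow> field_norm 4 (grad A) < \<infinity> \<longrightarrow> field_norm 3 (grad A) = K \<longrightarrow>
           (\<forall>T. 0 < T \<and> T \<le> T0 \<longrightarrow>
              (\<exists>!Y. Y \<in> controlled_evolutions \<gamma> X T \<and> evolution_map A X XX T Y = Y))"
proof -
  obtain \<kappa> where "rough \<gamma> \<kappa> X XX" using rough_path_imp_rough[OF assms] by blast
  then interpret rough \<gamma> \<kappa> X XX .
  define B where "B = 81 * enn2real K"
  let ?g = "transport_growth B (\<kappa> + 1)"
  have g: "?g \<ge> 0"
    unfolding transport_growth_def B_def using \<kappa> K_nonneg(1)[of "\<kappa> + 1"] growth_nonneg[of "\<kappa> + 1"] by simp
  show ?thesis
  \<comment> \<open>A lifetime with \<open>?g * T \<le> 1\<close>; adding one covers \<open>?g = 0\<close>. It depends on the kernel only through \<open>K\<close>.\<close>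
  proof (intro exI[of _ "1 / (?g + 1)"] conjI allI impI)
    show "1 / (?g + 1) > 0" using g by simp
    fix A :: "real^3 \<Rightarrow> real^3^3" and T :: real
    assume d: "times_differentiable 5 A" and n4: "field_norm 4 (grad A) < \<infinity>"
      and K: "field_norm 3 (grad A) = K" and T: "0 < T \<and> T \<le> 1 / (?g + 1)"
    have "field_norm 3 (grad A) \<le> field_norm 4 (grad A)"
      unfolding field_norm_def by (intro sum_mono2) auto
    then have n3: "field_norm 3 (grad A) < \<infinity>" using n4 by (rule le_less_trans)
    have d4: "times_differentiable 4 A" using d by (simp add: times_differentiable_def)
    have "partials_bounded 4 (enn2real K) A"
      using field_norm_imp_partials_bounded[of 3 A] d4 n3 by (simp add: K)
    then have A3: "smooth3 B A" unfolding B_def by (rule partials_bounded_smooth3)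
    have "partials_bounded 5 (enn2real (field_norm 4 (grad A))) A"
      using field_norm_imp_partials_bounded[of 4 A] d n4 by simp
    then have A4: "smooth4 (243 * enn2real (field_norm 4 (grad A))) A" by (rule partials_bounded_smooth4)
    interpret filament \<gamma> \<kappa> X XX A B "243 * enn2real (field_norm 4 (grad A))"
      by unfold_locales (rule A3, rule A4)
    have "?g * T \<le> (?g + 1) * T" using T by (intro mult_right_mono) auto
    also have "\<dots> \<le> (?g + 1) * (1 / (?g + 1))" using T g by (intro mult_left_mono) auto
    also have "\<dots> = 1" using g by simp
    finally show "\<exists>!Y. Y \<in> controlled_evolutions \<gamma> X T \<and> evolution_map A X XX T Y = Y"
      using T by (intro unique_evolution) auto
  qed
qed

end
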